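(* Let $W_n$, $n\in\mathbb{N}_0$, be the intrinsic martingale of a supercritical weighted branching process normalized by $m(1)=1$, with almost sure limit $W$, as described in the context, and suppose $\mathbb{P}\{W_1=1\}<1$. Let $a>0$ and $p\in(1,2)$, and consider the series $$A:=\sum_{n\ge 0}e^{an}(W-W_n).$$ (i) If $$\mathbb{E}W_1^r<\infty\quad\text{and}\quad e^a m^{1/r}(r)<1\quad\text{for some } r\in[p,2],$$ then $A$ converges in $L_p$ and almost surely. (ii) Conversely, if $A$ converges in $L_p$, then $$\mathbb{E}W_1^p<\infty\quad\text{and}\quad \inf_{r\in[p,2]}e^a m^{1/r}(r)\le 1.$$
   Context: Let $\mathbb{N}_0=\{0,1,2,\dots\}$, $\mathbb{N}=\{1,2,\dots\}$, and let $\mathbf{V}=\bigcup_{n\ge0}\mathbb{N}^n$ be the infinite Ulam-Harris tree of finite sequences $v=v_1\dots v_n$ with root $\varnothing$ ($\mathbb{N}^0=\{\varnothing\}$); $|v|$ is the length of $v$, and $vi$, $i\in\mathbb{N}$, are the successors of $v$. With each edge $(v,vi)$ a nonnegative random variable $L_i(v)$ (weight) is associated. The sequences $(L_i(v))_{i\in\mathbb{N}}$, $v\in\mathbf{V}$, are independent and identically distributed (arbitrary dependence among the weights $L_i(v)$, $i\in\mathbb{N}$, for the same $v$ is allowed). Define $L_\varnothing:=1$ and $L_{vi}:=L_i(v)L_v$. The point process $\sum_{i:\,L_i(\varnothing)>0}\delta_{\log L_i(\varnothing)}$ on $\mathbb{R}$ is locally finite, and its total number of points $J:=\#\{i\in\mathbb{N}:L_i(\varnothing)>0\}$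 may be infinite with positive probability. For $n\in\mathbb{N}_0$ and $r>0$ put $Z_n:=\sum_{|v|=n}L_v$ and $m(r):=\mathbb{E}\sum_{|v|=1}L_v^r\in[0,\infty]$; $m^{1/r}(r)$ means $(m(r))^{1/r}$. Standing assumptions: $\mathbb{E}J>1$ (supercriticality) and $m(1)=1$. With $\mathcal{F}_0$ trivial and $\mathcal{F}_n=\sigma(L_i(v):i\in\mathbb{N},|v|<n)$, the sequence $W_n:=Z_n/m^n(1)=Z_n$ is a nonnegative mean-one martingale with respect to $(\mathcal{F}_n)_{n\ge0}$ (the intrinsic martingale), and $W$ denotes its almost sure limit. Convergence of a series in $L_p$ (or a.s.) means convergence of its partial sums in $L_p$ (or a.s.). *)

theory Defs
  imports "HOL-Probability.Probability"
begin

text \<open>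
  Nodes of the infinite Ulam-Harris tree are finite sequences of labels, i.e. elements of
  \<^typ>\<open>nat list\<close>; the root is \<^term>\<open>[]\<close> and the successors of \<open>v\<close> are \<open>v @ [i]\<close>. Labels
  start at 0 rather than at 1. The weight of the edge from \<open>v\<close> to \<open>v @ [i]\<close>, written
  \<open>L\<^sub>i(v)\<close> on paper, is \<open>L v i\<close>, a random variable on the probability space \<open>M\<close>.
\<close>

locale weighted_branching_process = prob_space M
  for M :: "'a measure" and L :: "nat list \<Rightarrow> nat \<Rightarrow> 'a \<Rightarrow> real" +
  assumes weight_nonneg: "\<And>v i \<omega>. \<omega> \<in> space M \<Longrightarrow> 0 \<le> L v i \<omega>"
    \<comment> \<open>independence of the whole sequences \<open>(L v i)\<^sub>i\<close>, regarded as random elements of the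
      product space; this includes their measurability and allows arbitrary dependence in \<open>i\<close>\<close>
    and indep_weights:
      "indep_vars (\<lambda>_. Pi\<^sub>M UNIV (\<lambda>_. borel)) (\<lambda>v \<omega> i. L v i \<omega>) (UNIV :: nat list set)"
    and identically_distributed_weights:
      "\<And>v. distr M (Pi\<^sub>M UNIV (\<lambda>_. borel)) (\<lambda>\<omega> i. L v i \<omega>) =
            distr M (Pi\<^sub>M UNIV (\<lambda>_. borel)) (\<lambda>\<omega> i. L [] i \<omega>)"
    and locally_finite:
      "AE \<omega> in M. \<forall>x y. finite {i. L [] i \<omega> > 0 \<and> ln (L [] i \<omega>) \<in> {x..y}}"

function path_weight :: "(nat list \<Rightarrow> nat \<Rightarrow> 'a \<Rightarrow> real) \<Rightarrow> nat list \<Rightarrow> 'a \<Rightarrow> real" where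
  "path_weight L [] \<omega> = 1"
| "path_weight L (v @ [i]) \<omega> = L v i \<omega> * path_weight L v \<omega>"
  by (auto, metis rev_exhaust)
termination
  by (relation "Wellfounded.measure (\<lambda>(_, v, _). length v)") auto

text \<open>
  Sums of nonnegative terms over the countably infinite generations are taken in
  \<^typ>\<open>ennreal\<close>, as integrals with respect to the counting measure.
\<close>

definition offspring_number :: "(nat list \<Rightarrow> nat \<Rightarrow> 'a \<Rightarrow> real) \<Rightarrow> 'a \<Rightarrow> ennreal" where
  "offspring_number L \<omega> = emeasure (count_space UNIV) {i. L [] i \<omega> > 0}"

definition generation_sum :: "(nat list \<Rightarrow> nat \<Rightarrow> 'a \<Rightarrow> real) \<Rightarrow> nat \<Rightarrow> 'a \<Rightarrow> ennreal" where
  "generation_sum L n \<omega> =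
     (\<integral>\<^sup>+ v. ennreal (path_weight L v \<omega>) \<partial>count_space {v. length v = n})"

definition weight_moment :: "'a measure \<Rightarrow> (nat list \<Rightarrow> nat \<Rightarrow> 'a \<Rightarrow> real) \<Rightarrow> real \<Rightarrow> ennreal" where
  "weight_moment M L r =
     (\<integral>\<^sup>+ \<omega>. (\<integral>\<^sup>+ v. ennreal (path_weight L v \<omega> powr r)
        \<partial>count_space {v. length v = 1}) \<partial>M)"

text \<open>
  The conversion to a real number is harmless: \<^const>\<open>generation_sum\<close> has finite mean when
  \<open>weight_moment M L 1 = 1\<close>, hence is almost surely finite.
\<close>

definition intrinsic_martingale ::
  "'a measure \<Rightarrow> (nat list \<Rightarrow> nat \<Rightarrow> 'a \<Rightarrow> real) \<Rightarrow> nat \<Rightarrow> 'a \<Rightarrow> real" where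
  "intrinsic_martingale M L n \<omega> = enn2real (generation_sum L n \<omega> / weight_moment M L 1 ^ n)"

text \<open>Real powers on \<open>[0,\<infinity>]\<close>, for exponents \<open>s > 0\<close>.\<close>

definition ennreal_powr :: "ennreal \<Rightarrow> real \<Rightarrow> ennreal" where
  "ennreal_powr x s = (if x = \<infinity> then \<infinity> else ennreal (enn2real x powr s))"

text \<open>Convergence in \<open>L\<^sub>p\<close>: the sequence and its limit are in \<open>L\<^sub>p\<close>, and \<open>E |X\<^sub>n - Y|\<^sup>p \<rightarrow> 0\<close>.\<close>

definition in_Lp :: "'a measure \<Rightarrow> real \<Rightarrow> ('a \<Rightarrow> real) \<Rightarrow> bool" where
  "in_Lp M p X \<longleftrightarrow> X \<in> borel_measurable M \<and> (\<integral>\<^sup>+ \<omega>. ennreal (\<bar>X \<omega>\<bar> powr p) \<partial>M) < \<infinity>"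

definition converges_in_Lp :: "'a measure \<Rightarrow> real \<Rightarrow> (nat \<Rightarrow> 'a \<Rightarrow> real) \<Rightarrow> bool" where
  "converges_in_Lp M p X \<longleftrightarrow>
     (\<forall>n. in_Lp M p (X n)) \<and>
     (\<exists>Y. in_Lp M p Y \<and>
        (\<lambda>n. \<integral>\<^sup>+ \<omega>. ennreal (\<bar>X n \<omega> - Y \<omega>\<bar> powr p) \<partial>M) \<longlonglongrightarrow> 0)"

end

theory Submission
  imports Defs
begin

text \<open>
  The increments \<open>D\<^sub>n = W\<^sub>n\<^sub>+\<^sub>1 - W\<^sub>n\<close> are sums of \<open>L\<^sub>v \<xi>\<^sub>v\<close> over \<open>|v| = n\<close>, where the centred variables \<open>\<xi>\<^sub>v\<close> are
  distributed like \<open>W\<^sub>1 - 1\<close> and independent of the past.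

  (i) The von Bahr--Esseen inequality gives \<open>E |D\<^sub>n|\<^sup>r \<le> C m(r)\<^sup>n\<close>, hence \<open>E |D\<^sub>n|\<^sup>p \<le> C' \<rho>\<^sup>p\<^sup>n\<close> for some
  \<open>\<rho> < e\<^sup>-\<^sup>a\<close>, and all sums are dominated by a multiple of the sum of \<open>e\<^sup>a\<^sup>n |D\<^sub>n|\<close>, which lies in \<open>L\<^sub>p\<close>.

  (ii) Convergence forces \<open>e\<^sup>a\<^sup>n D\<^sub>n \<rightarrow> 0\<close> in \<open>L\<^sub>p\<close>. Let \<open>u\<close> be one minus the modulus of the
  characteristic function of \<open>W\<^sub>1 - 1\<close>. Conditioning on the past bounds that of \<open>D\<^sub>n\<close> at \<open>s\<close> by the
  expected product of \<open>1 - u(s L\<^sub>v)\<close> over any finite subset of the generation. If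
  \<open>e\<^sup>a\<^sup>r m(r) \<ge> c > 1\<close> on all of \<open>[p,2]\<close>, then, after truncating the weights, a suitable tilt of
  their intensity measure admits a bounded function \<open>U \<le> u\<close> that is subharmonic for the branching
  recursion; iterating the recursion one generation at a time bounds the expected product away from 1 well enough
  to keep \<open>e\<^sup>a\<^sup>p\<^sup>n E |D\<^sub>n|\<^sup>p\<close> away from 0.
\<close>

text \<open>In (ii) the two ends of \<open>[p,2]\<close> have separate origins: \<open>p\<close> is
  the order in the upper bound \<open>1 - |E exp(is D_n)| <= 2 |s|^p E|D_n|^p\<close>, while 2 is
  the order to which \<open>u\<close> vanishes at 0, even if \<open>W_1\<close> has no second
  moment. Hence \<open>U\<close> must be \<open>O(x^2)\<close> at 0. If \<open>n\<close> generations
  shrink the lower bound by \<open>\<theta>^n\<close> while \<open>s\<close> is multiplied by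
  \<open>g^n\<close>, the conclusion needs \<open>\<theta> = (g e^{-a})^p\<close>. With
  \<open>g = e^{a-d}\<close> this is \<open>\<theta> = e^{-dp}\<close>, and \<open>d \<ge> 0\<close>
  prevents the bounds from growing. The drift \<open>d\<close> follows the tilted walk when it moves
  to the right.

  The recursion is not linear: it contains one minus a product, not a sum. The strict inequality
  \<open>c > 1\<close> leaves a factor \<open>1 + \<epsilon>\<close> of room, and a small enough
  multiple of \<open>U\<close> keeps the loss within it. Smallness must be uniform, so only finitely
  many children per node are kept; discarding factors of modulus at most 1 is harmless. Thus weights
  are truncated in the recursion, while \<open>W_1\<close> and its characteristic function stay
  whole.\<close>

section \<open>Inequalities for real powers\<close>

lemma powr_add_le_add_powr:
  fixes a b \<beta> :: real
  assumes "0 \<le> a" "0 \<le> b" "0 < \<beta>" "\<beta> \<le> 1"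
  shows "(a + b) powr \<beta> \<le> a powr \<beta> + b powr \<beta>"
proof (cases "a + b = 0")
  case False
  then have s: "a + b > 0" using assms by linarith
  have *: "t / (a + b) \<le> t powr \<beta> / (a + b) powr \<beta>" if "0 \<le> t" "t \<le> a + b" for t
  proof -
    have "(t / (a + b)) powr 1 \<le> (t / (a + b)) powr \<beta>"
      using that s assms by (intro powr_mono') (auto simp: field_simps)
    then show ?thesis using that s by (simp add: powr_divide)
  qed
  have "1 = a / (a + b) + b / (a + b)" using s by (simp add: add_divide_distrib[symmetric])
  also have "\<dots> \<le> (a powr \<beta> + b powr \<beta>) / (a + b) powr \<beta>"
    using *[of a] *[of b] assms by (simp add: add_divide_distrib)
  finally show ?thesis using s by (simp add: field_simps)
qed (use assms in auto)

lemma powr_diff_le: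
  fixes a b \<beta> :: real
  assumes "0 \<le> a" "0 \<le> b" "0 < \<beta>" "\<beta> \<le> 1"
  shows "\<bar>a powr \<beta> - b powr \<beta>\<bar> \<le> \<bar>a - b\<bar> powr \<beta>"
proof (cases "a \<le> b")
  case True
  then have "b powr \<beta> \<le> a powr \<beta> + (b - a) powr \<beta>"
    using powr_add_le_add_powr[of a "b - a" \<beta>] assms by simp
  moreover have "a powr \<beta> \<le> b powr \<beta>" using True assms by (intro powr_mono2) auto
  ultimately show ?thesis using True by (simp add: abs_if)
next
  case False
  then have "a powr \<beta> \<le> b powr \<beta> + (a - b) powr \<beta>"
    using powr_add_le_add_powr[of b "a - b" \<beta>] assms by simp
  moreover have "b powr \<beta> \<le> a powr \<beta>" using False assms by (intro powr_mono2) auto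
  ultimately show ?thesis using False by (simp add: abs_if)
qed

text \<open>The derivative \<open>r t^(r-1)\<close> is Hoelder continuous of order
  \<open>r - 1 \<le> 1\<close> by \<open>powr_diff_le\<close>, so the error in the mean value
  theorem is at most \<open>r |y|^r\<close>; the 2 bounds \<open>r\<close>.\<close>

lemma powr_taylor_bound_nonneg:
  fixes x y r :: real
  assumes r: "1 < r" "r \<le> 2" and x: "0 \<le> x" "0 \<le> x + y"
  shows "(x + y) powr r \<le> x powr r + r * x powr (r - 1) * y + 2 * \<bar>y\<bar> powr r"
proof (cases "y = 0")
  case False
  define lo hi where "lo = min x (x + y)" and "hi = max x (x + y)"
  have lh: "lo < hi" "0 \<le> lo" using False x by (auto simp: lo_def hi_def)
  have "\<exists>\<xi>\<in>{lo<..<hi}. hi powr r - lo powr r = (\<lambda>h. h * (r * \<xi> powr (r - 1))) (hi - lo)"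
  proof (rule mvt[OF lh(1)])
    show "continuous_on {lo..hi} (\<lambda>t. t powr r)"
      using lh r by (intro continuous_on_powr') (auto intro!: continuous_intros)
    fix t assume t: "lo < t" "t < hi"
    have "((\<lambda>t. t powr r) has_field_derivative r * t powr (r - 1)) (at t)"
      using t lh by (auto intro!: derivative_eq_intros)
    then show "((\<lambda>t. t powr r) has_derivative (\<lambda>h. h * (r * t powr (r - 1)))) (at t)"
      by (simp add: has_field_derivative_def mult_commute_abs)
  qed auto
  then obtain \<xi> where \<xi>: "lo < \<xi>" "\<xi> < hi"
    and e: "hi powr r - lo powr r = (hi - lo) * (r * \<xi> powr (r - 1))" by auto
  have e': "(x + y) powr r - x powr r = y * (r * \<xi> powr (r - 1))"
  proof (cases "y > 0")
    case True then show ?thesis using e by (simp add: lo_def hi_def)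
  next
    case F: False
    then have "lo = x + y" "hi = x" by (auto simp: lo_def hi_def)
    then show ?thesis using e by (simp add: algebra_simps)
  qed
  have "\<bar>\<xi> powr (r - 1) - x powr (r - 1)\<bar> \<le> \<bar>\<xi> - x\<bar> powr (r - 1)"
    using \<xi> lh x r by (intro powr_diff_le) auto
  also have "\<dots> \<le> \<bar>y\<bar> powr (r - 1)"
    using \<xi> r by (intro powr_mono2) (auto simp: lo_def hi_def split: if_splits)
  finally have d: "\<bar>\<xi> powr (r - 1) - x powr (r - 1)\<bar> \<le> \<bar>y\<bar> powr (r - 1)" .
  have "(x + y) powr r - x powr r - r * x powr (r - 1) * y
      = r * (y * (\<xi> powr (r - 1) - x powr (r - 1)))"
    using e' by (simp add: algebra_simps)
  also have "\<dots> \<le> r * (\<bar>y\<bar> * \<bar>y\<bar> powr (r - 1))"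
  proof (rule mult_left_mono)
    have "y * (\<xi> powr (r - 1) - x powr (r - 1)) \<le> \<bar>y * (\<xi> powr (r - 1) - x powr (r - 1))\<bar>" by simp
    also have "\<dots> \<le> \<bar>y\<bar> * \<bar>y\<bar> powr (r - 1)"
      unfolding abs_mult using d by (intro mult_left_mono) auto
    finally show "y * (\<xi> powr (r - 1) - x powr (r - 1)) \<le> \<bar>y\<bar> * \<bar>y\<bar> powr (r - 1)" .
  qed (use r in simp)
  also have "\<dots> = r * \<bar>y\<bar> powr r" using False by (simp add: powr_diff)
  also have "\<dots> \<le> 2 * \<bar>y\<bar> powr r" using r by (intro mult_right_mono) auto
  finally show ?thesis by simp
qed (use x in simp)

text \<open>The first-order term has mean 0 if \<open>y\<close> is centred and independent of
  \<open>x\<close>; this is what makes \<open>r\<close>-th moments of sums additive up to a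
  constant. Where \<open>x + y\<close> has the opposite sign to \<open>x\<close>,
  \<open>|x + y| \<le> |y|\<close> and the first-order term is at least \<open>-2 |y|^r\<close>;
  negative \<open>x\<close> follow by reflection.\<close>

lemma powr_abs_taylor_bound:
  fixes x y r :: real
  assumes r: "1 < r" "r \<le> 2"
  shows "\<bar>x + y\<bar> powr r \<le> \<bar>x\<bar> powr r + r * (sgn x * \<bar>x\<bar> powr (r - 1)) * y + 4 * \<bar>y\<bar> powr r"
proof -
  have main: "\<bar>x + y\<bar> powr r \<le> \<bar>x\<bar> powr r + r * (sgn x * \<bar>x\<bar> powr (r - 1)) * y + 4 * \<bar>y\<bar> powr r"
    if x: "x \<ge> 0" for x y :: real
  proof (cases "x + y \<ge> 0")
    case True
    have "r * (sgn x * \<bar>x\<bar> powr (r - 1)) * y = r * x powr (r - 1) * y"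
      using x by (cases "x = 0") auto
    then show ?thesis using powr_taylor_bound_nonneg[OF r x True] x True
      by (smt (verit) powr_ge_zero)
  next
    case False
    then have y: "y < 0" "x < \<bar>y\<bar>" using x by auto
    have "\<bar>x + y\<bar> powr r \<le> \<bar>y\<bar> powr r" using y x False r by (intro powr_mono2) auto
    moreover have "r * (sgn x * \<bar>x\<bar> powr (r - 1)) * \<bar>y\<bar> \<le> 2 * \<bar>y\<bar> powr r"
    proof -
      have "r * (sgn x * \<bar>x\<bar> powr (r - 1)) * \<bar>y\<bar> \<le> 2 * (1 * \<bar>y\<bar> powr (r - 1)) * \<bar>y\<bar>"
        using x y r by (intro mult_mono powr_mono2) (auto simp: sgn_if)
      also have "\<dots> = 2 * \<bar>y\<bar> powr r" using y by (simp add: powr_diff)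
      finally show ?thesis .
    qed
    moreover have "r * (sgn x * \<bar>x\<bar> powr (r - 1)) * y = - (r * (sgn x * \<bar>x\<bar> powr (r - 1)) * \<bar>y\<bar>)"
      using y by simp
    moreover have "0 \<le> \<bar>x\<bar> powr r" "0 \<le> \<bar>y\<bar> powr r" by auto
    ultimately show ?thesis by linarith
  qed
  show ?thesis
  proof (cases "x \<ge> 0")
    case False
    then have "-x \<ge> 0" by simp
    from main[OF this, of "- y"] show ?thesis by (simp add: sgn_minus algebra_simps abs_minus_commute)
  qed (rule main)
qed

lemma abs_add_powr_le:
  fixes x y p :: real
  assumes "0 \<le> p"
  shows "\<bar>x + y\<bar> powr p \<le> 2 powr p * (\<bar>x\<bar> powr p + \<bar>y\<bar> powr p)"
proof -
  have "\<bar>x + y\<bar> powr p \<le> (2 * max \<bar>x\<bar> \<bar>y\<bar>) powr p" using assms by (intro powr_mono2) auto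
  also have "\<dots> = 2 powr p * max \<bar>x\<bar> \<bar>y\<bar> powr p" by (simp add: powr_mult)
  also have "\<dots> \<le> 2 powr p * (\<bar>x\<bar> powr p + \<bar>y\<bar> powr p)" by (intro mult_left_mono) (auto simp: max_def)
  finally show ?thesis .
qed

text \<open>Splitting at a level \<open>c\<close> replaces Hoelder's inequality: with
  \<open>c\<close> of the order of the \<open>L_r\<close> norm, a bound on the \<open>r\<close>-th
  moment gives one of matching size on the \<open>p\<close>-th.\<close>

lemma powr_le_powr_add_powr:
  fixes x c p r :: real
  assumes "0 \<le> x" "0 < c" "0 < p" "p \<le> r"
  shows "x powr p \<le> c powr p + c powr (p - r) * x powr r"
proof (cases "x \<le> c")
  case True
  then have "x powr p \<le> c powr p" using assms by (intro powr_mono2) auto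
  then show ?thesis by (smt (verit) mult_nonneg_nonneg powr_ge_zero)
next
  case False
  have "x powr p = x powr (p - r) * x powr r" by (simp add: powr_add[symmetric])
  also have "\<dots> \<le> c powr (p - r) * x powr r"
    using False assms by (intro mult_right_mono powr_mono2') auto
  finally show ?thesis by (smt (verit) powr_ge_zero)
qed

text \<open>Jensen's inequality for the weights \<open>w\<close> normalized to mass 1. With
  geometric weights it later takes the place of Minkowski's inequality.\<close>

lemma powr_weighted_sum_le:
  fixes y :: "'i \<Rightarrow> real"
  assumes "finite I" "\<And>k. k \<in> I \<Longrightarrow> 0 \<le> w k" "\<And>k. k \<in> I \<Longrightarrow> 0 \<le> y k" "1 \<le> p" "sum w I \<le> A"
  shows "(\<Sum>k\<in>I. w k * y k) powr p \<le> A powr (p - 1) * (\<Sum>k\<in>I. w k * y k powr p)"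
proof -
  \<comment> \<open>Convexity of \<open>x powr p\<close> is used on the open half-line, so vanishing
    terms are removed beforehand.\<close>
  define J where "J = {k\<in>I. 0 < w k \<and> 0 < y k}"
  have J: "finite J" "J \<subseteq> I" using assms by (auto simp: J_def)
  have 1: "(\<Sum>k\<in>I. w k * y k) = (\<Sum>k\<in>J. w k * y k)"
    using assms J by (intro sum.mono_neutral_right) (auto simp: J_def less_le)
  have 2: "(\<Sum>k\<in>J. w k * y k powr p) \<le> (\<Sum>k\<in>I. w k * y k powr p)"
    using assms J by (intro sum_mono2) auto
  show ?thesis
  proof (cases "J = {}")
    case True
    then show ?thesis using 1 2 by (simp add: sum_nonneg assms)
  next
    case False
    define B where "B = sum w J"
    have B: "B > 0" unfolding B_def using J False by (intro sum_pos) (auto simp: J_def)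
    have BA: "B \<le> A" using assms(5) sum_mono2[of I J w] J assms unfolding B_def by force
    have "(\<Sum>k\<in>J. (w k / B) *\<^sub>R y k) powr p \<le> (\<Sum>k\<in>J. (w k / B) * y k powr p)"
    proof (rule convex_on_sum[where C = "{0<..}" and f = "\<lambda>x. x powr p" and y = y and a = "\<lambda>k. w k / B"])
      show "convex_on {0<..} (\<lambda>x. x powr p)" using assms by (intro powr_convex)
      show "sum (\<lambda>i. w i / B) J = 1" using B by (simp add: sum_divide_distrib[symmetric] B_def)
    qed (use J False B in \<open>auto simp: J_def\<close>)
    also have "(\<Sum>k\<in>J. (w k / B) * y k powr p) = (\<Sum>k\<in>J. w k * y k powr p) / B"
      by (simp add: sum_divide_distrib)
    also have "(\<Sum>k\<in>J. (w k / B) *\<^sub>R y k) = (\<Sum>k\<in>J. w k * y k) / B"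
      by (simp add: sum_divide_distrib)
    finally have "((\<Sum>k\<in>J. w k * y k) / B) powr p * B powr p \<le> (\<Sum>k\<in>J. w k * y k powr p) / B * B powr p"
      by (intro mult_right_mono) auto
    also have "((\<Sum>k\<in>J. w k * y k) / B) powr p * B powr p = (\<Sum>k\<in>J. w k * y k) powr p"
      using B by (subst powr_mult[symmetric]) auto
    also have "(\<Sum>k\<in>J. w k * y k powr p) / B * B powr p = B powr (p - 1) * (\<Sum>k\<in>J. w k * y k powr p)"
      using B by (simp add: powr_diff)
    also have "\<dots> \<le> A powr (p - 1) * (\<Sum>k\<in>I. w k * y k powr p)"
      using B BA 2 assms by (intro mult_mono powr_mono2 sum_nonneg) (auto simp: J_def)
    finally show ?thesis using 1 by simp
  qed
qed

text \<open>One minus a product is almost the sum when the sum \<open>S\<close> is small: the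
  product is at most \<open>exp (- S)\<close>, hence at most \<open>1 / (1 + S)\<close>.\<close>

lemma one_minus_prod_ge:
  fixes v :: "'i \<Rightarrow> real"
  assumes "finite I" "\<And>i. i \<in> I \<Longrightarrow> 0 \<le> v i" "\<And>i. i \<in> I \<Longrightarrow> v i \<le> 1"
  shows "(1 - sum v I) * sum v I \<le> 1 - (\<Prod>i\<in>I. 1 - v i)"
proof -
  let ?S = "sum v I"
  have S: "?S \<ge> 0" using assms by (intro sum_nonneg) auto
  have "(\<Prod>i\<in>I. 1 - v i) \<le> (\<Prod>i\<in>I. exp (- v i))"
  proof (intro prod_mono conjI)
    fix i assume "i \<in> I"
    then show "0 \<le> 1 - v i" using assms by auto
    show "1 - v i \<le> exp (- v i)" using exp_ge_add_one_self[of "- v i"] by simp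
  qed
  also have "\<dots> = exp (- ?S)" using assms(1) by (simp add: exp_sum[symmetric] sum_negf)
  also have "\<dots> \<le> 1 / (1 + ?S)"
    using exp_ge_add_one_self[of ?S] S by (simp add: exp_minus field_simps)
  also have "\<dots> \<le> 1 - (1 - ?S) * ?S"
  proof -
    \<comment> \<open>The right side expands to \<open>1 + S^3\<close>.\<close>
    have "1 \<le> (1 - (1 - ?S) * ?S) * (1 + ?S)"
      using S by (simp add: algebra_simps power2_eq_square power3_eq_cube)
    then show ?thesis using S by (simp add: field_simps)
  qed
  finally show ?thesis by simp
qed

text \<open>Interpolates between the Taylor bounds of orders 2 and 1, the former used for
  \<open>|y| \<le> 1\<close> and the latter beyond.\<close>

lemma iexp_linear_approx:
  fixes y p :: real
  assumes "1 \<le> p" "p \<le> 2"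
  shows "cmod (iexp y - 1 - \<i> * y) \<le> 2 * \<bar>y\<bar> powr p"
proof (cases "\<bar>y\<bar> \<le> 1")
  case True
  have "cmod (iexp y - 1 - \<i> * y) \<le> \<bar>y\<bar>^2 / 2"
    using iexp_approx1[of y 1] by (simp add: numeral_2_eq_2 diff_diff_eq)
  also have "\<bar>y\<bar>^2 = \<bar>y\<bar> powr 2" by (cases "y = 0") (auto simp: powr_numeral)
  also have "\<bar>y\<bar> powr 2 / 2 \<le> \<bar>y\<bar> powr p / 2"
    using True assms by (intro divide_right_mono powr_mono') auto
  finally show ?thesis by (smt (verit) powr_ge_zero field_sum_of_halves)
next
  case False
  have "cmod (iexp y - 1 - \<i> * y) \<le> 2 * \<bar>y\<bar>"
    using iexp_approx2[of y 1] by (simp add: diff_diff_eq)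
  also have "\<bar>y\<bar> \<le> \<bar>y\<bar> powr p" using False assms powr_mono[of 1 p "\<bar>y\<bar>"] by simp
  finally show ?thesis by simp
qed

section \<open>The canonical environment\<close>

text \<open>Transport along \<open>to_nat\<close> turns the integral over a countable type into a
  series of measurable terms.\<close>

lemma borel_measurable_nn_integral_count_space:
  fixes f :: "'i::countable \<Rightarrow> 'b \<Rightarrow> ennreal"
  assumes "\<And>i. f i \<in> borel_measurable M"
  shows "(\<lambda>x. \<integral>\<^sup>+ i. f i x \<partial>count_space A) \<in> borel_measurable M"
proof -
  have "(\<integral>\<^sup>+ i. f i x \<partial>count_space A) =
      (\<Sum>k. (if k \<in> to_nat ` A then f (from_nat k) x else 0))" for x
  proof -
    have "(\<integral>\<^sup>+ i. f i x \<partial>count_space A) = (\<integral>\<^sup>+ i. f (from_nat (to_nat i)) x \<partial>count_space A)" by simp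
    also have "\<dots> = (\<integral>\<^sup>+ k. f (from_nat k) x \<partial>count_space (to_nat ` A))"
      by (rule nn_integral_bij_count_space) (auto simp: bij_betw_def inj_on_def)
    also have "\<dots> = (\<integral>\<^sup>+ k. (if k \<in> to_nat ` A then f (from_nat k) x else 0) \<partial>count_space UNIV)"
      by (subst nn_integral_count_space_indicator) (auto intro!: nn_integral_cong)
    finally show ?thesis by (simp only: nn_integral_count_space_nat)
  qed
  then show ?thesis using assms by (auto intro!: borel_measurable_suminf_order)
qed

text \<open>The last label is split off, as in the recursion of \<open>path_weight\<close>, so that
  all children of one parent are summed together.\<close>

lemma nn_integral_count_space_length_Suc:
  fixes f :: "'i list \<Rightarrow> ennreal"
  shows "(\<integral>\<^sup>+ v. f v \<partial>count_space {v. length v = Suc n}) =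
    (\<integral>\<^sup>+ v. (\<integral>\<^sup>+ i. f (v @ [i]) \<partial>count_space UNIV) \<partial>count_space {v. length v = n})"
proof -
  let ?A = "{v::'i list. length v = n}"
  have "bij_betw (\<lambda>(v, i). v @ [i]) (?A \<times> UNIV) {v. length v = Suc n}"
    by (auto simp: bij_betw_def inj_on_def image_iff length_Suc_conv_rev)
  then have "(\<integral>\<^sup>+ v. f v \<partial>count_space {v. length v = Suc n}) =
      (\<integral>\<^sup>+ vi. f ((\<lambda>(v, i). v @ [i]) vi) \<partial>count_space (?A \<times> UNIV))"
    by (rule nn_integral_bij_count_space[symmetric])
  also have "\<dots> = (\<integral>\<^sup>+ vi. f ((\<lambda>(v, i). v @ [i]) vi) * indicator (?A \<times> UNIV) vi \<partial>count_space UNIV)"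
    by (rule nn_integral_count_space_indicator) simp
  also have "\<dots> = (\<integral>\<^sup>+ v. (\<integral>\<^sup>+ i. f (v @ [i]) * indicator ?A v \<partial>count_space UNIV) \<partial>count_space UNIV)"
    by (subst nn_integral_fst_count_space[symmetric]) (auto intro!: nn_integral_cong split: split_indicator)
  also have "\<dots> = (\<integral>\<^sup>+ v. (\<integral>\<^sup>+ i. f (v @ [i]) \<partial>count_space UNIV) * indicator ?A v \<partial>count_space UNIV)"
    by (auto intro!: nn_integral_cong split: split_indicator)
  also have "\<dots> = (\<integral>\<^sup>+ v. (\<integral>\<^sup>+ i. f (v @ [i]) \<partial>count_space UNIV) \<partial>count_space ?A)"
    by (rule nn_integral_count_space_indicator[symmetric]) simp
  finally show ?thesis .
qed

lemma path_weight_measurable: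
  assumes "\<And>v i. L v i \<in> borel_measurable M"
  shows "path_weight L v \<in> borel_measurable M"
  by (induction v rule: rev_induct) (use assms in \<open>auto intro!: borel_measurable_times\<close>)

lemma path_weight_nonneg:
  assumes "\<And>v i. 0 \<le> L v i \<omega>"
  shows "0 \<le> path_weight L v \<omega>"
  by (induction v rule: rev_induct) (use assms in auto)

text \<open>
  The process is studied on its canonical space: an environment \<open>e\<close> is drawn from the product of
  copies of the law \<open>N\<close> of \<open>(L v i)\<^sub>i\<close>, and the weights are the coordinates of \<open>e\<close>.
  Clipping at 0 makes them nonnegative everywhere, not just almost everywhere.
\<close>

definition env_weight :: "nat list \<Rightarrow> nat \<Rightarrow> (nat list \<Rightarrow> nat \<Rightarrow> real) \<Rightarrow> real" where
  "env_weight v i e = max 0 (e v i)"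

abbreviation node_weight :: "nat list \<Rightarrow> (nat list \<Rightarrow> nat \<Rightarrow> real) \<Rightarrow> real" where
  "node_weight \<equiv> path_weight env_weight"

abbreviation population :: "nat \<Rightarrow> (nat list \<Rightarrow> nat \<Rightarrow> real) \<Rightarrow> ennreal" where
  "population \<equiv> generation_sum env_weight"

text \<open>\<open>ennreal\<close> sends negative numbers to 0, so the coordinates agree with
  \<open>env_weight\<close> without explicit clipping.\<close>

definition total_weight :: "(nat \<Rightarrow> real) \<Rightarrow> ennreal" where
  "total_weight z = (\<integral>\<^sup>+ i. ennreal (z i) \<partial>count_space UNIV)"

text \<open>The \<open>\<xi>\<^sub>v\<close> of the overview is \<open>centred_total (e v)\<close>.
  Where the total is infinite, a null set once its mean is 1, the value is -1.\<close>

definition centred_total :: "(nat \<Rightarrow> real) \<Rightarrow> real" where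
  "centred_total z = enn2real (total_weight z) - 1"

definition increment :: "nat \<Rightarrow> (nat list \<Rightarrow> nat \<Rightarrow> real) \<Rightarrow> real" where
  "increment n e = enn2real (population (Suc n) e) - enn2real (population n e)"

lemma node_weight_nonneg [simp]: "0 \<le> node_weight v e"
  by (rule path_weight_nonneg) (simp add: env_weight_def)

text \<open>The weight of \<open>u\<close> reads only the coordinates at proper prefixes of
  \<open>u\<close>, and \<open>v\<close> is not shorter than \<open>u\<close>. Such invariance plays
  the part of measurability with respect to the past.\<close>

lemma node_weight_upd [simp]:
  "length u \<le> length v \<Longrightarrow> node_weight u (e(v := z)) = node_weight u e"
  by (induction u rule: rev_induct) (auto simp: env_weight_def)

lemma population_0 [simp]: "population 0 e = 1"
proof -
  have "{v::nat list. length v = 0} = {[]}" by auto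
  then show ?thesis by (simp add: generation_sum_def nn_integral_count_space_finite)
qed

lemma population_Suc:
  "population (Suc n) e =
    (\<integral>\<^sup>+ v. ennreal (node_weight v e) * total_weight (e v) \<partial>count_space {v. length v = n})"
proof -
  have "(\<integral>\<^sup>+ i. ennreal (node_weight (v @ [i]) e) \<partial>count_space UNIV) =
      ennreal (node_weight v e) * total_weight (e v)" for v
  proof -
    have "ennreal (node_weight (v @ [i]) e) = ennreal (node_weight v e) * ennreal (e v i)" for i
      by (simp add: env_weight_def mult.commute ennreal_mult'[symmetric] max_def ennreal_neg
          mult_nonneg_nonpos)
    then show ?thesis by (simp add: total_weight_def nn_integral_cmult)
  qed
  then show ?thesis
    unfolding generation_sum_def nn_integral_count_space_length_Suc by simp
qed

section \<open>Random environments and the resampling of single nodes\<close>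

locale weight_law = prob_space N for N :: "(nat \<Rightarrow> real) measure" +
  assumes sets_N [measurable_cong]: "sets N = sets (Pi\<^sub>M UNIV (\<lambda>_. borel))"
begin

definition env :: "(nat list \<Rightarrow> nat \<Rightarrow> real) measure" where
  "env = Pi\<^sub>M UNIV (\<lambda>_. N)"

definition moment :: "real \<Rightarrow> ennreal" where
  "moment r = (\<integral>\<^sup>+ z. (\<integral>\<^sup>+ i. ennreal (max 0 (z i) powr r) \<partial>count_space UNIV) \<partial>N)"

sublocale env: prob_space env
  unfolding env_def by (intro prob_space_PiM prob_space_axioms)

sublocale pair_env: pair_prob_space N env ..

lemma space_N [simp]: "space N = UNIV"
  using sets_eq_imp_space_eq[OF sets_N] by (simp add: space_PiM)

lemma space_env [simp]: "space env = UNIV"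
  by (simp add: env_def space_PiM)

lemma measurable_env_node [measurable]: "(\<lambda>e. e v) \<in> env \<rightarrow>\<^sub>M N"
  unfolding env_def by simp

lemma measurable_N_component [measurable]: "(\<lambda>z. z i) \<in> borel_measurable N"
  by measurable

lemma measurable_env_component [measurable]: "(\<lambda>e. e v i) \<in> borel_measurable env"
  by (rule measurable_compose[OF measurable_env_node measurable_N_component])

lemma measurable_env_weight [measurable]: "env_weight v i \<in> borel_measurable env"
  unfolding env_weight_def by measurable

lemma measurable_node_weight [measurable]: "node_weight v \<in> borel_measurable env"
  by (rule path_weight_measurable) measurable

lemma measurable_population [measurable]: "population n \<in> borel_measurable env"
  unfolding generation_sum_def by (intro borel_measurable_nn_integral_count_space) measurable

lemma measurable_total_weight [measurable]: "total_weight \<in> borel_measurable N"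
  unfolding total_weight_def by (intro borel_measurable_nn_integral_count_space) measurable

lemma measurable_centred_total [measurable]: "centred_total \<in> borel_measurable N"
  unfolding centred_total_def by measurable

lemma measurable_increment [measurable]: "increment n \<in> borel_measurable env"
  unfolding increment_def by measurable

lemma measurable_env_upd [measurable]: "(\<lambda>(z, e). e(v := z)) \<in> N \<Otimes>\<^sub>M env \<rightarrow>\<^sub>M env"
  unfolding env_def split_def
  by (rule measurable_fun_upd[where J = UNIV]) auto

text \<open>Replacing one coordinate by an independent copy preserves a product measure.
  Independence between nodes is always used in this form, with Fubini's theorem in place of
  conditional expectations.\<close>

lemma distr_env_upd: "distr (N \<Otimes>\<^sub>M env) env (\<lambda>(z, e). e(v := z)) = env"
  using distr_pair_PiM_eq_PiM[where I = UNIV and M = "\<lambda>_. N" and i' = v] prob_space_axioms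
  by (simp add: env_def)

lemma nn_integral_resample:
  assumes [measurable]: "f \<in> borel_measurable env"
  shows "(\<integral>\<^sup>+ e. f e \<partial>env) = (\<integral>\<^sup>+ e. \<integral>\<^sup>+ z. f (e(v := z)) \<partial>N \<partial>env)"
proof -
  have "(\<integral>\<^sup>+ e. f e \<partial>env) = (\<integral>\<^sup>+ x. f ((\<lambda>(z, e). e(v := z)) x) \<partial>(N \<Otimes>\<^sub>M env))"
    by (subst distr_env_upd[of v, symmetric], subst nn_integral_distr) auto
  also have "\<dots> = (\<integral>\<^sup>+ e. \<integral>\<^sup>+ z. f (e(v := z)) \<partial>N \<partial>env)"
    by (subst pair_env.nn_integral_snd[symmetric]) auto
  finally show ?thesis .
qed

lemma integral_resample:
  fixes f :: "_ \<Rightarrow> 'b::{banach, second_countable_topology}"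
  assumes f: "integrable env f"
  shows "(\<integral> e. f e \<partial>env) = (\<integral> e. \<integral> z. f (e(v := z)) \<partial>N \<partial>env)"
proof -
  have [measurable]: "f \<in> borel_measurable env" using f by auto
  have i: "integrable (N \<Otimes>\<^sub>M env) (\<lambda>x. f ((\<lambda>(z, e). e(v := z)) x))"
    using f by (subst integrable_distr_eq[symmetric, of _ _ env]) (auto simp: distr_env_upd)
  have "(\<integral> e. f e \<partial>env) = (\<integral> x. f ((\<lambda>(z, e). e(v := z)) x) \<partial>(N \<Otimes>\<^sub>M env))"
    by (subst distr_env_upd[of v, symmetric], subst integral_distr) auto
  also have "\<dots> = (\<integral> e. \<integral> z. f (e(v := z)) \<partial>N \<partial>env)"
    using pair_env.integral_snd[of "\<lambda>z e. f (e(v := z))"] i by (simp add: split_def)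
  finally show ?thesis .
qed

text \<open>A function invariant under changes at \<open>v\<close> is independent of the coordinate
  at \<open>v\<close>, so the integral over the fresh copy \<open>z\<close> splits off.\<close>

lemma nn_integral_node_factor:
  assumes [measurable]: "g \<in> borel_measurable env" "\<phi> \<in> borel_measurable N"
    and g: "\<And>e z. g (e(v := z)) = g e"
  shows "(\<integral>\<^sup>+ e. g e * \<phi> (e v) \<partial>env) = (\<integral>\<^sup>+ e. g e \<partial>env) * (\<integral>\<^sup>+ z. \<phi> z \<partial>N)"
proof -
  have "(\<integral>\<^sup>+ e. g e * \<phi> (e v) \<partial>env) = (\<integral>\<^sup>+ e. \<integral>\<^sup>+ z. g e * \<phi> z \<partial>N \<partial>env)"
    by (subst nn_integral_resample[where v = v]) (auto simp: g)
  also have "\<dots> = (\<integral>\<^sup>+ e. g e * (\<integral>\<^sup>+ z. \<phi> z \<partial>N) \<partial>env)"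
    by (simp add: nn_integral_cmult)
  finally show ?thesis by (simp add: nn_integral_multc)
qed

lemma integral_node_factor:
  fixes g :: "_ \<Rightarrow> real"
  assumes g: "integrable env g" and \<phi>: "integrable N \<phi>"
    and g_upd: "\<And>e z. g (e(v := z)) = g e"
  shows "integrable env (\<lambda>e. g e * \<phi> (e v))"
    and "(\<integral> e. g e * \<phi> (e v) \<partial>env) = (\<integral> e. g e \<partial>env) * (\<integral> z. \<phi> z \<partial>N)"
proof -
  have [measurable]: "g \<in> borel_measurable env" "\<phi> \<in> borel_measurable N" using g \<phi> by auto
  show i: "integrable env (\<lambda>e. g e * \<phi> (e v))"
  proof (rule integrableI_bounded)
    have "(\<integral>\<^sup>+ e. ennreal (norm (g e * \<phi> (e v))) \<partial>env) =
        (\<integral>\<^sup>+ e. ennreal (norm (g e)) * ennreal (norm (\<phi> (e v))) \<partial>env)"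
      by (simp add: abs_mult ennreal_mult)
    also have "\<dots> = (\<integral>\<^sup>+ e. ennreal (norm (g e)) \<partial>env) * (\<integral>\<^sup>+ z. ennreal (norm (\<phi> z)) \<partial>N)"
      by (rule nn_integral_node_factor) (auto simp: g_upd)
    also have "\<dots> < \<infinity>"
      using g \<phi> by (auto simp: integrable_iff_bounded ennreal_mult_less_top)
    finally show "(\<integral>\<^sup>+ e. ennreal (norm (g e * \<phi> (e v))) \<partial>env) < \<infinity>" .
  qed measurable
  show "(\<integral> e. g e * \<phi> (e v) \<partial>env) = (\<integral> e. g e \<partial>env) * (\<integral> z. \<phi> z \<partial>N)"
    by (subst integral_resample[OF i, where v = v]) (simp add: g_upd)
qed

text \<open>Each generation multiplies the expectation by \<open>moment r\<close>, because the
  weight of a parent does not read the parent's own coordinate, from which the factors of its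
  children come.\<close>

lemma nn_integral_generation_powr:
  "(\<integral>\<^sup>+ e. \<integral>\<^sup>+ v. ennreal (node_weight v e powr r) \<partial>count_space {v. length v = n} \<partial>env) = moment r ^ n"
proof (induction n)
  case 0
  have "{v::nat list. length v = 0} = {[]}" by auto
  then show ?case by (simp add: nn_integral_count_space_finite env.emeasure_space_1[simplified])
next
  case (Suc n)
  define \<phi> where "\<phi> z = (\<integral>\<^sup>+ i. ennreal (max 0 (z i) powr r) \<partial>count_space UNIV)" for z :: "nat \<Rightarrow> real"
  have [measurable]: "\<phi> \<in> borel_measurable N"
    unfolding \<phi>_def by (intro borel_measurable_nn_integral_count_space) measurable
  have "(\<integral>\<^sup>+ i. ennreal (node_weight (v @ [i]) e powr r) \<partial>count_space UNIV) =
      ennreal (node_weight v e powr r) * \<phi> (e v)" for v e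
    by (simp add: \<phi>_def powr_mult env_weight_def ennreal_mult mult.commute[of _ "node_weight v e powr r"]
        nn_integral_cmult)
  then have "(\<integral>\<^sup>+ e. \<integral>\<^sup>+ v. ennreal (node_weight v e powr r) \<partial>count_space {v. length v = Suc n} \<partial>env) =
     (\<integral>\<^sup>+ e. \<integral>\<^sup>+ v. ennreal (node_weight v e powr r) * \<phi> (e v) \<partial>count_space {v. length v = n} \<partial>env)"
    by (simp add: nn_integral_count_space_length_Suc)
  also have "\<dots> = (\<integral>\<^sup>+ v. \<integral>\<^sup>+ e. ennreal (node_weight v e powr r) * \<phi> (e v) \<partial>env \<partial>count_space {v. length v = n})"
    by (intro nn_integral_count_space_nn_integral) (auto intro!: measurable_compose[OF measurable_env_node])
  also have "\<dots> = (\<integral>\<^sup>+ v. (\<integral>\<^sup>+ e. ennreal (node_weight v e powr r) \<partial>env) * moment r \<partial>count_space {v. length v = n})"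
    by (subst nn_integral_node_factor) (auto simp: moment_def \<phi>_def[abs_def, symmetric])
  also have "\<dots> = (\<integral>\<^sup>+ v. (\<integral>\<^sup>+ e. ennreal (node_weight v e powr r) \<partial>env) \<partial>count_space {v. length v = n}) * moment r"
    by (simp add: nn_integral_multc)
  also have "(\<integral>\<^sup>+ v. (\<integral>\<^sup>+ e. ennreal (node_weight v e powr r) \<partial>env) \<partial>count_space {v. length v = n}) =
     (\<integral>\<^sup>+ e. \<integral>\<^sup>+ v. ennreal (node_weight v e powr r) \<partial>count_space {v. length v = n} \<partial>env)"
    by (intro nn_integral_count_space_nn_integral[symmetric]) auto
  finally show ?case using Suc by (simp add: mult.commute)
qed

lemma nn_integral_population: "(\<integral>\<^sup>+ e. population n e \<partial>env) = moment 1 ^ n"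
  using nn_integral_generation_powr[where r = 1 and n = n] by (simp add: generation_sum_def)

end

section \<open>Exponentially weighted series\<close>

text \<open>\<open>|w - X n|\<close> is at most the tail of the increments. After exchanging the
  sums, increment \<open>k\<close> carries the sum of \<open>exp (a * n)\<close> over
  \<open>n \<le> k\<close>, which is comparable to its last term because
  \<open>a > 0\<close>.\<close>

lemma geometric_weighted_tail_bound:
  fixes X :: "nat \<Rightarrow> real" and a w :: real
  assumes "a > 0" and X: "X \<longlonglongrightarrow> w" and s: "summable (\<lambda>k. exp (a * k) * \<bar>X (Suc k) - X k\<bar>)"
  shows "(\<Sum>n<N. exp (a * n) * \<bar>w - X n\<bar>) \<le>
    exp a / (exp a - 1) * (\<Sum>k. exp (a * k) * \<bar>X (Suc k) - X k\<bar>)"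
proof -
  \<comment> \<open>The value of the geometric series with ratio \<open>exp (- a)\<close>.\<close>
  define c where "c = exp a / (exp a - 1)"
  have ea: "exp a > 1" using \<open>a > 0\<close> by simp
  then have c: "c > 0" by (simp add: c_def)
  have geo: "(\<Sum>n\<le>k. exp (a * n)) \<le> c * exp (a * k)" for k :: nat
  proof (induction k)
    case 0 then show ?case using ea by (simp add: c_def field_simps)
  next
    case (Suc k)
    have "c + exp a = c * exp a" using ea by (simp add: c_def field_simps)
    then have "(c + exp a) * exp (a * k) = c * exp (a * Suc k)"
      by (simp add: exp_add distrib_left mult_ac)
    then show ?case using Suc by (simp add: exp_add algebra_simps)
  qed
  \<comment> \<open>With \<open>X m\<close> in place of \<open>w\<close> all sums are finite;
    \<open>m\<close> tends to infinity afterwards.\<close>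
  have M: "(\<Sum>n<N. exp (a * n) * \<bar>X m - X n\<bar>) \<le>
      c * (\<Sum>k. exp (a * k) * \<bar>X (Suc k) - X k\<bar>)" if "N \<le> m" for m
  proof -
    let ?d = "\<lambda>k. \<bar>X (Suc k) - X k\<bar>"
    have "(\<Sum>n<N. exp (a * n) * \<bar>X m - X n\<bar>) \<le> (\<Sum>n<N. exp (a * n) * (\<Sum>k<m. if n \<le> k then ?d k else 0))"
    proof (intro sum_mono mult_left_mono)
      fix n assume "n \<in> {..<N}"
      then have "n \<le> m" using that by auto
      then have "X m - X n = (\<Sum>k=n..<m. X (Suc k) - X k)" by (simp add: sum_Suc_diff')
      then have "\<bar>X m - X n\<bar> \<le> (\<Sum>k=n..<m. ?d k)" by (simp add: sum_abs)
      also have "\<dots> = (\<Sum>k<m. if n \<le> k then ?d k else 0)"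
        by (subst sum.inter_filter[symmetric]) (auto intro!: sum.cong)
      finally show "\<bar>X m - X n\<bar> \<le> (\<Sum>k<m. if n \<le> k then ?d k else 0)" .
    qed simp
    also have "\<dots> = (\<Sum>n<N. \<Sum>k<m. if n \<le> k then exp (a * n) * ?d k else 0)"
      unfolding sum_distrib_left by (intro sum.cong) auto
    also have "\<dots> = (\<Sum>k<m. \<Sum>n<N. if n \<le> k then exp (a * n) * ?d k else 0)"
      by (rule sum.swap)
    also have "\<dots> \<le> (\<Sum>k<m. c * (exp (a * k) * ?d k))"
    proof (rule sum_mono)
      fix k
      have "(\<Sum>n<N. if n \<le> k then exp (a * n) * ?d k else 0) = (\<Sum>n\<in>{n\<in>{..<N}. n \<le> k}. exp (a * n) * ?d k)"
        by (rule sum.inter_filter[symmetric]) simp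
      also have "\<dots> \<le> (\<Sum>n\<le>k. exp (a * n) * ?d k)" by (rule sum_mono2) auto
      also have "\<dots> = (\<Sum>n\<le>k. exp (a * n)) * ?d k" by (simp add: sum_distrib_right)
      also have "\<dots> \<le> c * exp (a * k) * ?d k" by (intro mult_right_mono geo) auto
      finally show "(\<Sum>n<N. if n \<le> k then exp (a * n) * ?d k else 0) \<le> c * (exp (a * k) * ?d k)"
        by (simp add: mult_ac)
    qed
    also have "\<dots> = c * (\<Sum>k<m. exp (a * k) * ?d k)" by (simp add: sum_distrib_left)
    also have "\<dots> \<le> c * (\<Sum>k. exp (a * k) * ?d k)"
      using c s by (intro mult_left_mono sum_le_suminf) auto
    finally show ?thesis .
  qed
  have "(\<lambda>m. \<Sum>n<N. exp (a * n) * \<bar>X m - X n\<bar>) \<longlonglongrightarrow> (\<Sum>n<N. exp (a * n) * \<bar>w - X n\<bar>)"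
    by (intro tendsto_intros X)
  then have "(\<Sum>n<N. exp (a * n) * \<bar>w - X n\<bar>) \<le> c * (\<Sum>k. exp (a * k) * \<bar>X (Suc k) - X k\<bar>)"
    by (rule Lim_bounded[where M = N]) (use M in auto)
  then show ?thesis by (simp add: c_def)
qed

lemma exponentially_weighted_series_converges:
  fixes X :: "nat \<Rightarrow> 'a \<Rightarrow> real" and w :: "'a \<Rightarrow> real"
  assumes [measurable]: "\<And>n. X n \<in> borel_measurable M" "w \<in> borel_measurable M"
    and lim: "AE \<omega> in M. (\<lambda>n. X n \<omega>) \<longlonglongrightarrow> w \<omega>"
    and a: "a > 0" and p: "1 \<le> p" and \<rho>: "0 < \<rho>" "exp a * \<rho> < 1" and C: "C < \<infinity>"
    and bound: "\<And>n. (\<integral>\<^sup>+ \<omega>. ennreal (\<bar>X (Suc n) \<omega> - X n \<omega>\<bar> powr p) \<partial>M) \<le> C * ennreal ((\<rho> powr p) ^ n)"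
  shows "converges_in_Lp M p (\<lambda>N \<omega>. \<Sum>n<N. exp (a * real n) * (w \<omega> - X n \<omega>))" (is ?A)
    and "AE \<omega> in M. summable (\<lambda>n. exp (a * real n) * (w \<omega> - X n \<omega>))" (is ?B)
proof -
  define D where "D k \<omega> = exp (a * real k) * \<bar>X (Suc k) \<omega> - X k \<omega>\<bar>" for k \<omega>
  have [measurable]: "D k \<in> borel_measurable M" for k unfolding D_def by measurable
  have D0: "0 \<le> D k \<omega>" for k \<omega> by (simp add: D_def)
  define V where "V n \<omega> = (\<Sum>k<n. D k \<omega>)" for n \<omega>
  have [measurable]: "V k \<in> borel_measurable M" for k unfolding V_def by measurable
  have V0: "0 \<le> V n \<omega>" for n \<omega> by (auto simp: V_def D0 sum_nonneg)
  \<comment> \<open>\<open>D k\<close> is split into \<open>q ^ k\<close> and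
    \<open>D k / q ^ k\<close>. The latter is \<open>|X (Suc k) - X k| / \<rho> ^ k\<close>, whose
    \<open>p\<close>-th moment is at most \<open>C\<close> for every \<open>k\<close>, and the
    weights \<open>q ^ k\<close> are summable; so Jensen's inequality bounds the moments of
    \<open>V n\<close> uniformly in \<open>n\<close>.\<close>
  define q where "q = exp a * \<rho>"
  have q: "0 < q" "q < 1" using \<rho> by (auto simp: q_def)
  define A where "A = 1 / (1 - q)"
  have geo: "(\<Sum>k<n. q ^ k) \<le> A" for n
  proof -
    have "(\<Sum>k<n. q ^ k) \<le> (\<Sum>k. q ^ k)" using q by (intro sum_le_suminf) auto
    then show ?thesis using q by (simp add: suminf_geometric A_def)
  qed
  define B where "B = ennreal (A powr (p - 1)) * (C * ennreal A)"
  have B: "B < \<infinity>" using C by (simp add: B_def ennreal_mult_less_top)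
  have term_eq: "q ^ k * (D k \<omega> / q ^ k) powr p = q ^ k * ((1 / \<rho> powr p) ^ k * \<bar>X (Suc k) \<omega> - X k \<omega>\<bar> powr p)"
    for k \<omega>
  proof -
    have "D k \<omega> / q ^ k = \<bar>X (Suc k) \<omega> - X k \<omega>\<bar> / \<rho> ^ k"
      by (simp add: D_def q_def power_mult_distrib exp_of_nat_mult[symmetric] mult.commute)
    then have "(D k \<omega> / q ^ k) powr p = \<bar>X (Suc k) \<omega> - X k \<omega>\<bar> powr p / (\<rho> ^ k) powr p"
      using \<rho> by (simp add: powr_divide)
    also have "(\<rho> ^ k) powr p = (\<rho> powr p) ^ k"
      using \<rho> by (simp add: powr_realpow[symmetric] powr_powr mult.commute)
    finally show ?thesis by (simp add: power_divide)
  qed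
  have intV: "(\<integral>\<^sup>+ \<omega>. ennreal (V n \<omega> powr p) \<partial>M) \<le> B" for n
  proof -
    have "(\<integral>\<^sup>+ \<omega>. ennreal (V n \<omega> powr p) \<partial>M) \<le>
       (\<integral>\<^sup>+ \<omega>. ennreal (A powr (p - 1)) * (\<Sum>k<n. ennreal (q ^ k * (1 / \<rho> powr p) ^ k) * ennreal (\<bar>X (Suc k) \<omega> - X k \<omega>\<bar> powr p)) \<partial>M)"
    proof (rule nn_integral_mono)
      fix \<omega>
      have "V n \<omega> powr p = (\<Sum>k<n. q ^ k * (D k \<omega> / q ^ k)) powr p" using q by (simp add: V_def)
      also have "\<dots> \<le> A powr (p - 1) * (\<Sum>k<n. q ^ k * (D k \<omega> / q ^ k) powr p)"
        using q p geo D0 by (intro powr_weighted_sum_le) auto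
      also have "\<dots> = A powr (p - 1) * (\<Sum>k<n. (q ^ k * (1 / \<rho> powr p) ^ k) * \<bar>X (Suc k) \<omega> - X k \<omega>\<bar> powr p)"
        by (simp add: term_eq mult.assoc)
      finally have "ennreal (V n \<omega> powr p) \<le> ennreal (A powr (p - 1) * (\<Sum>k<n. (q ^ k * (1 / \<rho> powr p) ^ k) * \<bar>X (Suc k) \<omega> - X k \<omega>\<bar> powr p))"
        by (rule ennreal_leI)
      also have "\<dots> = ennreal (A powr (p - 1)) * (\<Sum>k<n. ennreal (q ^ k * (1 / \<rho> powr p) ^ k) * ennreal (\<bar>X (Suc k) \<omega> - X k \<omega>\<bar> powr p))"
        using q \<rho> by (simp add: ennreal_mult sum_nonneg sum_ennreal[symmetric])
      finally show "ennreal (V n \<omega> powr p) \<le> \<dots>" .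
    qed
    also have "\<dots> = ennreal (A powr (p - 1)) * (\<Sum>k<n. ennreal (q ^ k * (1 / \<rho> powr p) ^ k) *
        (\<integral>\<^sup>+ \<omega>. ennreal (\<bar>X (Suc k) \<omega> - X k \<omega>\<bar> powr p) \<partial>M))"
      by (simp add: nn_integral_cmult nn_integral_sum)
    also have "\<dots> \<le> ennreal (A powr (p - 1)) * (\<Sum>k<n. ennreal (q ^ k * (1 / \<rho> powr p) ^ k) * (C * ennreal ((\<rho> powr p) ^ k)))"
      by (intro mult_left_mono sum_mono bound) auto
    also have "\<dots> = ennreal (A powr (p - 1)) * (\<Sum>k<n. C * ennreal (q ^ k))"
    proof -
      have "ennreal (q ^ k * (1 / \<rho> powr p) ^ k) * (C * ennreal ((\<rho> powr p) ^ k)) = C * ennreal (q ^ k)" for k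
      proof -
        have "ennreal (q ^ k * (1 / \<rho> powr p) ^ k) * ennreal ((\<rho> powr p) ^ k) = ennreal (q ^ k)"
          using q \<rho> by (subst ennreal_mult[symmetric]) (auto simp: power_divide)
        then show ?thesis by (metis mult.left_commute)
      qed
      then show ?thesis by simp
    qed
    also have "\<dots> = ennreal (A powr (p - 1)) * (C * ennreal (\<Sum>k<n. q ^ k))"
      using q by (simp add: sum_distrib_left[symmetric] sum_ennreal)
    also have "\<dots> \<le> B"
      unfolding B_def by (intro mult_left_mono ennreal_leI geo) auto
    finally show ?thesis .
  qed
  have Vmono: "V m \<omega> \<le> V n \<omega>" if "m \<le> n" for m n \<omega>
    unfolding V_def using that D0 by (intro sum_mono2) auto
  \<comment> \<open>The supremum of the powers is taken in \<open>ennreal\<close>, so that monotone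
    convergence applies before the series is known to be finite.\<close>
  define G where "G \<omega> = (SUP n. ennreal (V n \<omega> powr p))" for \<omega>
  have [measurable]: "G \<in> borel_measurable M" unfolding G_def by measurable
  have intG: "(\<integral>\<^sup>+ \<omega>. G \<omega> \<partial>M) \<le> B"
  proof -
    have "(\<integral>\<^sup>+ \<omega>. G \<omega> \<partial>M) = (SUP n. \<integral>\<^sup>+ \<omega>. ennreal (V n \<omega> powr p) \<partial>M)"
      unfolding G_def
      by (rule nn_integral_monotone_convergence_SUP)
        (use p V0 Vmono in \<open>auto simp: incseq_def le_fun_def intro!: ennreal_leI powr_mono2\<close>)
    also have "\<dots> \<le> B" by (intro SUP_least intV)
    finally show ?thesis .
  qed
  \<comment> \<open>Where \<open>G\<close> is infinite the series need not converge; the default 0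
    keeps \<open>v\<close> nonnegative there.\<close>
  define v where "v \<omega> = (if G \<omega> = \<infinity> then 0 else (\<Sum>k. D k \<omega>))" for \<omega>
  have [measurable]: "v \<in> borel_measurable M" unfolding v_def by measurable
  have AEG: "AE \<omega> in M. G \<omega> \<noteq> \<infinity>"
    using intG B by (intro nn_integral_PInf_AE) (auto simp: less_top[symmetric] top_unique)
  have sumD: "summable (\<lambda>k. D k \<omega>)" if fin: "G \<omega> \<noteq> \<infinity>" for \<omega>
  proof -
    obtain K where K: "K \<ge> 0" "G \<omega> = ennreal K" using fin by (cases "G \<omega>") auto
    have "V n \<omega> \<le> 1 + K" for n
    proof -
      have "ennreal (V n \<omega> powr p) \<le> ennreal K" unfolding K(2)[symmetric] G_def by (rule SUP_upper) simp
      then have 1: "V n \<omega> powr p \<le> K" using K by (simp add: ennreal_le_iff)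
      show ?thesis
      proof (cases "V n \<omega> \<le> 1")
        case False
        then have "V n \<omega> powr 1 \<le> V n \<omega> powr p" using p by (intro powr_mono) auto
        then show ?thesis using 1 False by simp
      qed (use K in simp)
    qed
    then have "(\<Sum>k\<le>n. D k \<omega>) \<le> 1 + K" for n
      unfolding lessThan_Suc_atMost[symmetric] V_def .
    then show ?thesis using D0 by (intro bounded_imp_summable[where B = "1 + K"])
  qed
  have vG: "ennreal (v \<omega> powr p) \<le> G \<omega>" if "G \<omega> \<noteq> \<infinity>" for \<omega>
  proof -
    have "(\<lambda>n. V n \<omega>) \<longlonglongrightarrow> v \<omega>" unfolding V_def using summable_LIMSEQ[OF sumD[OF that]] that by (simp add: v_def)
    then have "(\<lambda>n. ennreal (V n \<omega> powr p)) \<longlonglongrightarrow> ennreal (v \<omega> powr p)"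
      using p V0 by (intro tendsto_ennrealI tendsto_powr') auto
    then show ?thesis by (rule Lim_bounded[where M = 0]) (auto simp: G_def intro: SUP_upper)
  qed
  define c where "c = exp a / (exp a - 1)"
  have c: "c > 0" using a by (simp add: c_def)
  have v0: "0 \<le> v \<omega>" for \<omega>
    using sumD[of \<omega>] D0 by (auto simp: v_def suminf_nonneg)
  \<comment> \<open>The factor 2 leaves room for the difference of a partial sum and the limit, each
    bounded by \<open>c * v\<close>.\<close>
  have intv: "(\<integral>\<^sup>+ \<omega>. ennreal ((2 * c * v \<omega>) powr p) \<partial>M) < \<infinity>"
  proof -
    have "(\<integral>\<^sup>+ \<omega>. ennreal ((2 * c * v \<omega>) powr p) \<partial>M) = (\<integral>\<^sup>+ \<omega>. ennreal ((2 * c) powr p) * ennreal (v \<omega> powr p) \<partial>M)"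
      using c v0 by (simp add: powr_mult ennreal_mult)
    also have "\<dots> = ennreal ((2 * c) powr p) * (\<integral>\<^sup>+ \<omega>. ennreal (v \<omega> powr p) \<partial>M)"
      by (simp add: nn_integral_cmult)
    also have "\<dots> \<le> ennreal ((2 * c) powr p) * (\<integral>\<^sup>+ \<omega>. G \<omega> \<partial>M)"
      using AEG vG by (intro mult_left_mono nn_integral_mono_AE) auto
    also have "\<dots> < \<infinity>" using intG B by (auto simp: ennreal_mult_less_top intro: le_less_trans)
    finally show ?thesis .
  qed
  define s where "s N \<omega> = (\<Sum>n<N. exp (a * real n) * (w \<omega> - X n \<omega>))" for N \<omega>
  define Y where "Y \<omega> = (\<Sum>n. exp (a * real n) * (w \<omega> - X n \<omega>))" for \<omega>
  have [measurable]: "s N \<in> borel_measurable M" for N unfolding s_def by measurable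
  have [measurable]: "Y \<in> borel_measurable M" unfolding Y_def by measurable
  have good: "summable (\<lambda>n. exp (a * real n) * (w \<omega> - X n \<omega>)) \<and> (\<forall>N. \<bar>s N \<omega>\<bar> \<le> c * v \<omega>)"
    if "G \<omega> \<noteq> \<infinity>" "(\<lambda>n. X n \<omega>) \<longlonglongrightarrow> w \<omega>" for \<omega>
  proof -
    have b: "(\<Sum>n<N. exp (a * real n) * \<bar>w \<omega> - X n \<omega>\<bar>) \<le> c * v \<omega>" for N
      using geometric_weighted_tail_bound[OF a that(2)] sumD[OF that(1)] that(1) by (simp add: D_def v_def c_def)
    have "(\<Sum>n\<le>N. \<bar>exp (a * real n) * (w \<omega> - X n \<omega>)\<bar>) \<le> c * v \<omega>" for N
      using b[of "Suc N"] unfolding lessThan_Suc_atMost by (simp add: abs_mult)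
    then have "summable (\<lambda>n. \<bar>exp (a * real n) * (w \<omega> - X n \<omega>)\<bar>)"
      by (intro bounded_imp_summable[where B = "c * v \<omega>"]) auto
    moreover have "\<bar>s N \<omega>\<bar> \<le> c * v \<omega>" for N
    proof -
      have "\<bar>s N \<omega>\<bar> \<le> (\<Sum>n<N. exp (a * real n) * \<bar>w \<omega> - X n \<omega>\<bar>)"
        unfolding s_def by (rule order_trans[OF sum_abs]) (simp add: abs_mult)
      then show ?thesis using b[of N] by linarith
    qed
    ultimately show ?thesis by (blast intro: summable_rabs_cancel)
  qed
  show ?B using AEG lim by eventually_elim (use good in auto)
  have AEs: "AE \<omega> in M. (\<lambda>N. s N \<omega>) \<longlonglongrightarrow> Y \<omega> \<and> (\<forall>N. \<bar>s N \<omega>\<bar> \<le> c * v \<omega>) \<and> \<bar>Y \<omega>\<bar> \<le> c * v \<omega>"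
    using AEG lim
  proof eventually_elim
    case (elim \<omega>)
    from good[OF this] have g: "(\<lambda>N. s N \<omega>) \<longlonglongrightarrow> Y \<omega>" "\<And>N. \<bar>s N \<omega>\<bar> \<le> c * v \<omega>"
      by (auto simp: s_def Y_def intro: summable_LIMSEQ)
    moreover have "\<bar>Y \<omega>\<bar> \<le> c * v \<omega>"
      by (rule Lim_bounded[where M = 0, OF tendsto_rabs[OF g(1)]]) (use g in auto)
    ultimately show ?case by auto
  qed
  have fin: "in_Lp M p f" if [measurable]: "f \<in> borel_measurable M" and "AE \<omega> in M. \<bar>f \<omega>\<bar> \<le> c * v \<omega>" for f
  proof -
    have "(\<integral>\<^sup>+ \<omega>. ennreal (\<bar>f \<omega>\<bar> powr p) \<partial>M) \<le> (\<integral>\<^sup>+ \<omega>. ennreal ((2 * c * v \<omega>) powr p) \<partial>M)"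
      using that(2)
    proof (intro nn_integral_mono_AE, eventually_elim)
      case (elim \<omega>)
      moreover have "0 \<le> c * v \<omega>" using c v0 by simp
      ultimately have "\<bar>f \<omega>\<bar> \<le> 2 * c * v \<omega>" by linarith
      then show ?case using p by (intro ennreal_leI powr_mono2) auto
    qed
    also note intv
    finally show ?thesis by (simp add: in_Lp_def)
  qed
  have "(\<lambda>n. \<integral>\<^sup>+ \<omega>. ennreal (\<bar>s n \<omega> - Y \<omega>\<bar> powr p) \<partial>M) \<longlonglongrightarrow> (\<integral>\<^sup>+ \<omega>. 0 \<partial>M)"
  proof (rule nn_integral_dominated_convergence[where w = "\<lambda>\<omega>. ennreal ((2 * c * v \<omega>) powr p)"])
    show "AE \<omega> in M. ennreal (\<bar>s n \<omega> - Y \<omega>\<bar> powr p) \<le> ennreal ((2 * c * v \<omega>) powr p)" for n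
      using AEs
    proof eventually_elim
      case (elim \<omega>)
      then have "\<bar>s n \<omega>\<bar> \<le> c * v \<omega>" "\<bar>Y \<omega>\<bar> \<le> c * v \<omega>" by auto
      then have "\<bar>s n \<omega> - Y \<omega>\<bar> \<le> 2 * c * v \<omega>" by linarith
      then show ?case using p by (intro ennreal_leI powr_mono2) auto
    qed
    show "AE \<omega> in M. (\<lambda>n. ennreal (\<bar>s n \<omega> - Y \<omega>\<bar> powr p)) \<longlonglongrightarrow> 0"
      using AEs
    proof eventually_elim
      case (elim \<omega>)
      then have "(\<lambda>n. s n \<omega> - Y \<omega>) \<longlonglongrightarrow> 0" by (simp add: LIM_zero)
      then have "(\<lambda>n. \<bar>s n \<omega> - Y \<omega>\<bar> powr p) \<longlonglongrightarrow> \<bar>0\<bar> powr p"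
        using p by (intro tendsto_powr' tendsto_rabs) auto
      then show ?case by (auto dest: tendsto_ennrealI)
    qed
  qed (use intv in auto)
  then have L: "(\<lambda>n. \<integral>\<^sup>+ \<omega>. ennreal (\<bar>s n \<omega> - Y \<omega>\<bar> powr p) \<partial>M) \<longlonglongrightarrow> 0" by simp
  have "in_Lp M p (s n)" for n by (rule fin[OF _ eventually_mono[OF AEs]]) auto
  moreover have "in_Lp M p Y" by (rule fin[OF _ eventually_mono[OF AEs]]) auto
  ultimately show ?A
    unfolding converges_in_Lp_def s_def[symmetric] using L by blast
qed

section \<open>Moments of the increments\<close>

text \<open>Generation \<open>n\<close> of the \<open>k\<close>-ary subtree. These finite boxes
  exhaust the generation as \<open>k\<close> grows and, unlike an arbitrary exhaustion, decompose
  along parents; see \<open>prod_node_box_Suc\<close>.\<close>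

definition node_box :: "nat \<Rightarrow> nat \<Rightarrow> nat list set" where
  "node_box n k = {v. set v \<subseteq> {..<k} \<and> length v = n}"

lemma finite_node_box [simp]: "finite (node_box n k)"
  unfolding node_box_def by (rule finite_lists_length_eq) simp

lemma length_node_box: "v \<in> node_box n k \<Longrightarrow> length v = n"
  by (simp add: node_box_def)

text \<open>Monotone convergence along the boxes, carried over to real numbers because an increment
  is a difference of two such sums.\<close>

lemma sum_node_box_tendsto:
  fixes f :: "nat list \<Rightarrow> ennreal"
  assumes fin: "(\<integral>\<^sup>+ v. f v \<partial>count_space {v. length v = n}) < \<infinity>"
  shows "(\<lambda>k. \<Sum>v\<in>node_box n k. enn2real (f v)) \<longlonglongrightarrow>
    enn2real (\<integral>\<^sup>+ v. f v \<partial>count_space {v. length v = n})"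
proof -
  let ?A = "{v::nat list. length v = n}"
  have f_fin: "f v < \<infinity>" if "v \<in> ?A" for v
  proof -
    have "f v = (\<integral>\<^sup>+ v. f v \<partial>count_space {v})" by (simp add: nn_integral_count_space_finite)
    also have "\<dots> = (\<integral>\<^sup>+ u. f u * indicator {v} u \<partial>count_space ?A)"
      using that by (subst nn_integral_count_space'[of "{v}"]) (auto simp: nn_integral_count_space_finite)
    also have "\<dots> \<le> (\<integral>\<^sup>+ v. f v \<partial>count_space ?A)"
      by (intro nn_integral_mono) (auto split: split_indicator)
    finally show ?thesis using fin by simp
  qed
  have sum_eq: "(\<integral>\<^sup>+ v. f v * indicator (node_box n k) v \<partial>count_space ?A) = (\<Sum>v\<in>node_box n k. f v)" for k
    by (subst nn_integral_count_space'[of "node_box n k"]) (auto simp: node_box_def[of n k] finite_lists_length_eq)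
  have "(\<lambda>k. \<integral>\<^sup>+ v. f v * indicator (node_box n k) v \<partial>count_space ?A) \<longlonglongrightarrow>
      (\<integral>\<^sup>+ v. f v * indicator ?A v \<partial>count_space ?A)"
  proof (rule nn_integral_LIMSEQ)
    show "incseq (\<lambda>k v. f v * indicator (node_box n k) v)"
      by (auto simp: incseq_def le_fun_def node_box_def split: split_indicator)
    fix v :: "nat list"
    have "\<forall>\<^sub>F k in sequentially. f v * indicator (node_box n k) v = f v * indicator ?A v"
      using eventually_gt_at_top[of "Max (insert 0 (set v))"]
    proof eventually_elim
      case (elim k)
      then show ?case by (auto simp: node_box_def split: split_indicator)
    qed
    then show "(\<lambda>k. f v * indicator (node_box n k) v) \<longlonglongrightarrow> f v * indicator ?A v"
      by (rule tendsto_eventually)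
  qed auto
  also have "(\<integral>\<^sup>+ v. f v * indicator ?A v \<partial>count_space ?A) = (\<integral>\<^sup>+ v. f v \<partial>count_space ?A)"
    by (intro nn_integral_cong) auto
  finally have "(\<lambda>k. \<Sum>v\<in>node_box n k. f v) \<longlonglongrightarrow> (\<integral>\<^sup>+ v. f v \<partial>count_space ?A)" by (simp only: sum_eq)
  then have "(\<lambda>k. enn2real (\<Sum>v\<in>node_box n k. f v)) \<longlonglongrightarrow> enn2real (\<integral>\<^sup>+ v. f v \<partial>count_space ?A)"
    using fin by (intro tendsto_enn2real) auto
  also have "(\<lambda>k. enn2real (\<Sum>v\<in>node_box n k. f v)) = (\<lambda>k. \<Sum>v\<in>node_box n k. enn2real (f v))"
    using f_fin by (subst enn2real_sum) (auto simp: node_box_def comp_def)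
  finally show ?thesis .
qed

text \<open>Arbitrary sets \<open>F\<close> are allowed, not only boxes, so that nodes can be added
  one at a time.\<close>

definition partial_increment :: "nat list set \<Rightarrow> (nat list \<Rightarrow> nat \<Rightarrow> real) \<Rightarrow> real" where
  "partial_increment F e = (\<Sum>v\<in>F. node_weight v e * centred_total (e v))"

lemma partial_increment_upd:
  "\<lbrakk>\<And>u. u \<in> F \<Longrightarrow> length u \<le> length v; v \<notin> F\<rbrakk> \<Longrightarrow> partial_increment F (e(v := z)) = partial_increment F e"
  unfolding partial_increment_def by (intro sum.cong) auto

lemma partial_increment_tendsto:
  assumes "population n e < \<infinity>" "population (Suc n) e < \<infinity>"
  shows "(\<lambda>k. partial_increment (node_box n k) e) \<longlonglongrightarrow> increment n e"
proof -
  have "(\<lambda>k. \<Sum>v\<in>node_box n k. enn2real (ennreal (node_weight v e) * total_weight (e v))) \<longlonglongrightarrow> enn2real (population (Suc n) e)"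
    using assms(2) unfolding population_Suc by (rule sum_node_box_tendsto)
  moreover have "(\<lambda>k. \<Sum>v\<in>node_box n k. enn2real (ennreal (node_weight v e))) \<longlonglongrightarrow> enn2real (population n e)"
    using assms(1) unfolding generation_sum_def by (rule sum_node_box_tendsto)
  ultimately have "(\<lambda>k. (\<Sum>v\<in>node_box n k. enn2real (ennreal (node_weight v e) * total_weight (e v)))
     - (\<Sum>v\<in>node_box n k. enn2real (ennreal (node_weight v e)))) \<longlonglongrightarrow> increment n e"
    unfolding increment_def by (rule tendsto_diff)
  then show ?thesis
    by (simp add: partial_increment_def centred_total_def enn2real_mult sum_subtractf[symmetric] algebra_simps)
qed

locale normalized_weight_law = weight_law +
  assumes moment_1: "moment 1 = 1"
begin

lemma measurable_partial_increment [measurable]: "partial_increment F \<in> borel_measurable env"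
  unfolding partial_increment_def
  by (intro borel_measurable_sum borel_measurable_times measurable_node_weight
      measurable_compose[OF measurable_env_node measurable_centred_total])

lemma AE_population_finite: "AE e in env. population n e < \<infinity>"
  using nn_integral_PInf_AE[of "population n" env]
  by (simp add: nn_integral_population moment_1 less_top)

lemma nn_integral_total_weight: "(\<integral>\<^sup>+ z. total_weight z \<partial>N) = 1"
proof -
  have "ennreal (max 0 x powr 1) = ennreal x" for x :: real by (cases "x \<ge> 0") (auto simp: ennreal_neg max_def)
  then show ?thesis using moment_1 by (simp add: moment_def total_weight_def)
qed

lemma AE_total_weight_finite: "AE z in N. total_weight z < \<infinity>"
  using nn_integral_PInf_AE[of total_weight N] by (simp add: nn_integral_total_weight less_top)

lemma integrable_centred_total: "integrable N centred_total"
  and integral_centred_total: "(\<integral> z. centred_total z \<partial>N) = 0"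
proof -
  have 1: "(\<integral>\<^sup>+ z. ennreal (enn2real (total_weight z)) \<partial>N) = 1"
    using AE_total_weight_finite
    by (subst nn_integral_total_weight[symmetric], intro nn_integral_cong_AE) (auto elim!: eventually_mono)
  then have i: "integrable N (\<lambda>z. enn2real (total_weight z))"
    by (intro integrableI_nonneg) auto
  then show "integrable N centred_total" unfolding centred_total_def by auto
  have "(\<integral> z. enn2real (total_weight z) \<partial>N) = 1"
    using 1 by (subst integral_eq_nn_integral) auto
  then show "(\<integral> z. centred_total z \<partial>N) = 0"
    unfolding centred_total_def using i prob_space by simp
qed

lemma integrable_population: "integrable env (\<lambda>e. enn2real (population n e))"
  and integral_population: "(\<integral> e. enn2real (population n e) \<partial>env) = 1"
proof -
  have 1: "(\<integral>\<^sup>+ e. ennreal (enn2real (population n e)) \<partial>env) = 1"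
  proof -
    have "(\<integral>\<^sup>+ e. ennreal (enn2real (population n e)) \<partial>env) = (\<integral>\<^sup>+ e. population n e \<partial>env)"
      using AE_population_finite[of n] by (intro nn_integral_cong_AE) (auto elim!: eventually_mono)
    then show ?thesis by (simp add: nn_integral_population moment_1)
  qed
  then show "integrable env (\<lambda>e. enn2real (population n e))" by (intro integrableI_nonneg) auto
  show "(\<integral> e. enn2real (population n e) \<partial>env) = 1" using 1 by (subst integral_eq_nn_integral) auto
qed

lemma integrable_increment: "integrable env (increment n)"
  and integral_increment: "(\<integral> e. increment n e \<partial>env) = 0"
  unfolding increment_def by (auto simp: integrable_population integral_population)

text \<open>
  The von Bahr--Esseen argument: when a node is added, the linear term vanishes because
  \<open>centred_total\<close> has mean 0 and is independent of the rest.
\<close>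

lemma partial_increment_moment_le:
  assumes r: "1 < r" "r \<le> 2" and \<xi>: "integrable N (\<lambda>z. \<bar>centred_total z\<bar> powr r)"
    and w: "\<And>v. length v = n \<Longrightarrow> integrable env (\<lambda>e. node_weight v e powr r)"
    and F: "finite F" "\<And>v. v \<in> F \<Longrightarrow> length v = n"
  shows "integrable env (\<lambda>e. \<bar>partial_increment F e\<bar> powr r) \<and>
    (\<integral> e. \<bar>partial_increment F e\<bar> powr r \<partial>env) \<le>
      4 * (\<integral> z. \<bar>centred_total z\<bar> powr r \<partial>N) * (\<Sum>v\<in>F. \<integral> e. node_weight v e powr r \<partial>env)"
  using F
proof (induction F rule: finite_induct)
  case empty
  then show ?case by (simp add: partial_increment_def)
next
  case (insert v F)
  let ?S = "partial_increment F" and ?\<xi> = centred_total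
  let ?g = "\<lambda>e. sgn (?S e) * \<bar>?S e\<bar> powr (r - 1) * node_weight v e"
  have v: "length v = n" and F: "\<And>u. u \<in> F \<Longrightarrow> length u = n" using insert by auto
  have S_upd: "?S (e(v := z)) = ?S e" for e z
    using insert v F by (intro partial_increment_upd) auto
  have iS: "integrable env (\<lambda>e. \<bar>?S e\<bar> powr r)"
    and leS: "(\<integral> e. \<bar>?S e\<bar> powr r \<partial>env) \<le> 4 * (\<integral> z. \<bar>?\<xi> z\<bar> powr r \<partial>N) * (\<Sum>v\<in>F. \<integral> e. node_weight v e powr r \<partial>env)"
    using insert by auto
  \<comment> \<open>A cross term \<open>x^(r-1) y\<close> is at most \<open>max(x,y)^r\<close>, so
    the two \<open>r\<close>-th moments already give integrability.\<close>
  have ig: "integrable env ?g"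
  proof (rule Bochner_Integration.integrable_bound)
    show "integrable env (\<lambda>e. \<bar>?S e\<bar> powr r + node_weight v e powr r)"
      using iS w[OF v] by auto
    show "AE e in env. norm (?g e) \<le> norm (\<bar>?S e\<bar> powr r + node_weight v e powr r)"
    proof (intro AE_I2)
      fix e
      let ?x = "\<bar>?S e\<bar>" and ?y = "node_weight v e"
      have "norm (?g e) \<le> ?x powr (r - 1) * ?y" by (simp add: abs_mult sgn_if)
      also have "\<dots> \<le> max ?x ?y powr (r - 1) * max ?x ?y"
        using r by (intro mult_mono powr_mono2) auto
      also have "\<dots> = max ?x ?y powr r"
      proof (cases "max ?x ?y = 0")
        case False
        then have "max ?x ?y > 0" by linarith
        then show ?thesis by (simp add: powr_diff)
      next
        case True
        then show ?thesis unfolding True by simp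
      qed
      also have "\<dots> \<le> ?x powr r + ?y powr r" by (auto simp: max_def)
      finally show "norm (?g e) \<le> norm (?x powr r + ?y powr r)" by simp
    qed
  qed measurable
  have g_upd: "?g (e(v := z)) = ?g e" for e z by (simp add: S_upd)
  note cross = integral_node_factor[OF ig integrable_centred_total g_upd]
  have w_upd: "node_weight v (e(v := z)) powr r = node_weight v e powr r" for e z by simp
  note top = integral_node_factor[OF w[OF v] \<xi> w_upd]
  let ?R = "\<lambda>e. \<bar>?S e\<bar> powr r + r * (?g e * ?\<xi> (e v)) + 4 * (node_weight v e powr r * \<bar>?\<xi> (e v)\<bar> powr r)"
  have iR: "integrable env ?R"
    by (intro Bochner_Integration.integrable_add integrable_mult_right iS cross top)
  have step: "\<bar>partial_increment (insert v F) e\<bar> powr r \<le> ?R e" for e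
  proof -
    have "partial_increment (insert v F) e = ?S e + node_weight v e * ?\<xi> (e v)"
      using insert by (simp add: partial_increment_def)
    then have "\<bar>partial_increment (insert v F) e\<bar> powr r \<le>
      \<bar>?S e\<bar> powr r + r * (sgn (?S e) * \<bar>?S e\<bar> powr (r - 1)) * (node_weight v e * ?\<xi> (e v)) + 4 * \<bar>node_weight v e * ?\<xi> (e v)\<bar> powr r"
      using powr_abs_taylor_bound[OF r] by metis
    also have "\<dots> = ?R e" by (simp add: abs_mult powr_mult mult_ac)
    finally show ?thesis .
  qed
  have i: "integrable env (\<lambda>e. \<bar>partial_increment (insert v F) e\<bar> powr r)"
    by (rule Bochner_Integration.integrable_bound[OF iR]) (use step in \<open>auto intro: order_trans[OF _ abs_ge_self]\<close>)
  have "(\<integral> e. \<bar>partial_increment (insert v F) e\<bar> powr r \<partial>env) \<le> (\<integral> e. ?R e \<partial>env)"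
    using i iR step by (intro integral_mono) auto
  also have "\<dots> = (\<integral> e. \<bar>?S e\<bar> powr r \<partial>env) + r * ((\<integral> e. ?g e \<partial>env) * (\<integral> z. ?\<xi> z \<partial>N))
      + 4 * ((\<integral> e. node_weight v e powr r \<partial>env) * (\<integral> z. \<bar>?\<xi> z\<bar> powr r \<partial>N))"
    using iS cross(1) top(1) by (simp add: cross(2) top(2))
  also have "\<dots> \<le> 4 * (\<integral> z. \<bar>?\<xi> z\<bar> powr r \<partial>N) * (\<Sum>v\<in>insert v F. \<integral> e. node_weight v e powr r \<partial>env)"
    using leS insert by (simp add: integral_centred_total algebra_simps)
  finally show ?case using i by simp
qed

text \<open>The expectations of \<open>node_weight v e powr r\<close> sum to
  \<open>moment r ^ n\<close> over the generation, which bounds all boxes at once; Fatou's lemma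
  then reaches the whole generation.\<close>

lemma increment_moment_le:
  assumes r: "1 < r" "r \<le> 2" and \<xi>: "integrable N (\<lambda>z. \<bar>centred_total z\<bar> powr r)" and m: "moment r < \<infinity>"
  shows "(\<integral>\<^sup>+ e. ennreal (\<bar>increment n e\<bar> powr r) \<partial>env) \<le>
    ennreal (4 * (\<integral> z. \<bar>centred_total z\<bar> powr r \<partial>N)) * moment r ^ n"
proof -
  let ?A = "{v::nat list. length v = n}"
  let ?c = "4 * (\<integral> z. \<bar>centred_total z\<bar> powr r \<partial>N)"
  have swap: "(\<integral>\<^sup>+ v. \<integral>\<^sup>+ e. ennreal (node_weight v e powr r) \<partial>env \<partial>count_space ?A) = moment r ^ n"
    by (subst nn_integral_count_space_nn_integral[symmetric]) (auto simp: nn_integral_generation_powr)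
  have part: "(\<Sum>v\<in>F. \<integral>\<^sup>+ e. ennreal (node_weight v e powr r) \<partial>env) \<le> moment r ^ n"
    if "finite F" "F \<subseteq> ?A" for F
  proof -
    have "(\<Sum>v\<in>F. \<integral>\<^sup>+ e. ennreal (node_weight v e powr r) \<partial>env) =
        (\<integral>\<^sup>+ v. (\<integral>\<^sup>+ e. ennreal (node_weight v e powr r) \<partial>env) * indicator F v \<partial>count_space ?A)"
      using that by (subst nn_integral_count_space'[of F]) auto
    also have "\<dots> \<le> (\<integral>\<^sup>+ v. \<integral>\<^sup>+ e. ennreal (node_weight v e powr r) \<partial>env \<partial>count_space ?A)"
      by (intro nn_integral_mono) (auto split: split_indicator)
    finally show ?thesis using swap by simp
  qed
  have w: "integrable env (\<lambda>e. node_weight v e powr r)" if "length v = n" for v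
  proof (rule integrableI_nonneg)
    have "(\<integral>\<^sup>+ e. ennreal (node_weight v e powr r) \<partial>env) \<le> moment r ^ n" using part[of "{v}"] that by simp
    also have "\<dots> < \<infinity>" using m by (simp add: power_less_top_ennreal)
    finally show "(\<integral>\<^sup>+ e. ennreal (node_weight v e powr r) \<partial>env) < \<infinity>" .
  qed auto
  have bound: "(\<integral>\<^sup>+ e. ennreal (\<bar>partial_increment (node_box n k) e\<bar> powr r) \<partial>env) \<le> ennreal ?c * moment r ^ n" for k
  proof -
    have box: "v \<in> node_box n k \<Longrightarrow> length v = n" for v by (simp add: node_box_def)
    have S: "integrable env (\<lambda>e. \<bar>partial_increment (node_box n k) e\<bar> powr r)"
      and S_le: "(\<integral> e. \<bar>partial_increment (node_box n k) e\<bar> powr r \<partial>env) \<le>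
        ?c * (\<Sum>v\<in>node_box n k. \<integral> e. node_weight v e powr r \<partial>env)"
      using partial_increment_moment_le[OF r \<xi> w finite_node_box[of n k] box] by auto
    have "(\<integral>\<^sup>+ e. ennreal (\<bar>partial_increment (node_box n k) e\<bar> powr r) \<partial>env) =
      ennreal (\<integral> e. \<bar>partial_increment (node_box n k) e\<bar> powr r \<partial>env)"
      using S by (rule nn_integral_eq_integral) simp
    also have "\<dots> \<le> ennreal (?c * (\<Sum>v\<in>node_box n k. \<integral> e. node_weight v e powr r \<partial>env))"
      using S_le by (rule ennreal_leI)
    also have "\<dots> = ennreal ?c * (\<Sum>v\<in>node_box n k. \<integral>\<^sup>+ e. ennreal (node_weight v e powr r) \<partial>env)"
    proof -
      have "(\<Sum>v\<in>node_box n k. \<integral>\<^sup>+ e. ennreal (node_weight v e powr r) \<partial>env) =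
          (\<Sum>v\<in>node_box n k. ennreal (\<integral> e. node_weight v e powr r \<partial>env))"
        using w box by (intro sum.cong refl nn_integral_eq_integral) auto
      then show ?thesis by (simp add: sum_ennreal ennreal_mult'' sum_nonneg)
    qed
    also have "\<dots> \<le> ennreal ?c * moment r ^ n"
      by (intro mult_left_mono part) (auto simp: box)
    finally show ?thesis .
  qed
  have "(\<integral>\<^sup>+ e. ennreal (\<bar>increment n e\<bar> powr r) \<partial>env) =
     (\<integral>\<^sup>+ e. liminf (\<lambda>k. ennreal (\<bar>partial_increment (node_box n k) e\<bar> powr r)) \<partial>env)"
    using AE_population_finite[of n] AE_population_finite[of "Suc n"]
  proof (intro nn_integral_cong_AE, eventually_elim)
    case (elim e)
    have "(\<lambda>k. \<bar>partial_increment (node_box n k) e\<bar> powr r) \<longlonglongrightarrow> \<bar>increment n e\<bar> powr r"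
      using r by (intro tendsto_powr' tendsto_rabs partial_increment_tendsto elim) auto
    from tendsto_ennrealI[OF this] show ?case by (intro lim_imp_Liminf[symmetric]) auto
  qed
  also have "\<dots> \<le> liminf (\<lambda>k. \<integral>\<^sup>+ e. ennreal (\<bar>partial_increment (node_box n k) e\<bar> powr r) \<partial>env)"
    by (rule nn_integral_liminf) measurable
  also have "\<dots> \<le> ennreal ?c * moment r ^ n"
    by (rule Liminf_le) (auto simp: bound)
  finally show ?thesis .
qed

end

section \<open>Characteristic functions\<close>

lemma norm_integral_le_integral:
  fixes f :: "'a \<Rightarrow> 'b::{banach, second_countable_topology}"
  assumes "integrable M f" "integrable M g" "\<And>x. x \<in> space M \<Longrightarrow> norm (f x) \<le> g x"
  shows "norm (\<integral>x. f x \<partial>M) \<le> (\<integral>x. g x \<partial>M)"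
  using assms by (intro order_trans[OF integral_norm_bound] integral_mono) auto

text \<open>Since \<open>Y\<close> is centred, the linear term can be subtracted inside the
  expectation at no cost; the remaining integrand is of order \<open>|s Y|^p\<close>.\<close>

lemma (in prob_space) one_minus_char_le:
  fixes Y :: "'a \<Rightarrow> real"
  assumes p: "1 \<le> p" "p \<le> 2" and Y: "integrable M Y" "expectation Y = 0"
    and Yp: "integrable M (\<lambda>\<omega>. \<bar>Y \<omega>\<bar> powr p)"
  shows "1 - cmod (\<integral>\<omega>. iexp (s * Y \<omega>) \<partial>M) \<le> 2 * \<bar>s\<bar> powr p * expectation (\<lambda>\<omega>. \<bar>Y \<omega>\<bar> powr p)"
proof -
  have [measurable]: "Y \<in> borel_measurable M" using Y by auto
  have ie: "integrable M (\<lambda>\<omega>. iexp (s * Y \<omega>))" by (intro integrable_iexp) auto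
  have iY: "integrable M (\<lambda>\<omega>. \<i> * complex_of_real (s * Y \<omega>))" using Y by simp
  have "(\<integral>\<omega>. iexp (s * Y \<omega>) - 1 - \<i> * complex_of_real (s * Y \<omega>) \<partial>M) = (\<integral>\<omega>. iexp (s * Y \<omega>) \<partial>M) - 1"
    using ie iY Y by (simp add: prob_space)
  moreover have "norm (\<integral>\<omega>. iexp (s * Y \<omega>) - 1 - \<i> * complex_of_real (s * Y \<omega>) \<partial>M)
      \<le> (\<integral>\<omega>. 2 * \<bar>s\<bar> powr p * \<bar>Y \<omega>\<bar> powr p \<partial>M)"
  proof (rule norm_integral_le_integral)
    show "cmod (iexp (s * Y \<omega>) - 1 - \<i> * complex_of_real (s * Y \<omega>)) \<le> 2 * \<bar>s\<bar> powr p * \<bar>Y \<omega>\<bar> powr p" for \<omega>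
      using iexp_linear_approx[OF p, of "s * Y \<omega>"] by (simp add: abs_mult powr_mult)
  qed (use ie iY Yp in auto)
  moreover have "1 - cmod (\<integral>\<omega>. iexp (s * Y \<omega>) \<partial>M) \<le> cmod ((\<integral>\<omega>. iexp (s * Y \<omega>) \<partial>M) - 1)"
    by (metis norm_minus_commute norm_one norm_triangle_ineq2)
  ultimately show ?thesis by simp
qed

lemma one_minus_cos_ge:
  fixes y :: real
  assumes "\<bar>y\<bar> \<le> 1"
  shows "y^2 / 4 \<le> 1 - cos y"
proof -
  have "\<bar>Re (iexp y - (\<Sum>k\<le>3. (\<i> * y)^k / fact k))\<bar> \<le> \<bar>y\<bar>^Suc 3 / fact (Suc 3)"
    by (rule order_trans[OF abs_Re_le_cmod iexp_approx1])
  moreover have "Re (iexp y - (\<Sum>k\<le>3. (\<i> * y)^k / fact k)) = cos y - (1 - y^2 / 2)"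
    by (simp add: numeral_3_eq_3 power2_eq_square Re_exp Im_exp)
  ultimately have "\<bar>cos y - (1 - y^2 / 2)\<bar> \<le> \<bar>y\<bar>^4 / 24"
    by (simp add: fact_numeral)
  moreover have "\<bar>y\<bar>^4 \<le> \<bar>y\<bar>^2" using assms by (intro power_decreasing) auto
  moreover have "\<bar>y\<bar>^4 = y^4" "\<bar>y\<bar>^2 = y^2" by simp_all
  ultimately have "y^2 / 2 - (1 - cos y) \<le> y^2 / 24" by linarith
  moreover have "0 \<le> y^2" by simp
  ultimately show ?thesis by linarith
qed

text \<open>\<open>Y\<close> may have infinite variance, so the real part is bounded using only the
  values with \<open>|Y| \<le> R\<close>. The modulus also involves the imaginary part; that is
  \<open>o(t)\<close> because \<open>Y\<close> has mean 0, so its square does not spoil a gain of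
  order \<open>t^2\<close>.\<close>

lemma (in prob_space) one_minus_char_ge:
  fixes Y :: "'a \<Rightarrow> real"
  assumes Y: "integrable M Y" "expectation Y = 0" and nz: "\<not> (AE \<omega> in M. Y \<omega> = 0)"
  shows "\<exists>c>0. \<exists>t0>0. \<forall>t. \<bar>t\<bar> \<le> t0 \<longrightarrow> c * t^2 \<le> 1 - cmod (\<integral>\<omega>. iexp (t * Y \<omega>) \<partial>M)"
proof -
  have [measurable]: "Y \<in> borel_measurable M" using Y by auto
  define \<psi> where "\<psi> t = (\<integral>\<omega>. iexp (t * Y \<omega>) \<partial>M)" for t :: real
  have ie: "integrable M (\<lambda>\<omega>. iexp (t * Y \<omega>))" for t by (intro integrable_iexp) auto
  have Re\<psi>: "Re (\<psi> t) = (\<integral>\<omega>. cos (t * Y \<omega>) \<partial>M)" for t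
    unfolding \<psi>_def using ie by (subst integral_Re[symmetric]) (auto simp: Re_exp)
  have Im\<psi>: "Im (\<psi> t) = (\<integral>\<omega>. sin (t * Y \<omega>) \<partial>M)" for t
    unfolding \<psi>_def using ie by (subst integral_Im[symmetric]) (auto simp: Im_exp)
  have \<psi>1: "cmod (\<psi> t) \<le> 1" for t
  proof -
    have "cmod (\<psi> t) \<le> (\<integral>\<omega>. cmod (iexp (t * Y \<omega>)) \<partial>M)" unfolding \<psi>_def by (rule integral_norm_bound)
    then show ?thesis by (simp add: prob_space)
  qed
  obtain R where R: "R > 0" "\<not> (AE \<omega> in M. \<not> (Y \<omega> \<noteq> 0 \<and> \<bar>Y \<omega>\<bar> \<le> R))"
  proof (rule ccontr)
    assume "\<not> thesis"
    then have "AE \<omega> in M. \<not> (Y \<omega> \<noteq> 0 \<and> \<bar>Y \<omega>\<bar> \<le> real (Suc n))" for n using that[of "real (Suc n)"] by auto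
    then have "AE \<omega> in M. \<forall>n. \<not> (Y \<omega> \<noteq> 0 \<and> \<bar>Y \<omega>\<bar> \<le> real (Suc n))" by (subst AE_all_countable) blast
    then have "AE \<omega> in M. Y \<omega> = 0"
    proof eventually_elim
      case (elim \<omega>)
      obtain n :: nat where "\<bar>Y \<omega>\<bar> \<le> real n" using real_arch_simple by blast
      then have "\<bar>Y \<omega>\<bar> \<le> real (Suc n)" by simp
      then show ?case using elim by blast
    qed
    then show False using nz by simp
  qed
  define T where "T \<omega> = (if \<bar>Y \<omega>\<bar> \<le> R then (Y \<omega>)^2 else 0)" for \<omega>
  have [measurable]: "T \<in> borel_measurable M" unfolding T_def by measurable
  have iT: "integrable M T"
    by (rule integrable_const_bound[where B = "R^2"]) (use R(1) in \<open>auto simp: T_def abs_le_square_iff[symmetric]\<close>)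
  \<comment> \<open>A quarter of the truncated second moment, the 4 coming from
    \<open>one_minus_cos_ge\<close>.\<close>
  define \<eta> where "\<eta> = expectation T / 4"
  have "expectation T \<noteq> 0"
  proof
    assume "expectation T = 0"
    then have "AE \<omega> in M. T \<omega> = 0"
      using integral_nonneg_eq_0_iff_AE[OF iT] by (simp add: T_def)
    then have "AE \<omega> in M. \<not> (Y \<omega> \<noteq> 0 \<and> \<bar>Y \<omega>\<bar> \<le> R)" by eventually_elim (auto simp: T_def)
    then show False using R by simp
  qed
  moreover have "expectation T \<ge> 0" by (intro integral_nonneg_AE) (auto simp: T_def)
  ultimately have \<eta>: "\<eta> > 0" by (simp add: \<eta>_def)
  have re: "\<eta> * t^2 \<le> 1 - Re (\<psi> t)" if "\<bar>t\<bar> \<le> 1 / R" for t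
  proof -
    have "\<eta> * t^2 = (\<integral>\<omega>. t^2 / 4 * T \<omega> \<partial>M)" by (simp add: \<eta>_def)
    also have "\<dots> \<le> (\<integral>\<omega>. 1 - cos (t * Y \<omega>) \<partial>M)"
    proof (intro integral_mono integrable_mult_right iT Bochner_Integration.integrable_diff)
      show "integrable M (\<lambda>\<omega>. cos (t * Y \<omega>))" by (rule integrable_const_bound[where B = 1]) auto
      fix \<omega>
      show "t^2 / 4 * T \<omega> \<le> 1 - cos (t * Y \<omega>)"
      proof (cases "\<bar>Y \<omega>\<bar> \<le> R")
        case True
        have "\<bar>t * Y \<omega>\<bar> \<le> 1 / R * R" unfolding abs_mult using that True R(1) by (intro mult_mono) auto
        then have "\<bar>t * Y \<omega>\<bar> \<le> 1" using R(1) by simp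
        from one_minus_cos_ge[OF this] True show ?thesis by (simp add: T_def power_mult_distrib)
      qed (simp add: T_def)
    qed simp
    also have "\<dots> = 1 - Re (\<psi> t)"
      unfolding Re\<psi> by (subst Bochner_Integration.integral_diff) (auto simp: prob_space intro!: integrable_const_bound[where B = 1])
    finally show ?thesis .
  qed
  have im: "((\<lambda>t. Im (\<psi> t) / t) \<longlongrightarrow> 0) (at 0)"
    unfolding tendsto_at_iff_sequentially comp_def
  proof safe
    fix X :: "nat \<Rightarrow> real" assume X: "\<forall>i. X i \<in> UNIV - {0}" "X \<longlonglongrightarrow> 0"
    then have X0: "X n \<noteq> 0" for n by auto
    have "Im (\<psi> (X n)) / X n = (\<integral>\<omega>. sin (X n * Y \<omega>) / X n - Y \<omega> \<partial>M)" for n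
    proof -
      have "integrable M (\<lambda>\<omega>. sin (X n * Y \<omega>))" by (rule integrable_const_bound[where B = 1]) auto
      then show ?thesis using Y by (simp add: Im\<psi>)
    qed
    moreover have "(\<lambda>n. \<integral>\<omega>. sin (X n * Y \<omega>) / X n - Y \<omega> \<partial>M) \<longlonglongrightarrow> (\<integral>\<omega>. 0 \<partial>M)"
    proof (rule integral_dominated_convergence[where w = "\<lambda>\<omega>. 2 * \<bar>Y \<omega>\<bar>"])
      show "AE \<omega> in M. (\<lambda>n. sin (X n * Y \<omega>) / X n - Y \<omega>) \<longlonglongrightarrow> 0"
      proof (rule AE_I2)
        fix \<omega>
        have "((\<lambda>t. sin (t * Y \<omega>)) has_field_derivative Y \<omega>) (at 0)"
          by (auto intro!: derivative_eq_intros)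
        then have "((\<lambda>t. sin (t * Y \<omega>) / t) \<longlongrightarrow> Y \<omega>) (at 0)"
          by (simp add: DERIV_def)
        then have "(\<lambda>n. sin (X n * Y \<omega>) / X n) \<longlonglongrightarrow> Y \<omega>"
          using X unfolding tendsto_at_iff_sequentially comp_def by blast
        from tendsto_diff[OF this tendsto_const[of "Y \<omega>"]]
        show "(\<lambda>n. sin (X n * Y \<omega>) / X n - Y \<omega>) \<longlonglongrightarrow> 0" by simp
      qed
      fix n
      show "AE \<omega> in M. norm (sin (X n * Y \<omega>) / X n - Y \<omega>) \<le> 2 * \<bar>Y \<omega>\<bar>"
      proof (rule AE_I2)
        fix \<omega>
        have "\<bar>sin (X n * Y \<omega>)\<bar> \<le> \<bar>X n * Y \<omega>\<bar>" by (rule abs_sin_x_le_abs_x)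
        then have "\<bar>sin (X n * Y \<omega>) / X n\<bar> \<le> \<bar>Y \<omega>\<bar>" using X0[of n] by (simp add: abs_mult field_simps)
        then show "norm (sin (X n * Y \<omega>) / X n - Y \<omega>) \<le> 2 * \<bar>Y \<omega>\<bar>" unfolding real_norm_def by linarith
      qed
    qed (use Y in auto)
    ultimately show "(\<lambda>n. Im (\<psi> (X n)) / X n) \<longlonglongrightarrow> 0" by simp
  qed
  have re1: "((\<lambda>t. Re (\<psi> t)) \<longlongrightarrow> 1) (at 0)"
    unfolding tendsto_at_iff_sequentially comp_def
  proof safe
    fix X :: "nat \<Rightarrow> real" assume X: "X \<longlonglongrightarrow> 0"
    have "(\<lambda>n. \<integral>\<omega>. cos (X n * Y \<omega>) \<partial>M) \<longlonglongrightarrow> (\<integral>\<omega>. 1 \<partial>M)"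
    proof (rule integral_dominated_convergence[where w = "\<lambda>\<omega>. 1"])
      show "AE \<omega> in M. (\<lambda>n. cos (X n * Y \<omega>)) \<longlonglongrightarrow> 1"
        using tendsto_cos[OF tendsto_mult[OF X tendsto_const]] by auto
    qed auto
    then show "(\<lambda>n. Re (\<psi> (X n))) \<longlonglongrightarrow> 1" by (simp add: Re\<psi> prob_space)
  qed
  \<comment> \<open>The bound \<open>sqrt (\<eta> / 2)\<close> makes the squared imaginary part at
    most half of the gain \<open>\<eta> * t^2\<close> in the squared real part.\<close>
  have "\<forall>\<^sub>F t in at 0. \<bar>Im (\<psi> t) / t\<bar> < sqrt (\<eta> / 2)"
    using tendstoD[OF im, of "sqrt (\<eta> / 2)"] \<eta> by (simp add: dist_real_def)
  moreover have "\<forall>\<^sub>F t in at 0. 0 < Re (\<psi> t)" by (rule order_tendstoD(1)[OF re1]) simp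
  ultimately have "\<forall>\<^sub>F t in at 0. \<bar>Im (\<psi> t) / t\<bar> < sqrt (\<eta> / 2) \<and> 0 < Re (\<psi> t)" by eventually_elim auto
  then obtain d where d: "d > 0" "\<And>t. t \<noteq> 0 \<Longrightarrow> \<bar>t\<bar> < d \<Longrightarrow> \<bar>Im (\<psi> t) / t\<bar> < sqrt (\<eta> / 2) \<and> 0 < Re (\<psi> t)"
    unfolding eventually_at by (auto simp: dist_real_def)
  have "\<eta> / 4 * t^2 \<le> 1 - cmod (\<psi> t)" if t: "\<bar>t\<bar> \<le> min (1 / R) (d / 2)" for t
  proof (cases "t = 0")
    case True
    then show ?thesis using \<psi>1[of t] by simp
  next
    case False
    with t d have im_t: "\<bar>Im (\<psi> t) / t\<bar> < sqrt (\<eta> / 2)" and re_t: "0 < Re (\<psi> t)" by auto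
    have "(Im (\<psi> t) / t)^2 \<le> (sqrt (\<eta> / 2))^2"
      using im_t \<eta> by (intro abs_le_square_iff[THEN iffD1]) auto
    then have 1: "(Im (\<psi> t))^2 \<le> \<eta> / 2 * t^2" using False \<eta> by (simp add: power_divide field_simps)
    have "Re (\<psi> t) \<le> 1" using re[of t] t \<eta> by (smt (verit) mult_nonneg_nonneg zero_le_power2)
    then have "(Re (\<psi> t))^2 \<le> Re (\<psi> t)" using re_t by (simp add: power2_eq_square mult_left_le)
    then have 2: "(Re (\<psi> t))^2 \<le> 1 - \<eta> * t^2" using re[of t] t by linarith
    have "(cmod (\<psi> t))^2 \<le> 1 - \<eta> / 2 * t^2" using 1 2 by (simp add: cmod_power2)
    \<comment> \<open>Passing from the squared modulus to the modulus costs another factor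
      2.\<close>
    moreover have "(1 - cmod (\<psi> t))^2 \<ge> 0" by simp
    then have "1 - (cmod (\<psi> t))^2 \<le> 2 * (1 - cmod (\<psi> t))"
      by (simp add: power2_eq_square algebra_simps)
    ultimately show ?thesis by simp
  qed
  moreover have "\<eta> / 4 > 0" "min (1 / R) (d / 2) > 0" using \<eta> d R(1) by auto
  ultimately show ?thesis unfolding \<psi>_def by blast
qed

section \<open>Products over a generation\<close>

lemma prod_node_box_Suc:
  "(\<Prod>v\<in>node_box (Suc n) k. f v) = (\<Prod>u\<in>node_box n k. \<Prod>i<k. f (u @ [i]))"
proof -
  have eq: "node_box (Suc n) k = (\<lambda>(u, i). u @ [i]) ` (node_box n k \<times> {..<k})"
    by (force simp: node_box_def length_Suc_conv_rev image_iff)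
  have "inj_on (\<lambda>(u, i). u @ [i]) (node_box n k \<times> {..<k})" by (auto simp: inj_on_def)
  then show ?thesis
    unfolding eq by (subst prod.reindex) (auto simp: prod.cartesian_product split_def)
qed

context weight_law
begin

text \<open>Conditionally on the weights of the earlier generations, the nodes of one generation are independent.\<close>

lemma integral_prod_generation:
  fixes h :: "real \<Rightarrow> (nat \<Rightarrow> real) \<Rightarrow> 'b::{real_normed_field, banach, second_countable_topology}"
  assumes h [measurable]: "(\<lambda>(x, z). h x z) \<in> borel_measurable (borel \<Otimes>\<^sub>M N)"
    and h1: "\<And>x z. norm (h x z) \<le> 1"
    and F: "finite F" "\<And>v. v \<in> F \<Longrightarrow> length v = n"
    and Y: "Y \<in> borel_measurable env" "\<And>e. norm (Y e) \<le> 1" "\<And>v e z. v \<in> F \<Longrightarrow> Y (e(v := z)) = Y e"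
  shows "(\<integral> e. Y e * (\<Prod>v\<in>F. h (node_weight v e) (e v)) \<partial>env) =
    (\<integral> e. Y e * (\<Prod>v\<in>F. \<integral> z. h (node_weight v e) z \<partial>N) \<partial>env)"
  using F Y
\<comment> \<open>\<open>Y\<close> must be arbitrary because it collects the factors already
  integrated out. They read weights of generation \<open>n\<close>, which do not change when a node
  of that generation is resampled.\<close>
proof (induction F arbitrary: Y rule: finite_induct)
  case (insert w F)
  note [measurable] = insert.prems(2)
  have hN [measurable]: "(\<lambda>z. h x z) \<in> borel_measurable N" for x
    using measurable_compose[OF _ h, of "\<lambda>z. (x, z)" N] by simp
  have hv [measurable]: "(\<lambda>e. h (node_weight v e) (e v)) \<in> borel_measurable env" for v
    using measurable_compose[OF _ h, of "\<lambda>e. (node_weight v e, e v)" env] by simp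
  define H where "H x = (\<integral> z. h x z \<partial>N)" for x
  have [measurable]: "H \<in> borel_measurable borel"
    unfolding H_def by (rule borel_measurable_lebesgue_integral[OF h])
  have H1: "norm (H x) \<le> 1" for x
  proof -
    have "norm (H x) \<le> (\<integral> z. 1 \<partial>N)"
      unfolding H_def by (rule norm_integral_le_integral)
        (use h1 in \<open>auto intro!: integrable_const_bound[where B = 1]\<close>)
    then show ?thesis using prob_space by simp
  qed
  have w: "length w = n" "\<And>v. v \<in> F \<Longrightarrow> length v = n" using insert by auto
  let ?P = "\<lambda>e. \<Prod>v\<in>F. h (node_weight v e) (e v)"
  have P1: "norm (?P e) \<le> 1" for e
    unfolding prod_norm[symmetric] using h1 by (intro prod_le_1) auto
  have P_upd: "?P (e(w := z)) = ?P e" for e z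
    using insert.hyps w by (intro prod.cong) auto
  have "integrable env (\<lambda>e. Y e * (\<Prod>v\<in>insert w F. h (node_weight v e) (e v)))"
  proof (rule env.integrable_const_bound[where B = 1])
    show "AE e in env. norm (Y e * (\<Prod>v\<in>insert w F. h (node_weight v e) (e v))) \<le> 1"
    proof (rule AE_I2)
      fix e
      have "norm (\<Prod>v\<in>insert w F. h (node_weight v e) (e v)) \<le> 1"
        unfolding prod_norm[symmetric] using h1 by (intro prod_le_1) auto
      then show "norm (Y e * (\<Prod>v\<in>insert w F. h (node_weight v e) (e v))) \<le> 1"
        unfolding norm_mult using insert.prems(3) by (intro mult_le_one) auto
    qed
  qed measurable
  then have "(\<integral> e. Y e * (\<Prod>v\<in>insert w F. h (node_weight v e) (e v)) \<partial>env) =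
    (\<integral> e. \<integral> z. Y (e(w := z)) * (\<Prod>v\<in>insert w F. h (node_weight v (e(w := z))) ((e(w := z)) v)) \<partial>N \<partial>env)"
    by (rule integral_resample)
  also have "\<dots> = (\<integral> e. \<integral> z. (Y e * ?P e) * h (node_weight w e) z \<partial>N \<partial>env)"
  proof -
    have "Y (e(w := z)) * (\<Prod>v\<in>insert w F. h (node_weight v (e(w := z))) ((e(w := z)) v)) =
        (Y e * ?P e) * h (node_weight w e) z" for e z
      unfolding prod.insert[OF insert.hyps] P_upd by (simp add: insert.prems(4) mult_ac)
    then show ?thesis by simp
  qed
  also have "\<dots> = (\<integral> e. (Y e * H (node_weight w e)) * ?P e \<partial>env)"
    by (simp add: H_def mult_ac)
  also have "\<dots> = (\<integral> e. (Y e * H (node_weight w e)) * (\<Prod>v\<in>F. H (node_weight v e)) \<partial>env)"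
    unfolding H_def[symmetric]
  proof (rule insert.IH[folded H_def])
    show "norm (Y e * H (node_weight w e)) \<le> 1" for e
      unfolding norm_mult using insert.prems(3) H1 by (intro mult_le_one) auto
    show "Y (e(v := z)) * H (node_weight w (e(v := z))) = Y e * H (node_weight w e)" if "v \<in> F" for v e z
    proof -
      have "length w \<le> length v" using that w by simp
      from node_weight_upd[OF this] show ?thesis
        by (simp only: insert.prems(4)[OF insertI2[OF that]])
    qed
  qed (use w in auto)
  also have "\<dots> = (\<integral> e. Y e * (\<Prod>v\<in>insert w F. H (node_weight v e)) \<partial>env)"
    using insert.hyps by (simp add: mult_ac)
  finally show ?case by (simp only: H_def)
qed simp

end

section \<open>Subharmonic functions for tilted random walks\<close>

text \<open>The jump measure of the walk, whose mass need not be 1. Compact support makes all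
  exponential moments finite and continuous in \<open>s\<close>, also outside
  \<open>[p,2]\<close>.\<close>

locale compact_finite_measure = finite_measure \<kappa> for \<kappa> :: "real measure" +
  fixes l :: real
  assumes sets_kappa [measurable_cong]: "sets \<kappa> = sets borel"
    and support: "AE y in \<kappa>. \<bar>y\<bar> \<le> l"
begin

lemma integrable_continuous:
  assumes "continuous_on UNIV (f :: real \<Rightarrow> real)"
  shows "integrable \<kappa> f"
proof -
  obtain B where B: "\<And>y. y \<in> {-l..l} \<Longrightarrow> norm (f y) \<le> B"
    using compact_imp_bounded[OF compact_continuous_image[OF continuous_on_subset[OF assms] compact_Icc]]
    unfolding bounded_iff by (metis imageI subset_UNIV)
  show ?thesis
  proof (rule integrable_const_bound)
    show "AE y in \<kappa>. norm (f y) \<le> B" using support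
    proof eventually_elim
      case (elim y)
      then have "y \<in> {-l..l}" by auto
      then show ?case by (rule B)
    qed
    show "f \<in> borel_measurable \<kappa>"
      using borel_measurable_continuous_onI[OF assms] measurable_cong_sets[OF sets_kappa refl] by blast
  qed
qed

definition mgf :: "real \<Rightarrow> real" where "mgf s = (\<integral> y. exp (s * y) \<partial>\<kappa>)"

text \<open>The derivative of \<open>mgf\<close>, which also locates the drift: the measure tilted
  by \<open>exp (s * y)\<close> has mean \<open>mgf' s / mgf s\<close>.\<close>

definition mgf' :: "real \<Rightarrow> real" where "mgf' s = (\<integral> y. y * exp (s * y) \<partial>\<kappa>)"

lemma integrable_mgf: "integrable \<kappa> (\<lambda>y. exp (s * y))" "integrable \<kappa> (\<lambda>y. y * exp (s * y))"
  by (auto intro!: integrable_continuous continuous_intros)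

lemma isCont_integral_exp:
  assumes f: "continuous_on UNIV (f :: real \<Rightarrow> real)"
  shows "isCont (\<lambda>s. \<integral> y. f y * exp (s * y) \<partial>\<kappa>) s"
  unfolding continuous_at_sequentially comp_def
proof safe
  fix X :: "nat \<Rightarrow> real" assume X: "X \<longlonglongrightarrow> s"
  have [measurable]: "f \<in> borel_measurable \<kappa>" using integrable_continuous[OF f] by auto
  obtain R where R: "\<And>n. \<bar>X n\<bar> \<le> R"
    using convergent_imp_Bseq[OF convergentI[OF X]] by (auto simp: Bseq_def)
  show "(\<lambda>n. \<integral> y. f y * exp (X n * y) \<partial>\<kappa>) \<longlonglongrightarrow> (\<integral> y. f y * exp (s * y) \<partial>\<kappa>)"
  proof (rule integral_dominated_convergence[where w = "\<lambda>y. \<bar>f y\<bar> * exp (R * l)"])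
    show "integrable \<kappa> (\<lambda>y. \<bar>f y\<bar> * exp (R * l))"
      by (intro integrable_continuous continuous_intros f)
    show "AE y in \<kappa>. (\<lambda>n. f y * exp (X n * y)) \<longlonglongrightarrow> f y * exp (s * y)"
      by (intro AE_I2 tendsto_intros X)
    fix n
    show "AE y in \<kappa>. norm (f y * exp (X n * y)) \<le> \<bar>f y\<bar> * exp (R * l)"
      using support
    proof eventually_elim
      case (elim y)
      have "X n * y \<le> \<bar>X n\<bar> * \<bar>y\<bar>" by (metis abs_ge_self abs_mult)
      also have "\<dots> \<le> R * l" using R[of n] elim by (intro mult_mono) auto
      finally show ?case by (auto simp: abs_mult intro!: mult_left_mono)
    qed
  qed auto
qed

lemma continuous_on_mgf': "continuous_on A mgf'"
  using isCont_integral_exp[of "\<lambda>y. y"]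
  by (auto intro!: continuous_at_imp_continuous_on simp: mgf'_def[abs_def])

text \<open>The tangent inequality of the convex function \<open>mgf\<close>, from
  \<open>1 + x \<le> exp x\<close> under the integral.\<close>

lemma mgf_diff_le: "mgf s - mgf t \<le> (s - t) * mgf' s"
proof -
  have "mgf s - mgf t = (\<integral> y. exp (s * y) - exp (t * y) \<partial>\<kappa>)"
    using integrable_mgf by (simp add: mgf_def)
  also have "\<dots> \<le> (\<integral> y. (s - t) * (y * exp (s * y)) \<partial>\<kappa>)"
  proof (intro integral_mono Bochner_Integration.integrable_diff integrable_mult_right integrable_mgf)
    fix y
    have "1 + (t - s) * y \<le> exp ((t - s) * y)" by (rule exp_ge_add_one_self)
    then have "(1 + (t - s) * y) * exp (s * y) \<le> exp ((t - s) * y) * exp (s * y)"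
      by (rule mult_right_mono) simp
    then show "exp (s * y) - exp (t * y) \<le> (s - t) * (y * exp (s * y))"
      by (simp add: algebra_simps exp_add[symmetric])
  qed
  finally show ?thesis by (simp add: mgf'_def)
qed

text \<open>
  A parabola on a long window is almost harmonic for a centred random walk: in the middle the
  variance is negligible, and near an endpoint the jumps towards the middle alone suffice.
\<close>

lemma parabola_subharmonic:
  fixes s d c :: real
  assumes centred: "(\<integral> y. exp (s * y) * (y - d) \<partial>\<kappa>) = 0" and c: "1 < c" "c \<le> mgf s"
  obtains h \<epsilon> where "h > 0" "\<epsilon> > 0"
    "\<And>x. (1 + \<epsilon>) * max 0 (h^2 - x^2) \<le> (\<integral> y. exp (s * y) * max 0 (h^2 - (x + (y - d))^2) \<partial>\<kappa>)"
proof -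
  define m where "m = mgf s"
  \<comment> \<open>Chosen so that \<open>(1 - \<eta>) * c = 1 + (c - 1) / 2\<close>: half of the
    excess of \<open>c\<close> over 1 is given up.\<close>
  define \<eta> where "\<eta> = (c - 1) / (2 * c)"
  have \<eta>: "0 < \<eta>" "\<eta> < 1" using c by (auto simp: \<eta>_def field_simps)
  have m: "m > 1" "m \<ge> c" using c by (auto simp: m_def)
  define L where "L = \<bar>l\<bar> + \<bar>d\<bar>"
  have L: "L \<ge> 0" by (simp add: L_def)
  have sup: "AE y in \<kappa>. \<bar>y - d\<bar> \<le> L" using support by eventually_elim (auto simp: L_def)
  \<comment> \<open>By centring, the positive and negative parts of \<open>y - d\<close> have the
    same tilted integral \<open>q\<close>, so the tilted integral of \<open>(y - d)^2\<close> is at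
    most \<open>2 * L * q\<close>.\<close>
  define q where "q = (\<integral> y. exp (s * y) * max 0 (d - y) \<partial>\<kappa>)"
  have int: "integrable \<kappa> (\<lambda>y. exp (s * y) * f y)" if "continuous_on UNIV f" for f
    using that by (intro integrable_continuous continuous_intros)
  have q0: "q \<ge> 0" unfolding q_def by (intro integral_nonneg_AE) auto
  have q': "q = (\<integral> y. exp (s * y) * max 0 (y - d) \<partial>\<kappa>)"
  proof -
    have "(\<integral> y. exp (s * y) * max 0 (y - d) \<partial>\<kappa>) - q = (\<integral> y. exp (s * y) * max 0 (y - d) - exp (s * y) * max 0 (d - y) \<partial>\<kappa>)"
      unfolding q_def by (intro Bochner_Integration.integral_diff[symmetric] int continuous_intros)
    also have "\<dots> = (\<integral> y. exp (s * y) * (y - d) \<partial>\<kappa>)"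
      by (intro Bochner_Integration.integral_cong) (auto simp: max_def algebra_simps)
    finally show ?thesis using centred by simp
  qed
  \<comment> \<open>Beyond \<open>T\<close> one has \<open>2 * |x| - L \<ge> 2 * L / \<eta>\<close>,
    as needed near an endpoint. Then \<open>h\<close> is taken so large that every point of the
    window where the variance is not negligible lies beyond \<open>T\<close>.\<close>
  define T where "T = L / 2 + L / \<eta> + 1"
  have T: "T > 0" using L \<eta> by (simp add: T_def add_nonneg_pos)
  define h where "h = sqrt (T^2 + 2 * L * q / (\<eta> * m))"
  have nn: "0 \<le> 2 * L * q / (\<eta> * m)" using L q0 \<eta> m by simp
  have h2: "h^2 = T^2 + 2 * L * q / (\<eta> * m)" using nn by (simp add: h_def)
  have h: "h > 0" using T nn by (simp add: h_def add_pos_nonneg)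
  let ?w = "\<lambda>x. max 0 (h^2 - x^2)"
  let ?I = "\<lambda>x. (\<integral> y. exp (s * y) * ?w (x + (y - d)) \<partial>\<kappa>)"
  have intw: "integrable \<kappa> (\<lambda>y. exp (s * y) * ?w (x + (y - d)))" for x
    by (rule int) (auto intro!: continuous_intros)
  have main: "(1 - \<eta>) * (m * ?w x) \<le> ?I x" for x
  proof (cases "\<bar>x\<bar> < h")
    case False
    then have "h^2 \<le> x^2" using h by (metis abs_le_square_iff abs_of_pos not_less)
    then have "?w x = 0" by simp
    moreover have "0 \<le> ?I x" by (intro integral_nonneg_AE) auto
    ultimately show ?thesis by simp
  next
    case True
    then have "x^2 < h^2" using h by (metis abs_le_square_iff abs_of_pos not_le)
    then have wx: "?w x = h^2 - x^2" by simp
    show ?thesis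
    proof (cases "2 * L * q \<le> \<eta> * (m * ?w x)")
      case True
      have "m * ?w x - 2 * L * q = (\<integral> y. exp (s * y) * (?w x - 2 * x * (y - d) - L * (max 0 (y - d) + max 0 (d - y))) \<partial>\<kappa>)"
      proof -
        have "(\<integral> y. exp (s * y) * (?w x - 2 * x * (y - d) - L * (max 0 (y - d) + max 0 (d - y))) \<partial>\<kappa>) =
          (\<integral> y. ?w x * exp (s * y) - 2 * x * (exp (s * y) * (y - d)) - L * (exp (s * y) * max 0 (y - d)) - L * (exp (s * y) * max 0 (d - y)) \<partial>\<kappa>)"
          by (intro Bochner_Integration.integral_cong) (auto simp: algebra_simps)
        also have "\<dots> = ?w x * m - 2 * x * 0 - L * q - L * q"
          using integrable_mgf int[of "\<lambda>y. y - d"] int[of "\<lambda>y. max 0 (y - d)"] int[of "\<lambda>y. max 0 (d - y)"]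
          by (simp add: m_def mgf_def centred q'[symmetric] q_def[symmetric] continuous_intros)
        finally show ?thesis by (simp add: algebra_simps)
      qed
      also have "\<dots> \<le> ?I x"
      proof (intro integral_mono_AE int intw)
        show "AE y in \<kappa>. exp (s * y) * (?w x - 2 * x * (y - d) - L * (max 0 (y - d) + max 0 (d - y))) \<le> exp (s * y) * ?w (x + (y - d))"
          using sup
        proof eventually_elim
          case (elim y)
          have "(y - d)^2 = \<bar>y - d\<bar> * \<bar>y - d\<bar>" by (simp add: power2_eq_square)
          also have "\<dots> \<le> L * \<bar>y - d\<bar>" using elim by (intro mult_right_mono) auto
          also have "\<bar>y - d\<bar> = max 0 (y - d) + max 0 (d - y)" by (auto simp: max_def)
          finally have "?w x - 2 * x * (y - d) - L * (max 0 (y - d) + max 0 (d - y)) \<le> h^2 - (x + (y - d))^2"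
            unfolding wx by (simp add: power2_sum)
          then show ?case by (intro mult_left_mono) auto
        qed
      qed (auto intro!: continuous_intros)
      finally show ?thesis using True by (simp add: algebra_simps)
    next
      case False
      then have lt: "m * ?w x < 2 * L * q / \<eta>" using \<eta> by (simp add: field_simps)
      then have "h^2 - x^2 < 2 * L * q / (\<eta> * m)" using m \<eta> unfolding wx by (simp add: field_simps)
      then have "T^2 < x^2" unfolding h2 by simp
      then have "T < \<bar>x\<bar>" using T by (metis abs_le_square_iff abs_of_pos not_le)
      then have xL: "2 * L / \<eta> \<le> 2 * \<bar>x\<bar> - L" by (simp add: T_def)
      have "(1 - \<eta>) * (m * ?w x) \<le> m * ?w x" using \<eta> m by (simp add: algebra_simps mult_nonneg_nonneg)
      also have "\<dots> \<le> (2 * L / \<eta>) * q" using lt by simp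
      also have "\<dots> \<le> (2 * \<bar>x\<bar> - L) * q" by (rule mult_right_mono[OF xL q0])
      also have "\<dots> \<le> ?I x"
      proof -
        \<comment> \<open>\<open>g y\<close> is the length of a jump towards the middle. Such a jump
          raises the parabola by at least \<open>(2 * |x| - L) * g y\<close>; the other jumps can be
          ignored because the parabola is cut off at 0.\<close>
        define g where "g y = (if x \<ge> 0 then max 0 (d - y) else max 0 (y - d))" for y
        have gc: "continuous_on UNIV g"
          unfolding g_def by (cases "x \<ge> 0") (auto intro!: continuous_intros)
        have "(2 * \<bar>x\<bar> - L) * q = (\<integral> y. (2 * \<bar>x\<bar> - L) * (exp (s * y) * g y) \<partial>\<kappa>)"
          using int[OF gc] q' q_def by (cases "x \<ge> 0") (simp_all add: g_def[abs_def])
        also have "\<dots> \<le> ?I x"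
        proof (intro integral_mono_AE intw integrable_mult_right int[OF gc])
          show "AE y in \<kappa>. (2 * \<bar>x\<bar> - L) * (exp (s * y) * g y) \<le> exp (s * y) * ?w (x + (y - d))"
            using sup
          proof eventually_elim
            case (elim y)
            have gL: "0 \<le> g y" "g y \<le> L" using elim L by (auto simp: g_def)
            have "(2 * \<bar>x\<bar> - L) * g y \<le> ?w (x + (y - d))"
            proof (cases "g y = 0")
              case False
              then have xy: "x * (y - d) = - (\<bar>x\<bar> * g y)" "(y - d)^2 = g y * g y"
                by (auto simp: g_def max_def power2_eq_square algebra_simps split: if_splits)
              have "(2 * \<bar>x\<bar> - L) * g y \<le> 2 * \<bar>x\<bar> * g y - g y * g y"
                using gL by (simp add: algebra_simps mult_right_mono)
              also have "\<dots> \<le> (h^2 - x^2) - 2 * (x * (y - d)) - (y - d)^2"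
                using \<open>x^2 < h^2\<close> unfolding xy by simp
              also have "\<dots> = h^2 - (x + (y - d))^2" by (simp add: power2_sum)
              finally show ?thesis by simp
            qed simp
            then have "exp (s * y) * ((2 * \<bar>x\<bar> - L) * g y) \<le> exp (s * y) * ?w (x + (y - d))"
              by (rule mult_left_mono) simp
            then show ?case by (simp add: mult_ac)
          qed
        qed
        finally show ?thesis .
      qed
      finally show ?thesis .
    qed
  qed
  show ?thesis
  proof (rule that[OF h, of "(c - 1) / 2"])
    show "(c - 1) / 2 > 0" using c by simp
    fix x
    have "1 + (c - 1) / 2 = (1 - \<eta>) * c" using c by (simp add: \<eta>_def field_simps)
    also have "\<dots> \<le> (1 - \<eta>) * m" using \<eta> m by (intro mult_left_mono) auto
    finally have "(1 + (c - 1) / 2) * ?w x \<le> (1 - \<eta>) * m * ?w x" by (rule mult_right_mono) simp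
    also have "\<dots> \<le> ?I x" using main[of x] by (simp add: mult.assoc)
    finally show "(1 + (c - 1) / 2) * ?w x \<le> ?I x" .
  qed
qed

text \<open>Multiplying the parabola by \<open>exp (s * x)\<close> undoes the tilt and leaves the
  factor \<open>exp (- s * d)\<close>. The hypothesis \<open>s * d = p * d\<close> turns this into
  \<open>exp (- d * p)\<close>; it covers the tilt \<open>s = p\<close> with any drift and any tilt
  without drift.\<close>

lemma subsolution_window:
  fixes s d p c :: real
  assumes centred: "(\<integral> y. exp (s * y) * (y - d) \<partial>\<kappa>) = 0" and c: "1 < c" "c \<le> mgf s"
    and sd: "s * d = p * d"
  shows "\<exists>\<epsilon> B x0 x1 V. \<epsilon> > 0 \<and> V \<in> borel_measurable borel \<and> (\<forall>x. 0 \<le> V x \<and> V x \<le> B \<and> V x \<le> B * exp (2 * x))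
    \<and> V x0 > 0 \<and> (\<forall>x>x1. V x = 0) \<and>
    (\<forall>x. (1 + \<epsilon>) * (exp (- d * p) * V x) \<le> (\<integral> y. V (x + (y - d)) \<partial>\<kappa>))"
proof -
  obtain h \<epsilon> where h: "h > 0" and \<epsilon>: "\<epsilon> > 0" and
    w: "\<And>x. (1 + \<epsilon>) * max 0 (h^2 - x^2) \<le> (\<integral> y. exp (s * y) * max 0 (h^2 - (x + (y - d))^2) \<partial>\<kappa>)"
    using parabola_subharmonic[OF centred c] by blast
  define V where "V x = exp (s * x) * max 0 (h^2 - x^2)" for x
  \<comment> \<open>In the window \<open>x \<ge> - h\<close>, so the last factor lets
    \<open>B * exp (2 * x)\<close> dominate too.\<close>
  define B where "B = exp (\<bar>s\<bar> * h) * h^2 * exp (2 * h)"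
  have far: "V x = 0" if "\<bar>x\<bar> \<ge> h" for x
  proof -
    have "h^2 \<le> x^2" using that h by (metis abs_le_square_iff abs_of_pos)
    then show ?thesis by (simp add: V_def)
  qed
  have V0: "V x \<le> exp (\<bar>s\<bar> * h) * h^2" for x
  proof (cases "\<bar>x\<bar> \<ge> h")
    case False
    have "s * x \<le> \<bar>s\<bar> * \<bar>x\<bar>" by (metis abs_ge_self abs_mult)
    also have "\<dots> \<le> \<bar>s\<bar> * h" using False by (intro mult_left_mono) auto
    finally show ?thesis unfolding V_def using h by (intro mult_mono) auto
  qed (simp add: far)
  have B1: "V x \<le> B" for x
  proof -
    have "exp (\<bar>s\<bar> * h) * h^2 * 1 \<le> B" unfolding B_def using h by (intro mult_left_mono) auto
    then show ?thesis using V0[of x] by simp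
  qed
  have B2: "V x \<le> B * exp (2 * x)" for x
  proof (cases "\<bar>x\<bar> \<ge> h")
    case False
    have "exp (\<bar>s\<bar> * h) * h^2 * 1 \<le> exp (\<bar>s\<bar> * h) * h^2 * exp (2 * h + 2 * x)"
      using False by (intro mult_left_mono) auto
    also have "\<dots> = B * exp (2 * x)" by (simp add: B_def exp_add)
    finally show ?thesis using V0[of x] by simp
  qed (simp add: far B_def)
  have "(1 + \<epsilon>) * (exp (- d * p) * V x) \<le> (\<integral> y. V (x + (y - d)) \<partial>\<kappa>)" for x
  proof -
    have eq: "V (x + (y - d)) = exp (s * x - d * p) * (exp (s * y) * max 0 (h^2 - (x + (y - d))^2))" for y
    proof -
      have "s * (x + (y - d)) = (s * x - s * d) + s * y" by (simp add: algebra_simps)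
      moreover have "s * d = d * p" using sd by (metis mult.commute)
      ultimately have "s * (x + (y - d)) = (s * x - d * p) + s * y" by linarith
      then show ?thesis unfolding V_def by (simp only: exp_add mult.assoc)
    qed
    have "(1 + \<epsilon>) * (exp (- d * p) * V x) = exp (s * x - d * p) * ((1 + \<epsilon>) * max 0 (h^2 - x^2))"
      by (simp add: V_def exp_diff exp_minus field_simps)
    also have "\<dots> \<le> exp (s * x - d * p) * (\<integral> y. exp (s * y) * max 0 (h^2 - (x + (y - d))^2) \<partial>\<kappa>)"
      by (intro mult_left_mono w) auto
    also have "\<dots> = (\<integral> y. V (x + (y - d)) \<partial>\<kappa>)" by (simp add: eq)
    finally show ?thesis .
  qed
  moreover have "V \<in> borel_measurable borel" unfolding V_def by measurable
  moreover have "\<forall>x. 0 \<le> V x \<and> V x \<le> B \<and> V x \<le> B * exp (2 * x)"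
    using B1 B2 by (simp add: V_def)
  moreover have "V 0 > 0" using h by (simp add: V_def)
  moreover have "\<forall>x>h. V x = 0" using far by auto
  ultimately show ?thesis using \<epsilon>
    by - (rule exI[of _ \<epsilon>], rule exI[of _ B], rule exI[of _ 0], rule exI[of _ h], rule exI[of _ V],
        simp only: simp_thms)
qed

text \<open>The cases say where the convex function \<open>mgf\<close> has its minimum. Left of
  \<open>p\<close>: the walk tilted at \<open>p\<close> moves right, and the window follows it with
  speed \<open>d > 0\<close>. In \<open>[p,2]\<close>: tilting at the minimum leaves no drift. Right
  of 2: the walk tilted at 2 moves left, and following it would need \<open>d < 0\<close>; instead
  \<open>V\<close> extends over the negative half-line with the largest size allowed,
  \<open>exp (2 * x)\<close>.\<close>

lemma subsolution_exists:
  fixes p c :: real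
  assumes p: "1 < p" "p < 2" and c: "1 < c" "\<forall>s\<in>{p..2}. c \<le> mgf s"
  shows "\<exists>d \<epsilon> B x0 x1 V. 0 \<le> d \<and> \<epsilon> > 0 \<and> V \<in> borel_measurable borel \<and>
    (\<forall>x. 0 \<le> V x \<and> V x \<le> B \<and> V x \<le> B * exp (2 * x)) \<and> V x0 > 0 \<and> (\<forall>x>x1. V x = 0) \<and>
    (\<forall>x. (1 + \<epsilon>) * (exp (- d * p) * V x) \<le> (\<integral> y. V (x + (y - d)) \<partial>\<kappa>))"
proof -
  have c2: "c \<le> mgf s" if "s \<in> {p..2}" for s using c(2) that by blast
  consider "mgf' p > 0" | "mgf' p \<le> 0" "mgf' 2 \<ge> 0" | "mgf' 2 < 0" by linarith
  then show ?thesis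
  proof cases
    case 1
    define d where "d = mgf' p / mgf p"
    have mp: "mgf p > 1" using c2[of p] p c(1) by force
    have "(\<integral> y. exp (p * y) * (y - d) \<partial>\<kappa>) = (\<integral> y. y * exp (p * y) - d * exp (p * y) \<partial>\<kappa>)"
      by (intro Bochner_Integration.integral_cong) (auto simp: algebra_simps)
    also have "\<dots> = mgf' p - d * mgf p" using integrable_mgf by (simp add: mgf_def mgf'_def)
    also have "\<dots> = 0" using mp by (simp add: d_def)
    finally have "(\<integral> y. exp (p * y) * (y - d) \<partial>\<kappa>) = 0" .
    moreover have "c \<le> mgf p" using p c2 by simp
    ultimately have "\<exists>\<epsilon> B x0 x1 V. \<epsilon> > 0 \<and> V \<in> borel_measurable borel \<and> (\<forall>x. 0 \<le> V x \<and> V x \<le> B \<and> V x \<le> B * exp (2 * x))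
      \<and> V x0 > 0 \<and> (\<forall>x>x1. V x = 0) \<and> (\<forall>x. (1 + \<epsilon>) * (exp (- d * p) * V x) \<le> (\<integral> y. V (x + (y - d)) \<partial>\<kappa>))"
      using c(1) by (intro subsolution_window) auto
    moreover have "0 \<le> d" using 1 mp by (simp add: d_def)
    ultimately show ?thesis by blast
  next
    case 2
    obtain s where s: "p \<le> s" "s \<le> 2" "mgf' s = 0"
      using IVT'[of mgf' p 0 2] 2 p continuous_on_mgf' by auto
    have "(\<integral> y. exp (s * y) * (y - 0) \<partial>\<kappa>) = 0"
      using s(3) by (simp add: mgf'_def mult.commute)
    moreover have "c \<le> mgf s" using s c2 by simp
    moreover have "s * 0 = p * 0" by simp
    ultimately have "\<exists>\<epsilon> B x0 x1 V. \<epsilon> > 0 \<and> V \<in> borel_measurable borel \<and> (\<forall>x. 0 \<le> V x \<and> V x \<le> B \<and> V x \<le> B * exp (2 * x))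
      \<and> V x0 > 0 \<and> (\<forall>x>x1. V x = 0) \<and> (\<forall>x. (1 + \<epsilon>) * (exp (- 0 * p) * V x) \<le> (\<integral> y. V (x + (y - 0)) \<partial>\<kappa>))"
      using c(1) by (intro subsolution_window)
    then show ?thesis by blast
  next
    case 3
    \<comment> \<open>\<open>mgf'\<close> stays negative slightly beyond 2, which gives
      \<open>s > 2\<close> with \<open>mgf s \<le> mgf 2\<close>.\<close>
    have "isCont mgf' 2" using continuous_on_mgf'[of UNIV] by (auto simp: continuous_on_eq_continuous_at)
    then have "(mgf' \<longlongrightarrow> mgf' 2) (at_right 2)" by (auto simp: isCont_def intro: filterlim_mono at_le)
    from order_tendstoD(2)[OF this 3] eventually_at_right_less[of "2::real"]
    have "\<forall>\<^sub>F s in at_right 2. mgf' s < 0 \<and> 2 < s" by eventually_elim auto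
    then obtain s where s: "mgf' s < 0" "2 < s" using eventually_happens'[of "at_right (2::real)"] by auto
    have le: "mgf s \<le> mgf 2"
      using mgf_diff_le[of s 2] mult_pos_neg[of "s - 2" "mgf' s"] s by auto
    \<comment> \<open>Without the cut at 0, integrating the shifted difference gives
      \<open>mgf 2 * exp (2 * x) - mgf s * exp (s * x)\<close>, at least \<open>mgf 2\<close> times
      the difference itself. Subtracting \<open>exp (s * x)\<close> makes \<open>V\<close> vanish
      for \<open>x > 0\<close>.\<close>
    define V where "V x = max 0 (exp (2 * x) - exp (s * x))" for x
    have V2: "V x \<le> exp (2 * x)" for x by (simp add: V_def)
    have V0: "V x = 0" if "x > 0" for x using that s by (simp add: V_def)
    have V1: "V x \<le> 1" for x
    proof (cases "x > 0")
      case False then show ?thesis using V2[of x] by (smt (verit) exp_le_one_iff)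
    qed (simp add: V0)
    have cont: "continuous_on UNIV V" unfolding V_def by (intro continuous_intros)
    have step: "(1 + (c - 1)) * (exp (- 0 * p) * V x) \<le> (\<integral> y. V (x + (y - 0)) \<partial>\<kappa>)" for x
    proof -
      have i: "integrable \<kappa> (\<lambda>y. V (x + y))"
        by (intro integrable_continuous continuous_on_compose2[OF cont] continuous_intros) auto
      have I0: "0 \<le> (\<integral> y. V (x + y) \<partial>\<kappa>)" by (intro integral_nonneg_AE) (auto simp: V_def)
      have "mgf 2 * exp (2 * x) - mgf s * exp (s * x) = (\<integral> y. exp (2 * x) * exp (2 * y) - exp (s * x) * exp (s * y) \<partial>\<kappa>)"
        using integrable_mgf by (simp add: mgf_def)
      also have "\<dots> \<le> (\<integral> y. V (x + y) \<partial>\<kappa>)"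
        by (intro integral_mono Bochner_Integration.integrable_diff integrable_mult_right integrable_mgf i)
          (simp add: V_def distrib_left exp_add)
      finally have I1: "mgf 2 * exp (2 * x) - mgf s * exp (s * x) \<le> (\<integral> y. V (x + y) \<partial>\<kappa>)" .
      show ?thesis
      proof (cases "exp (2 * x) - exp (s * x) > 0")
        case True
        then have "c * V x = c * (exp (2 * x) - exp (s * x))" by (simp add: V_def)
        also have "\<dots> \<le> mgf 2 * (exp (2 * x) - exp (s * x))"
          using True c2[of 2] p by (intro mult_right_mono) auto
        also have "\<dots> \<le> mgf 2 * exp (2 * x) - mgf s * exp (s * x)"
          using le by (simp add: algebra_simps)
        finally show ?thesis using I1 by simp
      qed (use I0 in \<open>simp add: V_def\<close>)
    qed
    show ?thesis
    proof (rule exI[of _ 0], rule exI[of _ "c - 1"], rule exI[of _ 1], rule exI[of _ "-1"], rule exI[of _ 0], rule exI[of _ V],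
        intro conjI allI impI)
      show "0 < c - 1" using c(1) by simp
      show "V \<in> borel_measurable borel" using cont by (rule borel_measurable_continuous_onI)
      show "0 < V (-1)" using s by (simp add: V_def)
      fix x :: real
      show "0 \<le> V x" by (simp add: V_def)
      show "V x \<le> 1" by (rule V1)
      show "V x \<le> 1 * exp (2 * x)" using V2 by simp
      show "(1 + (c - 1)) * (exp (- 0 * p) * V x) \<le> (\<integral> y. V (x + (y - 0)) \<partial>\<kappa>)" by (rule step)
      show "V x = 0" if "0 < x" using that by (rule V0)
    qed simp
  qed
qed

end

section \<open>A lower bound for the increments\<close>

context normalized_weight_law
begin

definition xi_char :: "real \<Rightarrow> complex" where
  "xi_char t = (\<integral> z. iexp (t * centred_total z) \<partial>N)"

lemma measurable_xi_char [measurable]: "xi_char \<in> borel_measurable borel"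
  unfolding xi_char_def by measurable

lemma norm_xi_char_le: "cmod (xi_char t) \<le> 1"
proof -
  have "cmod (xi_char t) \<le> (\<integral> z. cmod (iexp (t * centred_total z)) \<partial>N)"
    unfolding xi_char_def by (rule integral_norm_bound)
  then show ?thesis using prob_space by simp
qed

text \<open>Further factors have modulus at most 1, so the box of width \<open>K\<close> can stay
  fixed while the box of the partial increment grows to the whole generation.\<close>

lemma char_increment_le:
  "cmod (\<integral> e. iexp (s * increment n e) \<partial>env) \<le>
    (\<integral> e. (\<Prod>v\<in>node_box n K. cmod (xi_char (s * node_weight v e))) \<partial>env)"
proof -
  have part: "cmod (\<integral> e. iexp (s * partial_increment (node_box n k) e) \<partial>env) \<le>
    (\<integral> e. (\<Prod>v\<in>node_box n K. cmod (xi_char (s * node_weight v e))) \<partial>env)" if "K \<le> k" for k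
  proof -
    let ?h = "\<lambda>x z. iexp (s * x * centred_total z)"
    have "(\<integral> e. iexp (s * partial_increment (node_box n k) e) \<partial>env) =
        (\<integral> e. 1 * (\<Prod>v\<in>node_box n k. ?h (node_weight v e) (e v)) \<partial>env)"
      unfolding partial_increment_def
      by (simp add: exp_sum[symmetric] sum_distrib_left mult_ac)
    also have "\<dots> = (\<integral> e. 1 * (\<Prod>v\<in>node_box n k. \<integral> z. ?h (node_weight v e) z \<partial>N) \<partial>env)"
      by (rule integral_prod_generation[where n = n]) (auto dest: length_node_box)
    also have "\<dots> = (\<integral> e. (\<Prod>v\<in>node_box n k. xi_char (s * node_weight v e)) \<partial>env)"
      by (simp add: xi_char_def)
    finally have "cmod (\<integral> e. iexp (s * partial_increment (node_box n k) e) \<partial>env) \<le>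
        (\<integral> e. cmod (\<Prod>v\<in>node_box n k. xi_char (s * node_weight v e)) \<partial>env)"
      by (simp only: integral_norm_bound)
    also have "\<dots> \<le> (\<integral> e. (\<Prod>v\<in>node_box n K. cmod (xi_char (s * node_weight v e))) \<partial>env)"
    proof (rule integral_mono)
      show "integrable env (\<lambda>e. cmod (\<Prod>v\<in>node_box n k. xi_char (s * node_weight v e)))"
        "integrable env (\<lambda>e. \<Prod>v\<in>node_box n K. cmod (xi_char (s * node_weight v e)))"
        by (auto intro!: env.integrable_const_bound[where B = 1] AE_I2 prod_le_1 simp: norm_xi_char_le prod_norm[symmetric] abs_prod)
      fix e
      have sub: "node_box n K \<subseteq> node_box n k" using that by (auto simp: node_box_def)
      have "cmod (\<Prod>v\<in>node_box n k. xi_char (s * node_weight v e)) =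
          (\<Prod>v\<in>node_box n K. cmod (xi_char (s * node_weight v e))) *
          (\<Prod>v\<in>node_box n k - node_box n K. cmod (xi_char (s * node_weight v e)))"
        unfolding prod_norm[symmetric] by (subst prod.subset_diff[OF sub]) (auto simp: mult.commute)
      also have "\<dots> \<le> (\<Prod>v\<in>node_box n K. cmod (xi_char (s * node_weight v e))) * 1"
        by (intro mult_left_mono prod_le_1 prod_nonneg) (auto simp: norm_xi_char_le)
      finally show "cmod (\<Prod>v\<in>node_box n k. xi_char (s * node_weight v e)) \<le>
          (\<Prod>v\<in>node_box n K. cmod (xi_char (s * node_weight v e)))" by simp
    qed
    finally show ?thesis .
  qed
  have "(\<lambda>k. \<integral> e. iexp (s * partial_increment (node_box n k) e) \<partial>env) \<longlonglongrightarrow> (\<integral> e. iexp (s * increment n e) \<partial>env)"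
  proof (rule integral_dominated_convergence[where w = "\<lambda>_. 1"])
    show "AE e in env. (\<lambda>k. iexp (s * partial_increment (node_box n k) e)) \<longlonglongrightarrow> iexp (s * increment n e)"
      using AE_population_finite[of n] AE_population_finite[of "Suc n"]
      by eventually_elim (intro tendsto_intros partial_increment_tendsto)
  qed auto
  from Lim_bounded[OF tendsto_norm[OF this], of K] show ?thesis using part by auto
qed

text \<open>The last generation is integrated out first: given the earlier weights its families are
  independent, and \<open>step\<close> bounds each inner product by one minus
  \<open>u (Suc k)\<close> at the parent. The index \<open>k\<close> counts the generations already
  removed; each removal uses up one factor \<open>g\<close>.\<close>

lemma product_iteration:
  fixes u :: "nat \<Rightarrow> real \<Rightarrow> real"
  assumes [measurable]: "\<And>k. u k \<in> borel_measurable borel"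
    and u: "\<And>k x. 0 \<le> u k x" "\<And>k x. u k x \<le> 1" and g: "0 \<le> g"
    and step: "\<And>k x. 0 \<le> x \<Longrightarrow> (\<integral> z. (\<Prod>i<K. 1 - u k (g * (x * max 0 (z i)))) \<partial>N) \<le> 1 - u (Suc k) x"
    and t: "0 \<le> t"
  shows "(\<integral> e. (\<Prod>v\<in>node_box n K. 1 - u k (g ^ n * (t * node_weight v e))) \<partial>env) \<le> 1 - u (k + n) t"
proof (induction n arbitrary: k)
  case 0
  have "node_box 0 K = {[]}" by (auto simp: node_box_def)
  then show ?case using env.prob_space by simp
next
  case (Suc n)
  define h where "h x z = (\<Prod>i<K. 1 - u k (g * (g ^ n * (t * x) * max 0 (z i))))" for x :: real and z :: "nat \<Rightarrow> real"
  have [measurable]: "(\<lambda>(x, z). h x z) \<in> borel_measurable (borel \<Otimes>\<^sub>M N)" unfolding h_def by measurable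
  have h01: "0 \<le> h x z" "h x z \<le> 1" for x z
    unfolding h_def using u by (auto intro!: prod_nonneg prod_le_1)
  have H: "(\<integral> z. h x z \<partial>N) \<le> 1 - u (Suc k) (g ^ n * (t * x))" if "0 \<le> x" for x
    unfolding h_def using that g t by (intro step) auto
  have H0: "0 \<le> (\<integral> z. h x z \<partial>N)" for x by (intro integral_nonneg_AE) (auto simp: h01)
  have [measurable]: "(\<lambda>x. \<integral> z. h x z \<partial>N) \<in> borel_measurable borel" by measurable
  have "(\<integral> e. (\<Prod>v\<in>node_box (Suc n) K. 1 - u k (g ^ Suc n * (t * node_weight v e))) \<partial>env) =
      (\<integral> e. 1 * (\<Prod>v\<in>node_box n K. h (node_weight v e) (e v)) \<partial>env)"
    unfolding prod_node_box_Suc h_def by (simp add: env_weight_def mult_ac)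
  also have "\<dots> = (\<integral> e. 1 * (\<Prod>v\<in>node_box n K. \<integral> z. h (node_weight v e) z \<partial>N) \<partial>env)"
    by (rule integral_prod_generation[where n = n]) (auto dest: length_node_box simp: h01)
  also have "\<dots> \<le> (\<integral> e. (\<Prod>v\<in>node_box n K. 1 - u (Suc k) (g ^ n * (t * node_weight v e))) \<partial>env)"
  proof (rule integral_mono)
    have le1: "(\<integral> z. h (node_weight v e) z \<partial>N) \<le> 1" for v e
      using H[of "node_weight v e"] u(1)[of "Suc k" "g ^ n * (t * node_weight v e)"] by simp
    show "integrable env (\<lambda>e. 1 * (\<Prod>v\<in>node_box n K. \<integral> z. h (node_weight v e) z \<partial>N))"
      by (rule env.integrable_const_bound[where B = 1]) (auto simp: abs_prod H0 le1 intro!: prod_le_1)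
    show "integrable env (\<lambda>e. \<Prod>v\<in>node_box n K. 1 - u (Suc k) (g ^ n * (t * node_weight v e)))"
      by (rule env.integrable_const_bound[where B = 1]) (auto simp: abs_prod u intro!: prod_le_1)
    fix e
    show "1 * (\<Prod>v\<in>node_box n K. \<integral> z. h (node_weight v e) z \<partial>N) \<le>
      (\<Prod>v\<in>node_box n K. 1 - u (Suc k) (g ^ n * (t * node_weight v e)))"
      using H H0 by (auto intro!: prod_mono)
  qed
  also have "\<dots> \<le> 1 - u (Suc k + n) t" by (rule Suc.IH)
  finally show ?case by simp
qed

text \<open>The functions \<open>\<theta> ^ k * (\<delta> * U x)\<close> satisfy the nonlinear
  recursion because \<open>lin\<close> has a factor \<open>1 + \<epsilon>\<close> to spare. The
  iteration starts below one minus the modulus of \<open>xi_char\<close>, and the characteristic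
  function of the increment at \<open>\<tau> * (g ^ n * x)\<close> converts its result into a moment
  bound.\<close>

lemma increment_lower_bound:
  fixes U :: "real \<Rightarrow> real"
  assumes p: "1 \<le> p" "p \<le> 2"
    and [measurable]: "U \<in> borel_measurable borel"
    and U: "\<And>x. 0 \<le> U x" "\<And>x. U x \<le> B" "\<And>x. U x \<le> B * x^2" "\<And>x. x > x1 \<Longrightarrow> U x = 0"
    and \<theta>: "0 < \<theta>" "\<theta> \<le> 1" and \<epsilon>: "0 < \<epsilon>" and g: "0 \<le> g"
    and lin: "\<And>x. 0 \<le> x \<Longrightarrow> (1 + \<epsilon>) * (\<theta> * U x) \<le> (\<integral> z. (\<Sum>i<K. U (g * (x * max 0 (z i)))) \<partial>N)"
    and nz: "\<not> (AE z in N. centred_total z = 0)"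
    and int: "\<And>n. integrable env (\<lambda>e. \<bar>increment n e\<bar> powr p)"
  shows "\<exists>\<delta>>0. \<exists>\<tau>>0. \<forall>n. \<forall>x\<ge>0. \<theta> ^ n * (\<delta> * U x) \<le> 2 * (\<tau> * (g ^ n * x)) powr p * (\<integral> e. \<bar>increment n e\<bar> powr p \<partial>env)"
proof -
  obtain c t0 where c: "c > 0" "t0 > 0" "\<And>t. \<bar>t\<bar> \<le> t0 \<Longrightarrow> c * t^2 \<le> 1 - cmod (xi_char t)"
    using one_minus_char_ge[OF integrable_centred_total integral_centred_total nz]
    unfolding xi_char_def by blast
  define B' where "B' = max B 1"
  have B': "B' \<ge> 1" "\<And>x. U x \<le> B'" "\<And>x. U x \<le> B' * x^2"
  proof -
    show "B' \<ge> 1" by (simp add: B'_def)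
    show "U x \<le> B'" for x using U(2)[of x] by (simp add: B'_def)
    show "U x \<le> B' * x^2" for x
      by (rule order_trans[OF U(3)], rule mult_right_mono) (auto simp: B'_def)
  qed
  \<comment> \<open>\<open>U\<close> vanishes beyond \<open>x1\<close>; for nonnegative
    \<open>y\<close> up to there, \<open>\<tau> * y\<close> stays in \<open>[0, t0]\<close>, where
    the quadratic lower bound holds.\<close>
  define \<tau> where "\<tau> = t0 / (\<bar>x1\<bar> + 1)"
  have \<tau>: "\<tau> > 0" using c by (simp add: \<tau>_def)
  \<comment> \<open>The first bound places \<open>\<delta> * U\<close> below one minus the modulus
    of \<open>xi_char\<close>, the 1 keeps all factors nonnegative, and the last makes a sum over
    \<open>K\<close> children at most \<open>\<epsilon> / (1 + \<epsilon>)\<close>.\<close>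
  define \<delta> where "\<delta> = min (c * \<tau>^2 / B') (min 1 (\<epsilon> / ((1 + \<epsilon>) * (real K + 1))) / B')"
  have \<delta>: "\<delta> > 0" unfolding \<delta>_def using c \<tau> B'(1) \<epsilon> by simp
  have \<delta>B: "\<delta> * B' \<le> c * \<tau>^2" "\<delta> * B' \<le> 1" "\<delta> * B' \<le> \<epsilon> / ((1 + \<epsilon>) * (real K + 1))"
  proof -
    have "\<delta> \<le> c * \<tau>^2 / B'" "\<delta> \<le> min 1 (\<epsilon> / ((1 + \<epsilon>) * (real K + 1))) / B'"
      unfolding \<delta>_def by (rule min.cobounded1, rule min.cobounded2)
    then have "\<delta> * B' \<le> c * \<tau>^2" "\<delta> * B' \<le> min 1 (\<epsilon> / ((1 + \<epsilon>) * (real K + 1)))"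
      using B'(1) by (simp_all add: pos_le_divide_eq)
    then show "\<delta> * B' \<le> c * \<tau>^2" "\<delta> * B' \<le> 1" "\<delta> * B' \<le> \<epsilon> / ((1 + \<epsilon>) * (real K + 1))"
      by simp_all
  qed
  have small: "\<delta> * U y \<le> 1 - cmod (xi_char (\<tau> * y))" if "0 \<le> y" for y
  proof (cases "y > x1")
    case True
    then show ?thesis using U(4) norm_xi_char_le[of "\<tau> * y"] by simp
  next
    case False
    have "\<bar>\<tau> * y\<bar> \<le> \<tau> * (\<bar>x1\<bar> + 1)" using False that \<tau> by (simp add: abs_mult)
    also have "\<dots> = t0" by (simp add: \<tau>_def)
    finally have *: "c * (\<tau> * y)^2 \<le> 1 - cmod (xi_char (\<tau> * y))" by (rule c(3))
    have "\<delta> * U y \<le> \<delta> * (B' * y^2)" using B'(3) \<delta> by (intro mult_left_mono) auto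
    also have "\<dots> = (\<delta> * B') * y^2" by simp
    also have "\<dots> \<le> c * \<tau>^2 * y^2" by (rule mult_right_mono[OF \<delta>B(1)]) simp
    finally show ?thesis using * by (simp add: power_mult_distrib mult.assoc)
  qed
  define u where "u k x = \<theta> ^ k * (\<delta> * U x)" for k x
  have [measurable]: "u k \<in> borel_measurable borel" for k unfolding u_def by measurable
  have \<theta>k: "0 \<le> \<theta> ^ k" "\<theta> ^ k \<le> 1" for k using \<theta> by (auto simp: power_le_one)
  have u0: "0 \<le> u k x" for k x unfolding u_def using \<theta> \<delta> U(1) by simp
  have u\<delta>: "u k x \<le> \<delta> * B'" for k x
  proof -
    have "u k x \<le> 1 * (\<delta> * B')"
      unfolding u_def using \<theta>k \<delta> U(1) B'(2) by (intro mult_mono mult_left_mono) auto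
    then show ?thesis by simp
  qed
  have u1: "u k x \<le> 1" for k x using u\<delta>[of k x] \<delta>B(2) by linarith
  have step: "(\<integral> z. (\<Prod>i<K. 1 - u k (g * (x * max 0 (z i)))) \<partial>N) \<le> 1 - u (Suc k) x" if x: "0 \<le> x" for k x
  proof -
    define S where "S z = (\<Sum>i<K. U (g * (x * max 0 (z i))))" for z :: "nat \<Rightarrow> real"
    have [measurable]: "S \<in> borel_measurable N" unfolding S_def by measurable
    have S0: "0 \<le> S z" for z unfolding S_def using U(1) by (intro sum_nonneg)
    have S1: "S z \<le> real K * B'" for z
      unfolding S_def using sum_bounded_above[of "{..<K}" "\<lambda>i. U (g * (x * max 0 (z i)))" B'] B'(2) by simp
    have iS: "integrable N S"
      by (rule integrable_const_bound[where B = "real K * B'"]) (auto simp: S0 S1)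
    have iP: "integrable N (\<lambda>z. \<Prod>i<K. 1 - u k (g * (x * max 0 (z i))))"
      by (rule integrable_const_bound[where B = 1]) (auto simp: abs_prod u0 u1 intro!: prod_le_1)
    \<comment> \<open>So the factor lost in \<open>one_minus_prod_ge\<close> is no worse than a
      division by \<open>1 + \<epsilon>\<close>.\<close>
    have K\<delta>: "1 / (1 + \<epsilon>) \<le> 1 - real K * (\<delta> * B')"
    proof -
      have "real K * (\<delta> * B') \<le> (real K + 1) * (\<epsilon> / ((1 + \<epsilon>) * (real K + 1)))"
        using \<delta>B(3) \<delta> B'(1) by (intro mult_mono) auto
      also have "\<dots> = \<epsilon> / (1 + \<epsilon>)" by simp
      also have "\<dots> = 1 - 1 / (1 + \<epsilon>)" using \<epsilon> by (simp add: field_simps)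
      finally show ?thesis by simp
    qed
    have pt: "1 / (1 + \<epsilon>) * (\<theta> ^ k * \<delta> * S z) \<le> 1 - (\<Prod>i<K. 1 - u k (g * (x * max 0 (z i))))" for z
    proof -
      let ?s = "\<Sum>i<K. u k (g * (x * max 0 (z i)))"
      have s: "?s = \<theta> ^ k * \<delta> * S z" by (simp add: u_def S_def sum_distrib_left mult.assoc)
      have s0: "0 \<le> ?s" using u0 by (intro sum_nonneg)
      have "?s \<le> real K * (\<delta> * B')"
        using sum_bounded_above[of "{..<K}" "\<lambda>i. u k (g * (x * max 0 (z i)))" "\<delta> * B'"] u\<delta> by simp
      then have "1 / (1 + \<epsilon>) * ?s \<le> (1 - ?s) * ?s"
        using K\<delta> s0 by (intro mult_right_mono) auto
      also have "\<dots> \<le> 1 - (\<Prod>i<K. 1 - u k (g * (x * max 0 (z i))))"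
        by (rule one_minus_prod_ge) (auto simp: u0 u1)
      finally show ?thesis by (simp only: s)
    qed
    have "u (Suc k) x = 1 / (1 + \<epsilon>) * (\<theta> ^ k * \<delta> * ((1 + \<epsilon>) * (\<theta> * U x)))"
      using \<epsilon> by (simp add: u_def field_simps)
    also have "\<dots> \<le> 1 / (1 + \<epsilon>) * (\<theta> ^ k * \<delta> * (\<integral> z. S z \<partial>N))"
      unfolding S_def using lin[OF x] \<epsilon> \<theta>k \<delta> by (intro mult_left_mono) auto
    also have "\<dots> = (\<integral> z. 1 / (1 + \<epsilon>) * (\<theta> ^ k * \<delta> * S z) \<partial>N)" by simp
    also have "\<dots> \<le> (\<integral> z. 1 - (\<Prod>i<K. 1 - u k (g * (x * max 0 (z i)))) \<partial>N)"
      using iS iP pt by (intro integral_mono) auto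
    also have "\<dots> = 1 - (\<integral> z. (\<Prod>i<K. 1 - u k (g * (x * max 0 (z i)))) \<partial>N)"
      using iP prob_space by simp
    finally show ?thesis by simp
  qed
  have "\<theta> ^ n * (\<delta> * U x) \<le> 2 * (\<tau> * (g ^ n * x)) powr p * (\<integral> e. \<bar>increment n e\<bar> powr p \<partial>env)" if x: "0 \<le> x" for n x
  proof -
    let ?s = "\<tau> * (g ^ n * x)"
    have "\<theta> ^ n * (\<delta> * U x) = u (0 + n) x" by (simp add: u_def)
    also have "\<dots> \<le> 1 - (\<integral> e. (\<Prod>v\<in>node_box n K. 1 - u 0 (g ^ n * (x * node_weight v e))) \<partial>env)"
      using product_iteration[where u = u and g = g and K = K and t = x and n = n and k = 0, OF _ u0 u1 g step x]
      by simp
    also have "\<dots> \<le> 1 - (\<integral> e. (\<Prod>v\<in>node_box n K. cmod (xi_char (?s * node_weight v e))) \<partial>env)"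
    proof (intro diff_left_mono integral_mono)
      show "integrable env (\<lambda>e. \<Prod>v\<in>node_box n K. cmod (xi_char (?s * node_weight v e)))"
        by (rule env.integrable_const_bound[where B = 1]) (auto simp: abs_prod norm_xi_char_le intro!: prod_le_1)
      show "integrable env (\<lambda>e. \<Prod>v\<in>node_box n K. 1 - u 0 (g ^ n * (x * node_weight v e)))"
        by (rule env.integrable_const_bound[where B = 1]) (auto simp: abs_prod u0 u1 intro!: prod_le_1)
      fix e
      have "cmod (xi_char (?s * node_weight v e)) \<le> 1 - u 0 (g ^ n * (x * node_weight v e))" for v
        using small[of "g ^ n * (x * node_weight v e)"] g x by (simp add: u_def mult_ac)
      then show "(\<Prod>v\<in>node_box n K. cmod (xi_char (?s * node_weight v e))) \<le>
        (\<Prod>v\<in>node_box n K. 1 - u 0 (g ^ n * (x * node_weight v e)))"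
        by (intro prod_mono) auto
    qed
    also have "\<dots> \<le> 1 - cmod (\<integral> e. iexp (?s * increment n e) \<partial>env)"
      using char_increment_le[of ?s n K] by simp
    also have "\<dots> \<le> 2 * \<bar>?s\<bar> powr p * (\<integral> e. \<bar>increment n e\<bar> powr p \<partial>env)"
      by (rule env.one_minus_char_le[OF p integrable_increment integral_increment int])
    finally show ?thesis using \<tau> g x by (simp add: abs_mult)
  qed
  then show ?thesis using \<delta> \<tau> by blast
qed

section \<open>The truncated intensity measure of the shifted log-weights\<close>

abbreviation point_space :: "((nat \<Rightarrow> real) \<times> nat) measure" where
  "point_space \<equiv> N \<Otimes>\<^sub>M count_space UNIV"

text \<open>Finitely many labels bound the total mass, and weights in a compact part of the positive
  half-line bound the support of their logarithms.\<close>

definition truncation :: "nat \<Rightarrow> ((nat \<Rightarrow> real) \<times> nat) set" where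
  "truncation K = {(z, i). i < K \<and> 1 / (real K + 1) \<le> z i \<and> z i \<le> real K + 1}"

text \<open>The intensity measure of the truncated point process of the \<open>a + ln (z i)\<close>.
  Its exponential moment of order \<open>r\<close> is \<open>exp (a * r)\<close> times the truncated
  \<open>moment r\<close>.\<close>

definition intensity :: "real \<Rightarrow> nat \<Rightarrow> real measure" where
  "intensity a K = distr (density point_space (indicator (truncation K))) borel (\<lambda>(z, i). a + ln (z i))"

lemma measurable_point [measurable]: "(\<lambda>x. fst x (snd x)) \<in> borel_measurable point_space"
proof (rule measurable_compose_countable)
  show "(\<lambda>x. fst x i) \<in> borel_measurable point_space" for i
    by (rule measurable_compose[OF measurable_fst measurable_N_component])
qed simp

lemma truncation_sets [measurable]: "truncation K \<in> sets point_space"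
proof -
  have "truncation K = {x \<in> space point_space. snd x < K \<and> 1 / (real K + 1) \<le> fst x (snd x) \<and> fst x (snd x) \<le> real K + 1}"
    by (auto simp: truncation_def space_pair_measure)
  also have "\<dots> \<in> sets point_space" by measurable
  finally show ?thesis .
qed

lemma measurable_log_point [measurable]: "(\<lambda>(z, i). a + ln (z i)) \<in> borel_measurable point_space"
  using measurable_point by (simp add: split_def)

lemma nn_integral_point_space:
  assumes "f \<in> borel_measurable point_space"
  shows "(\<integral>\<^sup>+ x. f x \<partial>point_space) = (\<integral>\<^sup>+ z. \<integral>\<^sup>+ i. f (z, i) \<partial>count_space UNIV \<partial>N)"
  using sigma_finite_measure.nn_integral_fst[OF sigma_finite_measure_count_space assms] by simp

lemma nn_integral_intensity:
  assumes [measurable]: "f \<in> borel_measurable borel"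
  shows "(\<integral>\<^sup>+ y. f y \<partial>intensity a K) =
    (\<integral>\<^sup>+ z. \<integral>\<^sup>+ i. indicator (truncation K) (z, i) * f (a + ln (z i)) \<partial>count_space UNIV \<partial>N)"
proof -
  have "(\<integral>\<^sup>+ y. f y \<partial>intensity a K) = (\<integral>\<^sup>+ x. f (case x of (z, i) \<Rightarrow> a + ln (z i)) \<partial>density point_space (indicator (truncation K)))"
    unfolding intensity_def by (rule nn_integral_distr) auto
  also have "\<dots> = (\<integral>\<^sup>+ x. indicator (truncation K) x * f (case x of (z, i) \<Rightarrow> a + ln (z i)) \<partial>point_space)"
    by (rule nn_integral_density) auto
  also have "\<dots> = (\<integral>\<^sup>+ z. \<integral>\<^sup>+ i. indicator (truncation K) (z, i) * f (a + ln (z i)) \<partial>count_space UNIV \<partial>N)"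
    by (subst nn_integral_point_space) auto
  finally show ?thesis .
qed

lemma truncation_mono: "K \<le> K' \<Longrightarrow> truncation K \<subseteq> truncation K'"
proof -
  assume "K \<le> K'"
  then have "1 / (real K' + 1) \<le> 1 / (real K + 1)" by (intro divide_left_mono) auto
  then show ?thesis using \<open>K \<le> K'\<close> by (auto simp: truncation_def)
qed

lemma compact_finite_measure_intensity: "compact_finite_measure (intensity a K) (\<bar>a\<bar> + ln (real K + 1))"
proof (intro compact_finite_measure.intro finite_measureI compact_finite_measure_axioms.intro)
  have "emeasure (intensity a K) (space (intensity a K)) = (\<integral>\<^sup>+ y. 1 \<partial>intensity a K)" by simp
  also have "\<dots> = (\<integral>\<^sup>+ z. \<integral>\<^sup>+ i. indicator (truncation K) (z, i) * 1 \<partial>count_space UNIV \<partial>N)"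
    by (rule nn_integral_intensity) simp
  also have "\<dots> \<le> (\<integral>\<^sup>+ z. \<integral>\<^sup>+ i. indicator {..<K} i \<partial>count_space UNIV \<partial>N)"
    by (intro nn_integral_mono) (auto simp: truncation_def split: split_indicator)
  also have "\<dots> = of_nat K" by (simp add: emeasure_space_1[simplified])
  finally show "emeasure (intensity a K) (space (intensity a K)) \<noteq> \<infinity>"
    using of_nat_less_top by (metis infinity_ennreal_def le_less_trans less_irrefl)
  show "sets (intensity a K) = sets borel" by (simp add: intensity_def)
  have pt: "\<bar>a + ln x\<bar> \<le> \<bar>a\<bar> + ln (real K + 1)" if "1 / (real K + 1) \<le> x" "x \<le> real K + 1" for x
  proof -
    have "0 < 1 / (real K + 1)" by simp
    then have "x > 0" using that(1) by linarith
    then have "ln (1 / (real K + 1)) \<le> ln x" "ln x \<le> ln (real K + 1)" using that by (auto simp: ln_le_cancel_iff)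
    then show ?thesis by (simp add: ln_div)
  qed
  show "AE y in intensity a K. \<bar>y\<bar> \<le> \<bar>a\<bar> + ln (real K + 1)"
    unfolding intensity_def
    by (subst AE_distr_iff) (auto simp: AE_density truncation_def intro!: pt AE_I2 split: split_indicator)
qed

lemma intensity_mgf:
  "ennreal (\<integral> y. exp (r * y) \<partial>intensity a K) =
    (\<integral>\<^sup>+ x. indicator (truncation K) x * ennreal (exp (r * (a + ln (fst x (snd x))))) \<partial>point_space)"
proof -
  interpret K: compact_finite_measure "intensity a K" "\<bar>a\<bar> + ln (real K + 1)"
    by (rule compact_finite_measure_intensity)
  have "ennreal (\<integral> y. exp (r * y) \<partial>intensity a K) = (\<integral>\<^sup>+ y. ennreal (exp (r * y)) \<partial>intensity a K)"
    using K.integrable_mgf(1) by (intro nn_integral_eq_integral[symmetric]) auto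
  also have "\<dots> = (\<integral>\<^sup>+ z. \<integral>\<^sup>+ i. indicator (truncation K) (z, i) * ennreal (exp (r * (a + ln (z i)))) \<partial>count_space UNIV \<partial>N)"
    by (rule nn_integral_intensity) auto
  also have "\<dots> = (\<integral>\<^sup>+ x. indicator (truncation K) x * ennreal (exp (r * (a + ln (fst x (snd x))))) \<partial>point_space)"
    by (subst nn_integral_point_space) auto
  finally show ?thesis .
qed

lemma intensity_mgf_mono:
  assumes "K \<le> K'"
  shows "(\<integral> y. exp (r * y) \<partial>intensity a K) \<le> (\<integral> y. exp (r * y) \<partial>intensity a K')"
proof -
  have "ennreal (\<integral> y. exp (r * y) \<partial>intensity a K) \<le> ennreal (\<integral> y. exp (r * y) \<partial>intensity a K')"
    unfolding intensity_mgf using truncation_mono[OF assms]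
    by (intro nn_integral_mono mult_right_mono) (auto split: split_indicator)
  then show ?thesis by (subst (asm) ennreal_le_iff) (auto intro!: integral_nonneg_AE)
qed

text \<open>Monotone convergence: each point of positive weight eventually passes the truncation,
  and the others contribute 0. The limit may be infinite, hence \<open>ennreal\<close>.\<close>

lemma intensity_mgf_tendsto:
  "(\<lambda>K. ennreal (\<integral> y. exp (r * y) \<partial>intensity a K)) \<longlonglongrightarrow> ennreal (exp (a * r)) * moment r"
proof -
  have "(\<lambda>K. \<integral>\<^sup>+ x. indicator (truncation K) x * ennreal (exp (r * (a + ln (fst x (snd x))))) \<partial>point_space) \<longlonglongrightarrow>
      (\<integral>\<^sup>+ x. ennreal (exp (a * r)) * ennreal (max 0 (fst x (snd x)) powr r) \<partial>point_space)"
  proof (rule nn_integral_LIMSEQ)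
    show "incseq (\<lambda>K x. indicator (truncation K) x * ennreal (exp (r * (a + ln (fst x (snd x))))))"
      using truncation_mono by (fastforce simp: incseq_def le_fun_def split: split_indicator)
    fix x :: "(nat \<Rightarrow> real) \<times> nat"
    let ?z = "fst x (snd x)"
    show "(\<lambda>K. indicator (truncation K) x * ennreal (exp (r * (a + ln ?z)))) \<longlonglongrightarrow> ennreal (exp (a * r)) * ennreal (max 0 ?z powr r)"
    proof (cases "?z > 0")
      case True
      have val: "ennreal (exp (r * (a + ln ?z))) = ennreal (exp (a * r)) * ennreal (max 0 ?z powr r)"
        using True by (simp add: ennreal_mult[symmetric] powr_def exp_add[symmetric] algebra_simps)
      have "\<forall>\<^sub>F K in sequentially. indicator (truncation K) x * ennreal (exp (r * (a + ln ?z))) = ennreal (exp (a * r)) * ennreal (max 0 ?z powr r)"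
        using eventually_gt_at_top[of "max (snd x) (nat \<lceil>max ?z (1 / ?z)\<rceil>)"]
      proof eventually_elim
        case (elim K)
        then have "max ?z (1 / ?z) \<le> real K + 1" by linarith
        then have "?z \<le> real K + 1" "1 / ?z \<le> real K + 1" by auto
        moreover from this(2) True have "1 / (real K + 1) \<le> ?z" by (simp add: field_simps)
        ultimately have "x \<in> truncation K" using elim by (auto simp: truncation_def split_def)
        then show ?case by (simp add: val)
      qed
      then show ?thesis by (rule tendsto_eventually)
    next
      case False
      have "x \<notin> truncation K" for K
      proof
        assume "x \<in> truncation K"
        then have "1 / (real K + 1) \<le> ?z" by (auto simp: truncation_def)
        moreover have "0 < 1 / (real K + 1)" by simp
        ultimately show False using False by linarith
      qed
      then show ?thesis using False by (simp add: max_def)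
    qed
  qed measurable
  also have "(\<integral>\<^sup>+ x. ennreal (exp (a * r)) * ennreal (max 0 (fst x (snd x)) powr r) \<partial>point_space) = ennreal (exp (a * r)) * moment r"
    by (subst nn_integral_cmult) (auto simp: nn_integral_point_space moment_def)
  finally show ?thesis by (simp only: intensity_mgf)
qed

text \<open>Dini's argument: if every \<open>K\<close> fails at some \<open>R K\<close>, a
  subsequence tends to some \<open>r\<close>. Monotonicity in \<open>K\<close> and continuity for
  fixed \<open>K\<close> bound all truncated moments at \<open>r\<close> by \<open>c'\<close>,
  against their limit. This works even where the limit is infinite or discontinuous.\<close>

lemma truncation_uniform:
  fixes a p c c' :: real
  assumes c: "0 \<le> c'" "c' < c" and m: "\<And>r. r \<in> {p..2} \<Longrightarrow> ennreal c \<le> ennreal (exp (a * r)) * moment r"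
  shows "\<exists>K. \<forall>r\<in>{p..2}. c' \<le> (\<integral> y. exp (r * y) \<partial>intensity a K)"
proof (rule ccontr)
  let ?G = "\<lambda>K r. \<integral> y. exp (r * y) \<partial>intensity a K"
  assume "\<not> ?thesis"
  then have "\<forall>K. \<exists>r\<in>{p..2}. ?G K r < c'" by (simp add: not_le)
  then obtain R where R: "\<And>K. R K \<in> {p..2}" "\<And>K. ?G K (R K) < c'" by metis
  obtain r \<phi> where r: "r \<in> {p..2}" "strict_mono \<phi>" "(R \<circ> \<phi>) \<longlonglongrightarrow> r"
    using compact_Icc[of p 2] R(1) unfolding compact_def by metis
  have "?G K r \<le> c'" for K
  proof -
    interpret K: compact_finite_measure "intensity a K" "\<bar>a\<bar> + ln (real K + 1)"
      by (rule compact_finite_measure_intensity)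
    have "isCont (?G K) r" using K.isCont_integral_exp[of "\<lambda>_. 1" r] by simp
    from isCont_tendsto_compose[OF this r(3)] have "(\<lambda>n. ?G K (R (\<phi> n))) \<longlonglongrightarrow> ?G K r" by (simp add: comp_def)
    moreover have "?G K (R (\<phi> n)) \<le> c'" if "K \<le> n" for n
    proof -
      have "K \<le> \<phi> n" using seq_suble[OF r(2), of n] that by linarith
      from intensity_mgf_mono[OF this] R(2)[of "\<phi> n"] show ?thesis by (rule order_trans[OF _ less_imp_le])
    qed
    ultimately show ?thesis by (intro Lim_bounded[where M = K]) auto
  qed
  then have "ennreal (?G K r) \<le> ennreal c'" for K by (rule ennreal_leI)
  then have "ennreal (exp (a * r)) * moment r \<le> ennreal c'"
    by (intro Lim_bounded[OF intensity_mgf_tendsto, where M = 0]) auto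
  then have "ennreal c \<le> ennreal c'" using m[OF r(1)] by (rule order_trans[rotated])
  then show False using c by (simp add: ennreal_le_iff)
qed

text \<open>In the variable \<open>x = ln t\<close> the recursion for the weights becomes a walk
  with jumps \<open>a + ln (z i) - d\<close>, so \<open>V\<close> supplies the \<open>U\<close> of
  \<open>increment_lower_bound\<close> with \<open>g = exp (a - d)\<close> and
  \<open>\<theta> = exp (- d * p)\<close>.\<close>

lemma increments_not_small:
  fixes a p c :: real
  assumes p: "1 < p" "p < 2" and c: "1 < c"
    and m: "\<And>r. r \<in> {p..2} \<Longrightarrow> ennreal c \<le> ennreal (exp (a * r)) * moment r"
    and nz: "\<not> (AE z in N. centred_total z = 0)"
    and int: "\<And>n. integrable env (\<lambda>e. \<bar>increment n e\<bar> powr p)"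
  shows "\<not> (\<lambda>n. exp (a * n * p) * (\<integral> e. \<bar>increment n e\<bar> powr p \<partial>env)) \<longlonglongrightarrow> 0"
proof
  assume lim: "(\<lambda>n. exp (a * n * p) * (\<integral> e. \<bar>increment n e\<bar> powr p \<partial>env)) \<longlonglongrightarrow> 0"
  \<comment> \<open>The margin between \<open>c'\<close> and \<open>c\<close> is spent on the
    truncation, that between 1 and \<open>c'\<close> on the subharmonic function.\<close>
  define c' where "c' = (1 + c) / 2"
  have c': "1 < c'" "c' < c" using c by (auto simp: c'_def)
  have "\<exists>K. \<forall>r\<in>{p..2}. c' \<le> (\<integral> y. exp (r * y) \<partial>intensity a K)"
    using truncation_uniform[of c' c p a] c' m by simp
  then obtain K where K: "\<forall>r\<in>{p..2}. c' \<le> (\<integral> y. exp (r * y) \<partial>intensity a K)" by blast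
  interpret K: compact_finite_measure "intensity a K" "\<bar>a\<bar> + ln (real K + 1)"
    by (rule compact_finite_measure_intensity)
  have mgf: "\<forall>r\<in>{p..2}. c' \<le> K.mgf r" using K by (simp add: K.mgf_def)
  obtain d \<epsilon> B x0 x1 V where S: "0 \<le> d \<and> \<epsilon> > 0 \<and> V \<in> borel_measurable borel \<and>
    (\<forall>x. 0 \<le> V x \<and> V x \<le> B \<and> V x \<le> B * exp (2 * x)) \<and> V x0 > 0 \<and> (\<forall>x>x1. V x = 0) \<and>
    (\<forall>x. (1 + \<epsilon>) * (exp (- d * p) * V x) \<le> (\<integral> y. V (x + (y - d)) \<partial>intensity a K))"
    using K.subsolution_exists[OF p c'(1) mgf] by (elim exE) (rule that)
  then have d: "0 \<le> d" and \<epsilon>: "\<epsilon> > 0" and V [measurable]: "V \<in> borel_measurable borel"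
    and VB: "\<And>x. 0 \<le> V x" "\<And>x. V x \<le> B" "\<And>x. V x \<le> B * exp (2 * x)"
    and Vx0: "V x0 > 0" and Vx1: "\<And>x. x > x1 \<Longrightarrow> V x = 0"
    and sub: "\<And>x. (1 + \<epsilon>) * (exp (- d * p) * V x) \<le> (\<integral> y. V (x + (y - d)) \<partial>intensity a K)"
    by blast+
  \<comment> \<open>Weight 0 corresponds to the point at minus infinity and gets the value
    0.\<close>
  define U where "U t = (if t > 0 then V (ln t) else 0)" for t
  have [measurable]: "U \<in> borel_measurable borel" unfolding U_def by measurable
  have B: "B \<ge> 0" using VB(1,2)[of x0] by linarith
  have U0: "0 \<le> U t" for t by (simp add: U_def VB)
  have UB: "U t \<le> B" for t using B by (simp add: U_def VB)
  have UB2: "U t \<le> B * t^2" for t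
  proof (cases "t > 0")
    case True
    have "exp (2 * ln t) = t^2" using True by (simp add: exp_double)
    then show ?thesis using VB(3)[of "ln t"] True by (simp add: U_def)
  qed (use B in \<open>simp add: U_def\<close>)
  have U1: "U t = 0" if "t > exp x1" for t
  proof -
    have "exp x1 > 0" by simp
    then have "t > 0" using that by linarith
    then have "ln t > x1" using that by (metis exp_less_cancel_iff exp_ln)
    then show ?thesis by (simp add: U_def Vx1)
  qed
  define g where "g = exp (a - d)"
  have lin: "(1 + \<epsilon>) * (exp (- d * p) * U t) \<le> (\<integral> z. (\<Sum>i<K. U (g * (t * max 0 (z i)))) \<partial>N)" if t: "0 \<le> t" for t
  proof (cases "t = 0")
    case True
    then show ?thesis by (simp add: U_def)
  next
    case False
    with t have t: "t > 0" by simp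
    have i: "integrable N (\<lambda>z. \<Sum>i<K. U (g * (t * max 0 (z i))))"
      by (intro Bochner_Integration.integrable_sum integrable_const_bound[where B = B]) (auto simp: U0 UB)
    have iV: "integrable (intensity a K) (\<lambda>y. V (ln t + (y - d)))"
      by (rule K.integrable_const_bound[where B = B]) (auto simp: VB measurable_cong_sets[OF K.sets_kappa refl])
    have "ennreal (\<integral> y. V (ln t + (y - d)) \<partial>intensity a K) = (\<integral>\<^sup>+ y. ennreal (V (ln t + (y - d))) \<partial>intensity a K)"
      using iV by (intro nn_integral_eq_integral[symmetric]) (auto simp: VB)
    also have "\<dots> = (\<integral>\<^sup>+ z. \<integral>\<^sup>+ i. indicator (truncation K) (z, i) * ennreal (V (ln t + ((a + ln (z i)) - d))) \<partial>count_space UNIV \<partial>N)"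
      by (rule nn_integral_intensity) auto
    also have "\<dots> = (\<integral>\<^sup>+ z. (\<Sum>i<K. indicator (truncation K) (z, i) * ennreal (V (ln t + ((a + ln (z i)) - d)))) \<partial>N)"
      by (intro nn_integral_cong nn_integral_count_space') (auto simp: truncation_def)
    also have "\<dots> \<le> (\<integral>\<^sup>+ z. ennreal (\<Sum>i<K. U (g * (t * max 0 (z i)))) \<partial>N)"
    proof (intro nn_integral_mono)
      fix z :: "nat \<Rightarrow> real"
      have "indicator (truncation K) (z, i) * ennreal (V (ln t + ((a + ln (z i)) - d))) \<le> ennreal (U (g * (t * max 0 (z i))))" for i
      proof (cases "(z, i) \<in> truncation K")
        case True
        then have "1 / (real K + 1) \<le> z i" by (auto simp: truncation_def)
        moreover have "0 < 1 / (real K + 1)" by simp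
        ultimately have zi: "z i > 0" by linarith
        have "ln (g * (t * z i)) = ln t + ((a + ln (z i)) - d)"
          using zi t by (simp add: g_def ln_mult_pos)
        then show ?thesis using zi t True by (simp add: U_def g_def)
      qed simp
      then have "(\<Sum>i<K. indicator (truncation K) (z, i) * ennreal (V (ln t + ((a + ln (z i)) - d)))) \<le> (\<Sum>i<K. ennreal (U (g * (t * max 0 (z i)))))"
        by (rule sum_mono)
      also have "\<dots> = ennreal (\<Sum>i<K. U (g * (t * max 0 (z i))))" by (simp add: U0)
      finally show "(\<Sum>i<K. indicator (truncation K) (z, i) * ennreal (V (ln t + ((a + ln (z i)) - d)))) \<le> \<dots>" .
    qed
    also have "\<dots> = ennreal (\<integral> z. (\<Sum>i<K. U (g * (t * max 0 (z i)))) \<partial>N)"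
      using i by (intro nn_integral_eq_integral) (auto simp: U0 sum_nonneg)
    finally have "(\<integral> y. V (ln t + (y - d)) \<partial>intensity a K) \<le> (\<integral> z. (\<Sum>i<K. U (g * (t * max 0 (z i)))) \<partial>N)"
      by (subst (asm) ennreal_le_iff) (auto intro!: integral_nonneg_AE AE_I2 sum_nonneg U0)
    with sub[of "ln t"] show ?thesis using t by (simp add: U_def)
  qed
  define x where "x = exp x0"
  have x: "x > 0" "U x > 0" using Vx0 by (auto simp: x_def U_def)
  obtain \<delta> \<tau> where \<delta>: "\<delta> > 0" and \<tau>: "\<tau> > 0" and
    low: "\<And>n. exp (- d * p) ^ n * (\<delta> * U x) \<le> 2 * (\<tau> * (g ^ n * x)) powr p * (\<integral> e. \<bar>increment n e\<bar> powr p \<partial>env)"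
    using increment_lower_bound[of p U B "exp x1" "exp (- d * p)" \<epsilon> g K] p U0 UB UB2 U1 \<epsilon> lin nz int d x
    by (auto simp: g_def)
  let ?E = "\<lambda>n. (\<integral> e. \<bar>increment n e\<bar> powr p \<partial>env)"
  have "\<delta> * U x \<le> 2 * (\<tau> * x) powr p * (exp (a * n * p) * ?E n)" for n :: nat
  proof -
    \<comment> \<open>The \<open>p\<close>-th power of the scale contains the same decay
      \<open>exp (- d * p) ^ n\<close> as the lower bound; after cancelling, exactly
      \<open>exp (a * n * p)\<close> is left.\<close>
    have "(\<tau> * (g ^ n * x)) powr p = (\<tau> * x) powr p * exp ((a - d) * n) powr p"
      using \<tau> x by (simp add: g_def powr_mult exp_of_nat_mult[symmetric] mult_ac)
    also have "exp ((a - d) * n) powr p = exp (- d * p) ^ n * exp (a * n * p)"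
      by (simp add: powr_def exp_of_nat_mult[symmetric] exp_add[symmetric] algebra_simps)
    finally have "exp (- d * p) ^ n * (\<delta> * U x) \<le> exp (- d * p) ^ n * (2 * (\<tau> * x) powr p * (exp (a * n * p) * ?E n))"
      using low[of n] by (simp add: mult_ac)
    then show ?thesis by (subst (asm) mult_le_cancel_left_pos) auto
  qed
  moreover have "(\<lambda>n. 2 * (\<tau> * x) powr p * (exp (a * n * p) * ?E n)) \<longlonglongrightarrow> 2 * (\<tau> * x) powr p * 0"
    by (intro tendsto_mult tendsto_const lim)
  ultimately have "\<delta> * U x \<le> 2 * (\<tau> * x) powr p * 0"
    by (intro LIMSEQ_le_const) auto
  then show False using \<delta> x by (simp add: mult_le_0_iff not_le)
qed

end

section \<open>The main theorem\<close>

lemma in_Lp_add: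
  assumes "in_Lp M p X" "in_Lp M p Y" "0 \<le> p"
  shows "in_Lp M p (\<lambda>\<omega>. X \<omega> + Y \<omega>)"
proof -
  have [measurable]: "X \<in> borel_measurable M" "Y \<in> borel_measurable M" using assms by (auto simp: in_Lp_def)
  have "(\<integral>\<^sup>+ \<omega>. ennreal (\<bar>X \<omega> + Y \<omega>\<bar> powr p) \<partial>M) \<le>
      (\<integral>\<^sup>+ \<omega>. ennreal (2 powr p) * (ennreal (\<bar>X \<omega>\<bar> powr p) + ennreal (\<bar>Y \<omega>\<bar> powr p)) \<partial>M)"
    using abs_add_powr_le[OF assms(3)]
    by (intro nn_integral_mono) (auto simp: ennreal_mult[symmetric] ennreal_plus[symmetric] simp del: ennreal_plus intro!: ennreal_leI)
  also have "\<dots> = ennreal (2 powr p) * ((\<integral>\<^sup>+ \<omega>. ennreal (\<bar>X \<omega>\<bar> powr p) \<partial>M) + (\<integral>\<^sup>+ \<omega>. ennreal (\<bar>Y \<omega>\<bar> powr p) \<partial>M))"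
    by (simp add: nn_integral_cmult nn_integral_add)
  also have "\<dots> < \<infinity>" using assms by (auto simp: in_Lp_def ennreal_mult_less_top)
  finally show ?thesis by (simp add: in_Lp_def)
qed

lemma nn_integral_powr_cmult:
  assumes [measurable]: "X \<in> borel_measurable M"
  shows "(\<integral>\<^sup>+ \<omega>. ennreal (\<bar>c * X \<omega>\<bar> powr p) \<partial>M) = ennreal (\<bar>c\<bar> powr p) * (\<integral>\<^sup>+ \<omega>. ennreal (\<bar>X \<omega>\<bar> powr p) \<partial>M)"
  by (simp add: abs_mult powr_mult ennreal_mult nn_integral_cmult)

lemma in_Lp_cmult: "in_Lp M p X \<Longrightarrow> in_Lp M p (\<lambda>\<omega>. c * X \<omega>)"
  by (auto simp: in_Lp_def nn_integral_powr_cmult ennreal_mult_less_top)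

lemma in_Lp_diff: "\<lbrakk>in_Lp M p X; in_Lp M p Y; 0 \<le> p\<rbrakk> \<Longrightarrow> in_Lp M p (\<lambda>\<omega>. X \<omega> - Y \<omega>)"
  using in_Lp_add[of M p X "\<lambda>\<omega>. -1 * Y \<omega>"] in_Lp_cmult[of M p Y "-1"] by simp

lemma (in prob_space) in_Lp_const: "in_Lp M p (\<lambda>_. c)"
  by (simp add: in_Lp_def emeasure_space_1)

text \<open>The scalar \<open>c\<close> is -1 for the difference of consecutive partial sums and
  \<open>- exp (- a)\<close> for the elimination of \<open>W\<close>.\<close>

lemma Lp_null_add:
  assumes [measurable]: "\<And>n. F n \<in> borel_measurable M" "\<And>n. G n \<in> borel_measurable M" and p: "0 \<le> p"
    and "(\<lambda>n. \<integral>\<^sup>+ \<omega>. ennreal (\<bar>F n \<omega>\<bar> powr p) \<partial>M) \<longlonglongrightarrow> 0" "(\<lambda>n. \<integral>\<^sup>+ \<omega>. ennreal (\<bar>G n \<omega>\<bar> powr p) \<partial>M) \<longlonglongrightarrow> 0"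
  shows "(\<lambda>n. \<integral>\<^sup>+ \<omega>. ennreal (\<bar>F n \<omega> + c * G n \<omega>\<bar> powr p) \<partial>M) \<longlonglongrightarrow> 0"
proof (rule tendsto_sandwich[where f = "\<lambda>_. 0"])
  let ?I = "\<lambda>F. \<integral>\<^sup>+ \<omega>. ennreal (\<bar>F \<omega>\<bar> powr p) \<partial>M"
  have "?I (\<lambda>\<omega>. F n \<omega> + c * G n \<omega>) \<le> ennreal (2 powr p) * (?I (F n) + ennreal (\<bar>c\<bar> powr p) * ?I (G n))" for n
  proof -
    have "?I (\<lambda>\<omega>. F n \<omega> + c * G n \<omega>) \<le>
        (\<integral>\<^sup>+ \<omega>. ennreal (2 powr p) * (ennreal (\<bar>F n \<omega>\<bar> powr p) + ennreal (\<bar>c * G n \<omega>\<bar> powr p)) \<partial>M)"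
      using abs_add_powr_le[OF p]
      by (intro nn_integral_mono) (auto simp: ennreal_mult[symmetric] ennreal_plus[symmetric] simp del: ennreal_plus intro!: ennreal_leI)
    also have "\<dots> = ennreal (2 powr p) * (?I (F n) + ?I (\<lambda>\<omega>. c * G n \<omega>))"
      by (simp add: nn_integral_cmult nn_integral_add)
    finally show ?thesis by (simp only: nn_integral_powr_cmult assms(2))
  qed
  then show "\<forall>\<^sub>F n in sequentially. ?I (\<lambda>\<omega>. F n \<omega> + c * G n \<omega>) \<le> ennreal (2 powr p) * (?I (F n) + ennreal (\<bar>c\<bar> powr p) * ?I (G n))"
    by simp
  have "(\<lambda>n. ennreal (2 powr p) * (?I (F n) + ennreal (\<bar>c\<bar> powr p) * ?I (G n))) \<longlonglongrightarrow> ennreal (2 powr p) * (0 + ennreal (\<bar>c\<bar> powr p) * 0)"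
    using assms(4,5) by (intro tendsto_add tendsto_const ennreal_tendsto_cmult) auto
  then show "(\<lambda>n. ennreal (2 powr p) * (?I (F n) + ennreal (\<bar>c\<bar> powr p) * ?I (G n))) \<longlonglongrightarrow> 0" by simp
qed auto

text \<open>\<open>\<rho>\<close> is taken strictly between \<open>m^(1/r)\<close> and
  \<open>exp (- a)\<close>, hence positive even for \<open>m = 0\<close>.\<close>

lemma ennreal_powr_mult_less_1:
  assumes "r > 0" and "ennreal (exp a) * ennreal_powr m (1 / r) < 1"
  obtains \<rho> where "0 < \<rho>" "exp a * \<rho> < 1" "m \<le> ennreal (\<rho> powr r)"
proof -
  have "m \<noteq> \<infinity>" using assms(2) by (auto simp: ennreal_powr_def ennreal_mult_top)
  then obtain x where x: "x \<ge> 0" "m = ennreal x" by (cases m) auto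
  then have "ennreal (exp a * x powr (1 / r)) < ennreal 1"
    using assms(2) by (simp add: ennreal_powr_def ennreal_mult)
  then have "exp a * x powr (1 / r) < 1" by (simp add: ennreal_less_iff)
  then have "x powr (1 / r) < exp (- a)" by (simp add: exp_minus field_simps)
  then obtain \<rho> where \<rho>: "x powr (1 / r) < \<rho>" "\<rho> < exp (- a)" using dense by blast
  show ?thesis
  proof
    show "0 < \<rho>" using \<rho>(1) powr_ge_zero[of x "1 / r"] by linarith
    show "exp a * \<rho> < 1" using \<rho>(2) by (simp add: exp_minus field_simps)
    have "x = (x powr (1 / r)) powr r" using x assms(1) by (simp add: powr_powr)
    also have "\<dots> \<le> \<rho> powr r" using \<rho>(1) assms(1) by (intro powr_mono2) auto
    finally show "m \<le> ennreal (\<rho> powr r)" unfolding x(2) by (rule ennreal_leI)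
  qed
qed

text \<open>Raising to the power \<open>r\<close> gives \<open>y^r\<close> on the left, which is at
  least \<open>y\<close> because \<open>y \<ge> 1\<close>; thus one \<open>y\<close> serves all
  \<open>r\<close>.\<close>

lemma less_ennreal_powr_mult:
  assumes "1 \<le> r" "1 \<le> y" and "ennreal y \<le> ennreal (exp a) * ennreal_powr m (1 / r)"
  shows "ennreal y \<le> ennreal (exp (a * r)) * m"
proof (cases "m = \<infinity>")
  case True
  then show ?thesis by (simp add: ennreal_mult_top)
next
  case False
  then obtain x where x: "x \<ge> 0" "m = ennreal x" by (cases m) auto
  then have "ennreal y \<le> ennreal (exp a * x powr (1 / r))"
    using assms(3) by (simp add: ennreal_powr_def ennreal_mult)
  then have "y \<le> exp a * x powr (1 / r)" by (simp add: ennreal_le_iff)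
  then have "y powr r \<le> (exp a * x powr (1 / r)) powr r" using assms by (intro powr_mono2) auto
  also have "\<dots> = exp (a * r) * x"
    using x assms by (simp add: powr_mult powr_powr) (simp add: powr_def mult.commute)
  finally have "y powr r \<le> exp (a * r) * x" .
  moreover have "y powr 1 \<le> y powr r" using assms by (intro powr_mono) auto
  ultimately have "y \<le> exp (a * r) * x" using assms by simp
  then show ?thesis using x by (simp add: ennreal_mult[symmetric] ennreal_leI)
qed

section \<open>Transfer from the given probability space to the canonical one\<close>

locale normalized_branching_process = weighted_branching_process +
  assumes normalized: "weight_moment M L 1 = 1"
begin

definition weights_law :: "(nat \<Rightarrow> real) measure" where
  "weights_law = distr M (Pi\<^sub>M UNIV (\<lambda>_. borel)) (\<lambda>\<omega> i. L [] i \<omega>)"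

definition weights_env :: "'a \<Rightarrow> nat list \<Rightarrow> nat \<Rightarrow> real" where
  "weights_env \<omega> = (\<lambda>v i. L v i \<omega>)"

lemma measurable_weights: "(\<lambda>\<omega> i. L v i \<omega>) \<in> M \<rightarrow>\<^sub>M Pi\<^sub>M UNIV (\<lambda>_. borel)"
  using indep_weights by (auto simp: indep_vars_def)

sublocale law: weight_law weights_law
proof (intro weight_law.intro weight_law_axioms.intro)
  show "prob_space weights_law"
    unfolding weights_law_def by (rule prob_space_distr[OF measurable_weights])
qed (simp add: weights_law_def)

lemma sets_env: "sets law.env = sets (Pi\<^sub>M UNIV (\<lambda>_. Pi\<^sub>M UNIV (\<lambda>_. borel)))"
  unfolding law.env_def by (intro sets_PiM_cong refl law.sets_N)

text \<open>Independence of the families together with their common law says precisely that the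
  joint law is a product of copies of \<open>weights_law\<close>.\<close>

lemma distr_weights_env: "distr M law.env weights_env = law.env"
proof -
  have "distr M (\<Pi>\<^sub>M v\<in>UNIV. Pi\<^sub>M UNIV (\<lambda>_. borel)) (\<lambda>x. \<lambda>v\<in>UNIV. (\<lambda>i. L v i x)) =
      (\<Pi>\<^sub>M v\<in>UNIV. distr M (Pi\<^sub>M UNIV (\<lambda>_. borel)) (\<lambda>\<omega> i. L v i \<omega>))"
    using indep_weights by (subst indep_vars_iff_distr_eq_PiM[symmetric]) (auto simp: measurable_weights)
  also have "\<dots> = law.env"
    unfolding law.env_def by (intro PiM_cong refl) (unfold weights_law_def, rule identically_distributed_weights)
  finally have "distr M (\<Pi>\<^sub>M v\<in>UNIV. Pi\<^sub>M UNIV (\<lambda>_. borel)) weights_env = law.env"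
    by (simp add: weights_env_def[abs_def] restrict_UNIV)
  moreover have "distr M law.env weights_env = distr M (\<Pi>\<^sub>M v\<in>UNIV. Pi\<^sub>M UNIV (\<lambda>_. borel)) weights_env"
    by (intro distr_cong) (auto simp: sets_env)
  ultimately show ?thesis by simp
qed

lemma measurable_weights_env [measurable]: "weights_env \<in> M \<rightarrow>\<^sub>M law.env"
proof -
  have "weights_env \<in> M \<rightarrow>\<^sub>M (\<Pi>\<^sub>M v\<in>UNIV. Pi\<^sub>M UNIV (\<lambda>_. borel))"
    unfolding weights_env_def by (rule measurable_PiM_single') (auto simp: measurable_weights space_PiM)
  then show ?thesis using measurable_cong_sets[OF refl sets_env] by blast
qed

lemma nn_integral_weights_env:
  "f \<in> borel_measurable law.env \<Longrightarrow> (\<integral>\<^sup>+ \<omega>. f (weights_env \<omega>) \<partial>M) = (\<integral>\<^sup>+ e. f e \<partial>law.env)"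
  using nn_integral_distr[OF measurable_weights_env, of f] by (simp add: distr_weights_env)

lemma nn_integral_weights_root:
  "f \<in> borel_measurable weights_law \<Longrightarrow> (\<integral>\<^sup>+ \<omega>. f (weights_env \<omega> []) \<partial>M) = (\<integral>\<^sup>+ z. f z \<partial>weights_law)"
  unfolding weights_env_def using measurable_cong_sets[OF law.sets_N refl, of borel]
  by (auto simp: weights_law_def nn_integral_distr measurable_weights)

text \<open>Nonnegativity on \<open>space M\<close> makes the clipping in \<open>env_weight\<close>
  invisible.\<close>

lemma path_weight_eq: "\<omega> \<in> space M \<Longrightarrow> path_weight L v \<omega> = node_weight v (weights_env \<omega>)"
  by (induction v rule: rev_induct) (auto simp: env_weight_def weights_env_def weight_nonneg max_def)

lemma generation_sum_eq: "\<omega> \<in> space M \<Longrightarrow> generation_sum L n \<omega> = population n (weights_env \<omega>)"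
  unfolding generation_sum_def by (simp add: path_weight_eq)

lemma weight_moment_eq: "weight_moment M L r = law.moment r"
proof -
  have meas: "(\<lambda>e. \<integral>\<^sup>+ v. ennreal (node_weight v e powr r) \<partial>count_space {v. length v = 1}) \<in> borel_measurable law.env"
    by (intro borel_measurable_nn_integral_count_space) measurable
  have "weight_moment M L r =
      (\<integral>\<^sup>+ \<omega>. \<integral>\<^sup>+ v. ennreal (node_weight v (weights_env \<omega>) powr r) \<partial>count_space {v. length v = 1} \<partial>M)"
    unfolding weight_moment_def by (intro nn_integral_cong) (simp add: path_weight_eq)
  also have "\<dots> = law.moment r ^ 1"
    unfolding law.nn_integral_generation_powr[symmetric] by (rule nn_integral_weights_env[OF meas])
  finally show ?thesis by simp
qed

sublocale law: normalized_weight_law weights_law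
  using normalized by unfold_locales (simp add: weight_moment_eq)

abbreviation martingale where "martingale \<equiv> intrinsic_martingale M L"

lemma martingale_eq: "\<omega> \<in> space M \<Longrightarrow> martingale n \<omega> = enn2real (population n (weights_env \<omega>))"
  by (simp add: intrinsic_martingale_def generation_sum_eq normalized divide_ennreal_def)

lemma measurable_martingale [measurable]: "martingale n \<in> borel_measurable M"
proof -
  have "(\<lambda>\<omega>. enn2real (population n (weights_env \<omega>))) \<in> borel_measurable M" by measurable
  then show ?thesis by (subst measurable_cong[OF martingale_eq])
qed

lemma martingale_nonneg: "0 \<le> martingale n \<omega>"
  by (simp add: intrinsic_martingale_def)

lemma martingale_0: "\<omega> \<in> space M \<Longrightarrow> martingale 0 \<omega> = 1"
  by (simp add: martingale_eq)

lemma martingale_1: "\<omega> \<in> space M \<Longrightarrow> martingale 1 \<omega> = centred_total (weights_env \<omega> []) + 1"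
proof -
  have "{v::nat list. length v = 0} = {[]}" by auto
  then have "population 1 e = total_weight (e [])" for e
    using population_Suc[of 0 e] by (simp add: nn_integral_count_space_finite)
  then show "\<omega> \<in> space M \<Longrightarrow> ?thesis" by (simp add: martingale_eq centred_total_def)
qed

lemma martingale_diff:
  "\<omega> \<in> space M \<Longrightarrow> martingale (Suc n) \<omega> - martingale n \<omega> = increment n (weights_env \<omega>)"
  by (simp add: martingale_eq increment_def)

lemma nn_integral_martingale_diff:
  "(\<integral>\<^sup>+ \<omega>. ennreal (\<bar>martingale (Suc n) \<omega> - martingale n \<omega>\<bar> powr p) \<partial>M) =
    (\<integral>\<^sup>+ e. ennreal (\<bar>increment n e\<bar> powr p) \<partial>law.env)"
proof -
  have "(\<integral>\<^sup>+ \<omega>. ennreal (\<bar>martingale (Suc n) \<omega> - martingale n \<omega>\<bar> powr p) \<partial>M) =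
      (\<integral>\<^sup>+ \<omega>. ennreal (\<bar>increment n (weights_env \<omega>)\<bar> powr p) \<partial>M)"
    by (intro nn_integral_cong) (simp add: martingale_diff)
  also have "\<dots> = (\<integral>\<^sup>+ e. ennreal (\<bar>increment n e\<bar> powr p) \<partial>law.env)"
    by (rule nn_integral_weights_env) measurable
  finally show ?thesis .
qed

lemma series_converges:
  assumes [measurable]: "W \<in> borel_measurable M" and lim: "AE \<omega> in M. (\<lambda>n. martingale n \<omega>) \<longlonglongrightarrow> W \<omega>"
    and a: "a > 0" and p: "1 < p" "p < 2" and r: "r \<in> {p..2}"
    and W1: "(\<integral>\<^sup>+ \<omega>. ennreal (martingale 1 \<omega> powr r) \<partial>M) < \<infinity>"
    and contr: "ennreal (exp a) * ennreal_powr (weight_moment M L r) (1 / r) < 1"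
  shows "converges_in_Lp M p (\<lambda>N \<omega>. \<Sum>n<N. exp (a * real n) * (W \<omega> - martingale n \<omega>))"
    and "AE \<omega> in M. summable (\<lambda>n. exp (a * real n) * (W \<omega> - martingale n \<omega>))"
proof -
  have r': "1 < r" "r \<le> 2" "p \<le> r" "0 < r" using r p by auto
  obtain \<rho> where \<rho>: "0 < \<rho>" "exp a * \<rho> < 1" "law.moment r \<le> ennreal (\<rho> powr r)"
    using ennreal_powr_mult_less_1[OF \<open>0 < r\<close> contr] unfolding weight_moment_eq by blast
  have "in_Lp M r (martingale 1)" using W1 by (simp add: in_Lp_def martingale_nonneg)
  from in_Lp_diff[OF this in_Lp_const[of r 1]] r'
  have "(\<integral>\<^sup>+ \<omega>. ennreal (\<bar>martingale 1 \<omega> - 1\<bar> powr r) \<partial>M) < \<infinity>" by (simp add: in_Lp_def)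
  also have "(\<integral>\<^sup>+ \<omega>. ennreal (\<bar>martingale 1 \<omega> - 1\<bar> powr r) \<partial>M) =
      (\<integral>\<^sup>+ \<omega>. ennreal (\<bar>centred_total (weights_env \<omega> [])\<bar> powr r) \<partial>M)"
    by (intro nn_integral_cong) (simp add: martingale_1[simplified])
  also have "\<dots> = (\<integral>\<^sup>+ z. ennreal (\<bar>centred_total z\<bar> powr r) \<partial>weights_law)"
    by (rule nn_integral_weights_root) measurable
  finally have \<xi>: "integrable weights_law (\<lambda>z. \<bar>centred_total z\<bar> powr r)"
    by (intro integrableI_nonneg) auto
  define C where "C = 4 * (\<integral> z. \<bar>centred_total z\<bar> powr r \<partial>weights_law)"
  have C: "C \<ge> 0" unfolding C_def by (auto intro!: integral_nonneg_AE)
  have bound: "(\<integral>\<^sup>+ \<omega>. ennreal (\<bar>martingale (Suc n) \<omega> - martingale n \<omega>\<bar> powr p) \<partial>M) \<le> ennreal (1 + C) * ennreal ((\<rho> powr p) ^ n)" for n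
  proof -
    \<comment> \<open>Up to a constant, \<open>\<rho> ^ n\<close> bounds the \<open>L_r\<close> norm
      of the increment, so splitting at this level lowers the order from \<open>r\<close> to
      \<open>p\<close> and keeps the rate \<open>\<rho>\<close>.\<close>
    let ?c = "\<rho> ^ n"
    have c: "?c > 0" using \<rho> by simp
    have cp: "?c powr s = (\<rho> powr s) ^ n" for s
      using \<rho> by (simp add: powr_realpow[symmetric] powr_powr mult.commute)
    have "(\<integral>\<^sup>+ e. ennreal (\<bar>increment n e\<bar> powr p) \<partial>law.env) \<le>
        (\<integral>\<^sup>+ e. ennreal (?c powr p) + ennreal (?c powr (p - r)) * ennreal (\<bar>increment n e\<bar> powr r) \<partial>law.env)"
      using powr_le_powr_add_powr[OF abs_ge_zero c, of p r] p r'
      by (intro nn_integral_mono) (auto simp: ennreal_mult[symmetric] ennreal_plus[symmetric] simp del: ennreal_plus intro!: ennreal_leI)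
    also have "\<dots> = ennreal (?c powr p) + ennreal (?c powr (p - r)) * (\<integral>\<^sup>+ e. ennreal (\<bar>increment n e\<bar> powr r) \<partial>law.env)"
      by (simp add: nn_integral_add nn_integral_cmult law.env.emeasure_space_1[simplified])
    also have "\<dots> \<le> ennreal (?c powr p) + ennreal (?c powr (p - r)) * (ennreal C * ennreal (?c powr r))"
    proof -
      have "(\<integral>\<^sup>+ e. ennreal (\<bar>increment n e\<bar> powr r) \<partial>law.env) \<le> ennreal C * law.moment r ^ n"
        unfolding C_def using law.increment_moment_le[OF r'(1,2) \<xi>] \<rho>(3) by (simp add: le_less_trans)
      also have "\<dots> \<le> ennreal C * ennreal (\<rho> powr r) ^ n"
        using \<rho>(3) by (intro mult_left_mono power_mono) auto
      finally have "(\<integral>\<^sup>+ e. ennreal (\<bar>increment n e\<bar> powr r) \<partial>law.env) \<le> ennreal C * ennreal (?c powr r)"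
        by (simp add: cp ennreal_power)
      then show ?thesis by (intro add_left_mono mult_left_mono) auto
    qed
    also have "\<dots> = ennreal (?c powr p + ?c powr (p - r) * (C * ?c powr r))"
      using C by (simp add: ennreal_mult)
    also have "?c powr p + ?c powr (p - r) * (C * ?c powr r) = (1 + C) * (\<rho> powr p) ^ n"
    proof -
      have "?c powr (p - r) * ?c powr r = ?c powr p" by (simp add: powr_add[symmetric])
      then have "?c powr (p - r) * (C * ?c powr r) = C * ?c powr p" by (metis mult.left_commute)
      then show ?thesis by (simp add: cp algebra_simps)
    qed
    finally show ?thesis using C by (simp add: nn_integral_martingale_diff ennreal_mult)
  qed
  note conv = exponentially_weighted_series_converges[OF measurable_martingale assms(1) lim a less_imp_le[OF p(1)] \<rho>(1,2) _ bound]
  show "converges_in_Lp M p (\<lambda>N \<omega>. \<Sum>n<N. exp (a * real n) * (W \<omega> - martingale n \<omega>))"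
    and "AE \<omega> in M. summable (\<lambda>n. exp (a * real n) * (W \<omega> - martingale n \<omega>))"
    using conv by auto
qed

lemma series_converges_imp:
  assumes [measurable]: "W \<in> borel_measurable M"
    and nz: "measure M {\<omega> \<in> space M. martingale 1 \<omega> = 1} < 1"
    and p: "1 < p" "p < 2"
    and conv: "converges_in_Lp M p (\<lambda>N \<omega>. \<Sum>n<N. exp (a * real n) * (W \<omega> - martingale n \<omega>))"
  shows "(\<integral>\<^sup>+ \<omega>. ennreal (martingale 1 \<omega> powr p) \<partial>M) < \<infinity>"
    and "(INF r\<in>{p..2}. ennreal (exp a) * ennreal_powr (weight_moment M L r) (1 / r)) \<le> 1"
proof -
  define S where "S N \<omega> = (\<Sum>n<N. exp (a * real n) * (W \<omega> - martingale n \<omega>))" for N \<omega>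
  have [measurable]: "S n \<in> borel_measurable M" for n unfolding S_def by measurable
  obtain Y where S: "\<And>n. in_Lp M p (S n)" and Y: "in_Lp M p Y"
    and lim: "(\<lambda>n. \<integral>\<^sup>+ \<omega>. ennreal (\<bar>S n \<omega> - Y \<omega>\<bar> powr p) \<partial>M) \<longlonglongrightarrow> 0"
    using conv unfolding converges_in_Lp_def S_def[symmetric] by blast
  have [measurable]: "Y \<in> borel_measurable M" using Y by (simp add: in_Lp_def)
  have p0: "0 \<le> p" using p by simp
  define D where "D n \<omega> = exp (a * real n) * (W \<omega> - martingale n \<omega>)" for n \<omega>
  have [measurable]: "D n \<in> borel_measurable M" for n unfolding D_def by measurable
  have D: "D n \<omega> = (S (Suc n) \<omega> - Y \<omega>) + (-1) * (S n \<omega> - Y \<omega>)" for n \<omega>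
    by (simp add: S_def D_def)
  have D_Lp: "in_Lp M p (D n)" for n
    using in_Lp_diff[OF S[of "Suc n"] S[of n] p0] by (simp add: S_def D_def[abs_def])
  have D_lim: "(\<lambda>n. \<integral>\<^sup>+ \<omega>. ennreal (\<bar>D n \<omega>\<bar> powr p) \<partial>M) \<longlonglongrightarrow> 0"
    unfolding D using lim p0 by (intro Lp_null_add) (auto intro: LIMSEQ_Suc)
  \<comment> \<open>The combination in which \<open>W\<close> cancels, leaving the increment
    weighted by \<open>exp (a * real n)\<close>.\<close>
  define I where "I n \<omega> = D n \<omega> + (- exp (- a)) * D (Suc n) \<omega>" for n \<omega>
  have I: "I n \<omega> = exp (a * real n) * (martingale (Suc n) \<omega> - martingale n \<omega>)" for n \<omega>
  proof -
    have "exp (- a) * exp (a * real (Suc n)) = exp (a * real n)"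
      by (simp add: exp_add[symmetric] algebra_simps)
    then have "exp (- a) * D (Suc n) \<omega> = exp (a * real n) * (W \<omega> - martingale (Suc n) \<omega>)"
      by (simp add: D_def mult.assoc[symmetric])
    then show ?thesis by (simp add: I_def D_def algebra_simps)
  qed
  have I_lim: "(\<lambda>n. \<integral>\<^sup>+ \<omega>. ennreal (\<bar>I n \<omega>\<bar> powr p) \<partial>M) \<longlonglongrightarrow> 0"
    unfolding I_def using D_lim p0 by (intro Lp_null_add) (auto intro: LIMSEQ_Suc[of "\<lambda>n. \<integral>\<^sup>+ \<omega>. ennreal (\<bar>D n \<omega>\<bar> powr p) \<partial>M"])
  have I_Lp: "in_Lp M p (I n)" for n
    unfolding I_def by (intro in_Lp_add in_Lp_cmult D_Lp p0)
  have env_eq: "(\<integral>\<^sup>+ \<omega>. ennreal (\<bar>I n \<omega>\<bar> powr p) \<partial>M) =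
      ennreal (exp (a * real n) powr p) * (\<integral>\<^sup>+ e. ennreal (\<bar>increment n e\<bar> powr p) \<partial>law.env)" for n
    unfolding I by (subst nn_integral_powr_cmult) (auto simp: nn_integral_martingale_diff)
  have int: "integrable law.env (\<lambda>e. \<bar>increment n e\<bar> powr p)" for n
  proof (rule integrableI_nonneg)
    show "(\<integral>\<^sup>+ e. ennreal (\<bar>increment n e\<bar> powr p) \<partial>law.env) < \<infinity>"
      using I_Lp[of n] unfolding in_Lp_def env_eq by (auto simp: ennreal_mult_less_top)
  qed auto
  \<comment> \<open>At \<open>n = 0\<close> the weighted increment is \<open>W_1 - 1\<close>, whence
    the moment of \<open>W_1\<close>.\<close>
  have "in_Lp M p (\<lambda>\<omega>. I 0 \<omega> + 1)" by (intro in_Lp_add I_Lp in_Lp_const p0)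
  then have "(\<integral>\<^sup>+ \<omega>. ennreal (\<bar>I 0 \<omega> + 1\<bar> powr p) \<partial>M) < \<infinity>" by (simp add: in_Lp_def)
  also have "(\<integral>\<^sup>+ \<omega>. ennreal (\<bar>I 0 \<omega> + 1\<bar> powr p) \<partial>M) = (\<integral>\<^sup>+ \<omega>. ennreal (martingale 1 \<omega> powr p) \<partial>M)"
    by (intro nn_integral_cong) (simp add: I martingale_0 martingale_nonneg)
  finally show "(\<integral>\<^sup>+ \<omega>. ennreal (martingale 1 \<omega> powr p) \<partial>M) < \<infinity>" .
  have nz': "\<not> (AE z in weights_law. centred_total z = 0)"
  proof
    assume "AE z in weights_law. centred_total z = 0"
    then have "AE \<omega> in M. centred_total (weights_env \<omega> []) = 0"
      unfolding weights_law_def weights_env_def by (rule AE_distrD[OF measurable_weights])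
    then have "AE \<omega> in M. martingale 1 \<omega> = 1"
      by (rule AE_mp) (auto simp: martingale_1[simplified] intro!: AE_I2)
    then have "measure M {\<omega> \<in> space M. martingale 1 \<omega> = 1} = 1"
      by (intro prob_Collect_eq_1[THEN iffD2]) auto
    then show False using nz by simp
  qed
  show "(INF r\<in>{p..2}. ennreal (exp a) * ennreal_powr (weight_moment M L r) (1 / r)) \<le> 1"
  proof (rule ccontr)
    assume "\<not> ?thesis"
    then have "1 < (INF r\<in>{p..2}. ennreal (exp a) * ennreal_powr (weight_moment M L r) (1 / r))" by (simp add: not_le)
    \<comment> \<open>A number strictly between 1 and the infimum gives a lower bound uniform in
      \<open>r\<close>, as the truncation needs.\<close>
    then obtain y' where y': "1 < y'" "y' < (INF r\<in>{p..2}. ennreal (exp a) * ennreal_powr (weight_moment M L r) (1 / r))"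
      using dense by blast
    then have "y' \<noteq> \<infinity>" by auto
    then obtain y where y: "y' = ennreal y" "y \<ge> 0" by (cases y') auto
    have y1: "1 < y" using y'(1) unfolding y(1) by (simp add: ennreal_less_iff[of 1, simplified])
    have "ennreal y \<le> ennreal (exp (a * r)) * law.moment r" if r: "r \<in> {p..2}" for r
    proof (rule less_ennreal_powr_mult)
      show "ennreal y \<le> ennreal (exp a) * ennreal_powr (law.moment r) (1 / r)"
        using y'(2) INF_lower[OF r, of "\<lambda>r. ennreal (exp a) * ennreal_powr (weight_moment M L r) (1 / r)"]
        unfolding y(1) by (auto simp: weight_moment_eq)
    qed (use r p y1 in auto)
    from law.increments_not_small[OF p y1 this nz' int]
    have "\<not> (\<lambda>n. exp (a * real n * p) * (\<integral> e. \<bar>increment n e\<bar> powr p \<partial>law.env)) \<longlonglongrightarrow> 0" by simp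
    moreover have "(\<lambda>n. exp (a * real n * p) * (\<integral> e. \<bar>increment n e\<bar> powr p \<partial>law.env)) \<longlonglongrightarrow> 0"
    proof -
      have "(\<integral>\<^sup>+ \<omega>. ennreal (\<bar>I n \<omega>\<bar> powr p) \<partial>M) = ennreal (exp (a * real n * p) * (\<integral> e. \<bar>increment n e\<bar> powr p \<partial>law.env))" for n
        unfolding env_eq using int[of n]
        by (subst nn_integral_eq_integral) (auto simp: ennreal_mult powr_def mult_ac)
      with I_lim have "(\<lambda>n. ennreal (exp (a * real n * p) * (\<integral> e. \<bar>increment n e\<bar> powr p \<partial>law.env))) \<longlonglongrightarrow> ennreal 0" by simp
      then show ?thesis by (rule tendsto_ennrealD) auto
    qed
    ultimately show False by simp
  qed
qed

end

theorem theorem1p2: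
  fixes M :: "'a measure" and L :: "nat list \<Rightarrow> nat \<Rightarrow> 'a \<Rightarrow> real"
    and W :: "'a \<Rightarrow> real" and a p :: real
  assumes "weighted_branching_process M L"
    and supercritical: "(\<integral>\<^sup>+ \<omega>. offspring_number L \<omega> \<partial>M) > 1"
    and normalized: "weight_moment M L 1 = 1"
    and "W \<in> borel_measurable M"
    and "AE \<omega> in M. (\<lambda>n. intrinsic_martingale M L n \<omega>) \<longlonglongrightarrow> W \<omega>"
    and "measure M {\<omega> \<in> space M. intrinsic_martingale M L 1 \<omega> = 1} < 1"
    and "a > 0" and "1 < p" and "p < 2"
  shows
    "((\<exists>r\<in>{p..2}.
         (\<integral>\<^sup>+ \<omega>. ennreal (intrinsic_martingale M L 1 \<omega> powr r) \<partial>M) < \<infinity> \<and>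
         ennreal (exp a) * ennreal_powr (weight_moment M L r) (1 / r) < 1)
      \<longrightarrow>
        converges_in_Lp M p
          (\<lambda>N \<omega>. \<Sum>n<N. exp (a * real n) * (W \<omega> - intrinsic_martingale M L n \<omega>)) \<and>
        (AE \<omega> in M. summable (\<lambda>n. exp (a * real n) * (W \<omega> - intrinsic_martingale M L n \<omega>))))
     \<and>
     (converges_in_Lp M p
        (\<lambda>N \<omega>. \<Sum>n<N. exp (a * real n) * (W \<omega> - intrinsic_martingale M L n \<omega>))
      \<longrightarrow>
        (\<integral>\<^sup>+ \<omega>. ennreal (intrinsic_martingale M L 1 \<omega> powr p) \<partial>M) < \<infinity> \<and>
        (INF r\<in>{p..2}. ennreal (exp a) * ennreal_powr (weight_moment M L r) (1 / r)) \<le> 1)"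
proof -
  interpret normalized_branching_process M L
    using assms(1) normalized by (intro normalized_branching_process.intro normalized_branching_process_axioms.intro)
  show ?thesis
    using series_converges[OF assms(4,5,7-9)] series_converges_imp[OF assms(4,6,8,9)] by blast
qed

end
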